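(* Let $\lambda>0$. For any $g\in\mathcal{M}_\lambda$ the problem $$\begin{cases}-\operatorname{div}\mathbf{a}(x,\nabla V(x))+\lambda\,\overline{b}(x,V(x))=g(x), & x\in\Omega\\ \mathbf{a}(x,\nabla V)\cdot\nu=0, & x\in\partial\Omega\end{cases}$$ admits a unique weak solution $V\in W^{1,p(x)}(\Omega)$, and $V\in\mathcal{U}$.
   Context: Setting. $\Omega\subset\mathbb{R}^N$, $N\ge 2$, is an open, bounded, connected Lipschitz domain. $p:\overline{\Omega}\to(1,\infty)$ is either log-Hölder continuous with $p^-:=\min_{\overline\Omega}p\ge\frac{2N}{N+2}$, or continuous with $p^->\frac{2N}{N+2}$; put $p^+:=\max_{\overline\Omega}p$ and $p'(x)=\frac{p(x)}{p(x)-1}$. (In both cases $W^{1,p(x)}(\Omega)\hookrightarrow L^2(\Omega)$.) $L^{p(x)}(\Omega)$ is the space of measurable $u$ with $\int_\Omega|u|^{p(x)}dx<\infty$, with the Luxemburg norm $\inf\{\lambda>0:\int_\Omega|u/\lambda|^{p(x)}dx\le1\}$, and $W^{1,p(x)}(\Omega)$ is the corresponding Sobolev space of $u\in L^{p(x)}(\Omega)$ with $|\nabla u|\in L^{p(x)}(\Omega)$, with its usual norm. $\Psi:\overline{\Omega}\times(0,\infty)\to(0,\infty)$ satisfies: $\Psi(\cdot,s)$ is measurable for each $s>0$; for a.a. $x\in\Omega$, $\Psi(x,\cdot)$ is locally absolutely continuous on $(0,\infty)$, $\lim_{s\to0^+}\Psi(x,s)s=0$, and $s\mapsto\Psi(x,s)s$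 is strictly increasing on $(0,\infty)$. Put $\mathbf{a}(x,\xi)=\Psi(x,|\xi|)\xi$ for $\xi\in\mathbb{R}^N\setminus\{\mathbf 0\}$, $\mathbf{a}(x,\mathbf 0)=\mathbf 0$; $\Phi(x,s)=\Psi(x,|s|)|s|$ for $s\ne0$, $\Phi(x,0)=0$; $A(x,\xi)=\int_0^{|\xi|}\Phi(x,s)\,ds$. It is assumed that $\Phi(\cdot,v(\cdot))\in L^{p'(x)}(\Omega)$ for every $v\in L^{p(x)}(\Omega)$, and that for any sequence $(V_n)\subset W^{1,p(x)}(\Omega)$ with $\int_\Omega|\nabla V_n|^{p(x)}dx\to\infty$ one has $\int_\Omega A(x,\nabla V_n)\,dx\to\infty$. $0<\delta_0<\infty$ is a constant and $b:\overline\Omega\times[0,\delta_0]\to[0,\infty)$ is a Carathéodory function (measurable in $x$ for every $s$, continuous in $s$ for a.a. $x$) such that $b(\cdot,0),b(\cdot,\delta_0)\in L^2(\Omega)$ and $s\mapsto b(x,s)$ is strictly increasing on $[0,\delta_0]$ for a.a. $x\in\Omega$. Its extension $\overline b:\overline\Omega\times\mathbb{R}\to\mathbb{R}$ is $\overline b(x,s)=b(x,0)+s$ for $s<0$, $\overline b(x,s)=b(x,s)$ for $s\in[0,\delta_0]$, $\overline b(x,s)=b(x,\delta_0)+s-\delta_0$ for $s>\delta_0$. Notation. $\mathcal{U}=\{U\in L^\infty(\Omega): 0\le U\le\delta_0\text{ a.e. on }\Omega\}$. For $\lambda>0$, $\mathcal{M}_\lambda=\{g\in L^\infty(\Omega):\lambda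 b(x,0)\le g(x)\le\lambda b(x,\delta_0)\text{ for a.a. }x\in\Omega\}$. Definition. $V\in W^{1,p(x)}(\Omega)$ is a weak solution of the problem in the claim if for every $\phi\in W^{1,p(x)}(\Omega)$: $$\int_\Omega\mathbf{a}(x,\nabla V)\cdot\nabla\phi\,dx+\lambda\int_\Omega\overline b(x,V)\phi\,dx=\int_\Omega g\phi\,dx.$$ *)

theory Defs
  imports "HOL-Analysis.Analysis"
begin

section \<open>Domains and exponents\<close>

text \<open>
  Near each boundary point the set is, in suitable orthonormal coordinates, the strict epigraph
  of a Lipschitz function. The unit vector e is the last coordinate direction, and
  \<gamma> depends on the remaining coordinates, i.e. on the orthogonal projection onto the
  complement of e.
\<close>
definition lipschitz_boundary :: "'a::euclidean_space set \<Rightarrow> bool" where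
  "lipschitz_boundary \<Omega> \<longleftrightarrow>
    (\<forall>x\<in>frontier \<Omega>. \<exists>r>0. \<exists>e \<gamma> L. norm e = 1 \<and> L-lipschitz_on {z. z \<bullet> e = 0} \<gamma> \<and>
      \<Omega> \<inter> ball x r = {y \<in> ball x r. \<gamma> (y - (y \<bullet> e) *\<^sub>R e) < y \<bullet> e})"

definition log_holder_on :: "'a::euclidean_space set \<Rightarrow> ('a \<Rightarrow> real) \<Rightarrow> bool" where
  "log_holder_on S p \<longleftrightarrow>
    (\<exists>C. \<forall>x\<in>S. \<forall>y\<in>S. 0 < dist x y \<and> dist x y < 1/2 \<longrightarrow> \<bar>p x - p y\<bar> \<le> - C / ln (dist x y))"

definition conj_exponent :: "('a \<Rightarrow> real) \<Rightarrow> 'a \<Rightarrow> real" where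
  "conj_exponent p x = p x / (p x - 1)"


section \<open>Absolute continuity\<close>

text \<open>
  D is a finite family of non-overlapping subintervals of [a, b], each given by its endpoints.
\<close>
definition abs_continuous_on_Icc :: "real \<Rightarrow> real \<Rightarrow> (real \<Rightarrow> real) \<Rightarrow> bool" where
  "abs_continuous_on_Icc a b f \<longleftrightarrow>
    (\<forall>\<epsilon>>0. \<exists>\<delta>>0. \<forall>D. finite D \<and> (\<forall>(s, t)\<in>D. a \<le> s \<and> s \<le> t \<and> t \<le> b) \<and>
        pairwise (\<lambda>I J. {fst I<..<snd I} \<inter> {fst J<..<snd J} = {}) D \<and>
        (\<Sum>(s, t)\<in>D. t - s) < \<delta>
      \<longrightarrow> (\<Sum>(s, t)\<in>D. \<bar>f t - f s\<bar>) < \<epsilon>)"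

definition locally_abs_continuous_on_pos :: "(real \<Rightarrow> real) \<Rightarrow> bool" where
  "locally_abs_continuous_on_pos f \<longleftrightarrow>
    (\<forall>a b. 0 < a \<and> a \<le> b \<longrightarrow> abs_continuous_on_Icc a b f)"


section \<open>Variable exponent Lebesgue and Sobolev spaces\<close>

text \<open>
  Elements of the function spaces are represented by functions on the whole space; only their
  values on \<Omega> matter, and equality in the spaces is equality almost everywhere on \<Omega>.
\<close>
definition Lp_var :: "'a::euclidean_space set \<Rightarrow> ('a \<Rightarrow> real) \<Rightarrow> ('a \<Rightarrow> real) set" where
  "Lp_var \<Omega> p = {u \<in> borel_measurable (lebesgue_on \<Omega>).
      integrable (lebesgue_on \<Omega>) (\<lambda>x. \<bar>u x\<bar> powr p x)}"

definition Linfty :: "'a::euclidean_space set \<Rightarrow> ('a \<Rightarrow> real) set" where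
  "Linfty \<Omega> = {u \<in> borel_measurable (lebesgue_on \<Omega>).
      \<exists>C. AE x in lebesgue_on \<Omega>. \<bar>u x\<bar> \<le> C}"

primrec C_diff :: "nat \<Rightarrow> ('a::euclidean_space \<Rightarrow> real) \<Rightarrow> bool" where
  "C_diff 0 f \<longleftrightarrow> continuous_on UNIV f"
| "C_diff (Suc k) f \<longleftrightarrow> (\<forall>x. f differentiable (at x)) \<and>
    (\<forall>i\<in>Basis. C_diff k (\<lambda>x. frechet_derivative f (at x) i))"

definition test_functions :: "'a::euclidean_space set \<Rightarrow> ('a \<Rightarrow> real) set" where
  "test_functions \<Omega> = {\<phi>. (\<forall>k. C_diff k \<phi>) \<and>
      compact (closure {x. \<phi> x \<noteq> 0}) \<and> closure {x. \<phi> x \<noteq> 0} \<subseteq> \<Omega>}"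

definition has_weak_gradient ::
    "'a::euclidean_space set \<Rightarrow> ('a \<Rightarrow> real) \<Rightarrow> ('a \<Rightarrow> 'a) \<Rightarrow> bool" where
  "has_weak_gradient \<Omega> u G \<longleftrightarrow>
    (\<forall>K. compact K \<and> K \<subseteq> \<Omega> \<longrightarrow> set_integrable lebesgue K u \<and> set_integrable lebesgue K G) \<and>
    (\<forall>\<phi>\<in>test_functions \<Omega>. \<forall>i\<in>Basis.
      (LINT x|lebesgue_on \<Omega>. u x * frechet_derivative \<phi> (at x) i) =
      - (LINT x|lebesgue_on \<Omega>. (G x \<bullet> i) * \<phi> x))"

text \<open>The weak gradient is determined almost everywhere on an open set; choose a representative.\<close>
definition weak_gradient :: "'a::euclidean_space set \<Rightarrow> ('a \<Rightarrow> real) \<Rightarrow> 'a \<Rightarrow> 'a" where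
  "weak_gradient \<Omega> u = (SOME G. has_weak_gradient \<Omega> u G)"

definition W1p_var :: "'a::euclidean_space set \<Rightarrow> ('a \<Rightarrow> real) \<Rightarrow> ('a \<Rightarrow> real) set" where
  "W1p_var \<Omega> p = {u \<in> Lp_var \<Omega> p.
      \<exists>G. has_weak_gradient \<Omega> u G \<and> (\<lambda>x. norm (G x)) \<in> Lp_var \<Omega> p}"


section \<open>The problem\<close>

definition flux :: "('a::euclidean_space \<Rightarrow> real \<Rightarrow> real) \<Rightarrow> 'a \<Rightarrow> 'a \<Rightarrow> 'a" where
  "flux \<Psi> x \<xi> = (if \<xi> = 0 then 0 else \<Psi> x (norm \<xi>) *\<^sub>R \<xi>)"

definition Phi :: "('a::euclidean_space \<Rightarrow> real \<Rightarrow> real) \<Rightarrow> 'a \<Rightarrow> real \<Rightarrow> real" where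
  "Phi \<Psi> x s = (if s = 0 then 0 else \<Psi> x \<bar>s\<bar> * \<bar>s\<bar>)"

definition potential :: "('a::euclidean_space \<Rightarrow> real \<Rightarrow> real) \<Rightarrow> 'a \<Rightarrow> 'a \<Rightarrow> real" where
  "potential \<Psi> x \<xi> = (LINT s:{0..norm \<xi>}|lborel. Phi \<Psi> x s)"

definition b_ext :: "real \<Rightarrow> ('a \<Rightarrow> real \<Rightarrow> real) \<Rightarrow> 'a \<Rightarrow> real \<Rightarrow> real" where
  "b_ext \<delta>\<^sub>0 b x s =
    (if s < 0 then b x 0 + s else if s \<le> \<delta>\<^sub>0 then b x s else b x \<delta>\<^sub>0 + s - \<delta>\<^sub>0)"

definition U_set :: "'a::euclidean_space set \<Rightarrow> real \<Rightarrow> ('a \<Rightarrow> real) set" where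
  "U_set \<Omega> \<delta>\<^sub>0 = {u \<in> Linfty \<Omega>. AE x in lebesgue_on \<Omega>. 0 \<le> u x \<and> u x \<le> \<delta>\<^sub>0}"

definition M_set ::
    "'a::euclidean_space set \<Rightarrow> real \<Rightarrow> ('a \<Rightarrow> real \<Rightarrow> real) \<Rightarrow> real \<Rightarrow> ('a \<Rightarrow> real) set" where
  "M_set \<Omega> \<delta>\<^sub>0 b lam = {g \<in> Linfty \<Omega>.
      AE x in lebesgue_on \<Omega>. lam * b x 0 \<le> g x \<and> g x \<le> lam * b x \<delta>\<^sub>0}"

definition weak_solution ::
    "'a::euclidean_space set \<Rightarrow> ('a \<Rightarrow> real) \<Rightarrow> ('a \<Rightarrow> real \<Rightarrow> real) \<Rightarrow> real \<Rightarrow> ('a \<Rightarrow> real \<Rightarrow> real)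
      \<Rightarrow> real \<Rightarrow> ('a \<Rightarrow> real) \<Rightarrow> ('a \<Rightarrow> real) \<Rightarrow> bool" where
  "weak_solution \<Omega> p \<Psi> \<delta>\<^sub>0 b lam g V \<longleftrightarrow> V \<in> W1p_var \<Omega> p \<and>
    (\<forall>\<phi>\<in>W1p_var \<Omega> p.
      (LINT x|lebesgue_on \<Omega>. flux \<Psi> x (weak_gradient \<Omega> V x) \<bullet> weak_gradient \<Omega> \<phi> x)
        + lam * (LINT x|lebesgue_on \<Omega>. b_ext \<delta>\<^sub>0 b x (V x) * \<phi> x)
      = (LINT x|lebesgue_on \<Omega>. g x * \<phi> x))"

end

theory Submission
  imports Defs
begin

text \<open>
  The solution minimises the convex functional
  \<open>J V = \<integral> A(x, \<nabla>V) + \<integral> E(x, V)\<close> with \<open>E(x, \<cdot>)\<close> a primitive of \<open>\<lambda> b_ext(x, \<cdot>) - g\<close>, over the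
  functions with \<open>0 \<le> V \<le> \<delta>\<^sub>0\<close>. No weak compactness is needed: along near-minimisers of \<open>J\<close> that
  also nearly minimise \<open>\<integral> V\<^sup>2 + \<integral> sqrt (1 + \<bar>\<nabla>V\<bar>\<^sup>2)\<close>, the explicit strict convexity of the latter
  forces \<open>V\<close> and \<open>\<nabla>V\<close> to converge almost everywhere; bounded modulars make the gradients uniformly
  integrable, and Fatou's lemma gives the minimiser. Truncation to \<open>[0, \<delta>\<^sub>0]\<close> does not increase \<open>J\<close>
  because \<open>g \<in> M_set\<close>, so the minimiser satisfies the Euler equation for all bounded test functions.
  Truncating test functions and using \<open>b \<ge> 0\<close> extends it to the whole space without Sobolev's
  embedding. Uniqueness follows by testing with the truncated difference of two solutions.

  The chain rule for weak gradients that truncation requires comes from difference quotients: along a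
  coordinate direction a weakly differentiable function is the integral of its derivative, so its
  difference quotients converge in the mean.
\<close>

section \<open>Test functions\<close>

text \<open>For almost every x the potential is strictly convex, but no modulus of convexity uniform
  in x is given, so a minimising sequence of \<open>J\<close> alone carries no rate of convergence.
  The second functional supplies an explicit one. Its gradient integrand grows linearly, hence is
  finite along every gradient in the space, and its convexity degenerates only polynomially for
  large gradients; this loss dictates the weights 1/64, 32 and 1/2 in
  \<open>minimiser_exists\<close>. A second obstacle is that the Bochner integral of a
  non-integrable function is 0, so a weak equation has its intended meaning only when its products
  are integrable. Bounded test functions guarantee this, which is why the Euler equation is first
  proved for them and why the difference of two solutions, known only to lie in the Sobolev space,
  is truncated before testing. The growth of the flux is never computed: bounds come from
  \<open>potential \<le> Phi * norm\<close> and Young's inequality. Primitives and gradients are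
  obtained by choice; measurability of the former comes from Riemann sums, and the latter are
  identified through almost everywhere uniqueness.\<close>

lemma C_diff_SucD: "C_diff (Suc k) f \<Longrightarrow> C_diff k f"
proof (induction k arbitrary: f)
  case 0
  then show ?case
    by (simp add: continuous_on_eq_continuous_at differentiable_imp_continuous_within)
next
  case (Suc k)
  then show ?case by auto
qed

lemma C_diff_const: "C_diff k (\<lambda>x. c)"
  by (induction k arbitrary: c) (auto simp: frechet_derivative_const)

lemma C_diff_add: "C_diff k f \<Longrightarrow> C_diff k g \<Longrightarrow> C_diff k (\<lambda>x. f x + g x)"
proof (induction k arbitrary: f g)
  case 0
  then show ?case by (auto intro: continuous_intros)
next
  case (Suc k)
  then have "frechet_derivative (\<lambda>x. f x + g x) (at x)
      = (\<lambda>h. frechet_derivative f (at x) h + frechet_derivative g (at x) h)" for x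
    by (intro frechet_derivative_at[symmetric] has_derivative_add frechet_derivative_works[THEN iffD1]) auto
  with Suc show ?case by auto
qed

lemma C_diff_mult: "C_diff k f \<Longrightarrow> C_diff k g \<Longrightarrow> C_diff k (\<lambda>x. f x * g x)"
proof (induction k arbitrary: f g)
  case 0
  then show ?case by (auto intro: continuous_intros)
next
  case (Suc k)
  then have "frechet_derivative (\<lambda>x. f x * g x) (at x)
      = (\<lambda>h. f x * frechet_derivative g (at x) h + frechet_derivative f (at x) h * g x)" for x
    by (intro frechet_derivative_at[symmetric] has_derivative_mult frechet_derivative_works[THEN iffD1]) auto
  moreover have "C_diff k f" "C_diff k g"
    using Suc.prems by (auto intro: C_diff_SucD simp del: C_diff.simps)
  ultimately show ?case
    using Suc by (auto intro!: C_diff_add)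
qed

lemma C_diff_prod: "finite A \<Longrightarrow> (\<And>i. i \<in> A \<Longrightarrow> C_diff k (f i)) \<Longrightarrow> C_diff k (\<lambda>x. \<Prod>i\<in>A. f i x)"
  by (induction A rule: finite_induct) (auto intro: C_diff_const C_diff_mult)

lemma frechet_derivative_shift:
  fixes f :: "'a::real_normed_vector \<Rightarrow> 'b::real_normed_vector"
  assumes "\<And>x. f differentiable (at x)"
  shows "((\<lambda>x. f (x + v)) has_derivative frechet_derivative f (at (x + v))) (at x)"
proof -
  have "((\<lambda>x. x + v) has_derivative (\<lambda>h. h)) (at x)"
    by (auto intro!: derivative_eq_intros)
  from diff_chain_at[OF this, of f "frechet_derivative f (at (x + v))"] show ?thesis
    using assms frechet_derivative_works by (auto simp: o_def)
qed

lemma C_diff_shift: "C_diff k f \<Longrightarrow> C_diff k (\<lambda>x. f (x + v))"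
proof (induction k arbitrary: f)
  case 0
  then show ?case by (auto intro!: continuous_intros continuous_on_compose2[of UNIV f])
next
  case (Suc k)
  then have der: "((\<lambda>x. f (x + v)) has_derivative frechet_derivative f (at (x + v))) (at x)" for x
    by (intro frechet_derivative_shift) auto
  then have "frechet_derivative (\<lambda>x. f (x + v)) (at x) = frechet_derivative f (at (x + v))" for x
    by (intro frechet_derivative_at[symmetric])
  moreover have "C_diff k (\<lambda>x. frechet_derivative f (at (x + v)) i)" if "i \<in> Basis" for i
    using Suc.IH[of "\<lambda>x. frechet_derivative f (at x) i"] Suc.prems that by auto
  ultimately show ?case using der by (auto simp: differentiable_def)
qed

section \<open>Smooth bumps supported in boxes\<close>

definition flat_exp :: "nat \<Rightarrow> real \<Rightarrow> real" where
  "flat_exp m t = (if t > 0 then (1 / t) ^ m * exp (- (1 / t)) else 0)"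

lemma flat_exp_tendsto_0: "(flat_exp m \<longlongrightarrow> 0) (at 0)"
proof -
  have "((\<lambda>x. x ^ m / exp x) \<longlongrightarrow> (0::real)) at_top"
    by (rule tendsto_power_div_exp_0)
  then have "((\<lambda>t. inverse t ^ m / exp (inverse t)) \<longlongrightarrow> (0::real)) (at_right 0)"
    by (rule filterlim_compose[OF _ filterlim_inverse_at_top_right])
  then have "(flat_exp m \<longlongrightarrow> 0) (at_right 0)"
    by (rule Lim_transform_eventually)
      (auto simp: flat_exp_def eventually_at_right_less exp_minus field_simps inverse_eq_divide
        intro!: eventually_at_rightI[of 0 1])
  moreover have "(flat_exp m \<longlongrightarrow> 0) (at_left 0)"
    by (rule tendsto_eventually) (auto simp: flat_exp_def intro!: eventually_at_leftI[of "-1"])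
  ultimately show ?thesis by (simp add: filterlim_split_at)
qed

text \<open>The family of functions \<open>t^(-m) exp(-1/t)\<close>, continued by 0, is closed under
  differentiation up to linear combinations. Smoothness of every member then follows from one
  induction on the order, carried out for all m at once.\<close>

lemma flat_exp_has_derivative:
  "(flat_exp m has_real_derivative (flat_exp (m + 2) t - real m * flat_exp (m + 1) t)) (at t)"
proof -
  consider "t < 0" | "t = 0" | "t > 0" by linarith
  then show ?thesis
  proof cases
    case 1
    have "((\<lambda>_. 0) has_real_derivative 0) (at t)" by simp
    then have "(flat_exp m has_real_derivative 0) (at t)"
      by (rule has_field_derivative_transform_within_open[of _ _ _ "{..<0}"])
        (use 1 in \<open>auto simp: flat_exp_def\<close>)
    with 1 show ?thesis by (simp add: flat_exp_def)
  next
    case 2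
    \<comment> \<open>At the origin the difference quotient is itself the next member of the family,
      so its limit is already known. The value at \<open>h = 0\<close> agrees because division by 0
      gives 0.\<close>
    have "(\<lambda>h. (flat_exp m (0 + h) - flat_exp m 0) / h) = flat_exp (m + 1)"
      by (auto simp: flat_exp_def fun_eq_iff field_simps)
    then have "(flat_exp m has_real_derivative 0) (at 0)"
      unfolding DERIV_def using flat_exp_tendsto_0[of "m + 1"] by simp
    with 2 show ?thesis by (simp add: flat_exp_def)
  next
    case 3
    have "((\<lambda>t. (1 / t) ^ m * exp (- (1 / t))) has_real_derivative
       (real m * (1 / t) ^ (m - 1) * (- 1 / t ^ 2)) * exp (- (1 / t))
          + (exp (- (1 / t)) * (1 / t ^ 2)) * (1 / t) ^ m) (at t)"
      using 3 by (auto intro!: derivative_eq_intros simp: power2_eq_square)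
    also have "(real m * (1 / t) ^ (m - 1) * (- 1 / t ^ 2)) * exp (- (1 / t))
          + (exp (- (1 / t)) * (1 / t ^ 2)) * (1 / t) ^ m
       = flat_exp (m + 2) t - real m * flat_exp (m + 1) t"
      using 3 by (cases m) (auto simp: flat_exp_def field_simps power2_eq_square)
    finally show ?thesis
      by (rule has_field_derivative_transform_within_open[of _ _ _ "{0<..}"])
        (use 3 in \<open>auto simp: flat_exp_def\<close>)
  qed
qed

lemma C_diff_flat_exp: "C_diff k (\<lambda>x. flat_exp m (x \<bullet> e + c))"
proof (induction k arbitrary: m)
  case 0
  have "isCont (flat_exp m) t" for t
    by (rule DERIV_isCont[OF flat_exp_has_derivative])
  then have "continuous_on UNIV (flat_exp m)"
    by (simp add: continuous_on_eq_continuous_at)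
  then show ?case
    by (auto intro!: continuous_on_compose2[of UNIV "flat_exp m"] continuous_intros)
next
  case (Suc k)
  let ?D = "\<lambda>x. flat_exp (m + 2) (x \<bullet> e + c) - real m * flat_exp (m + 1) (x \<bullet> e + c)"
  have der: "((\<lambda>x. flat_exp m (x \<bullet> e + c)) has_derivative (\<lambda>h. ?D x * (h \<bullet> e))) (at x)" for x
  proof -
    have "((\<lambda>x. x \<bullet> e + c) has_derivative (\<lambda>h. h \<bullet> e)) (at x)"
      by (auto intro!: derivative_eq_intros)
    moreover have "(flat_exp m has_derivative (*) (?D x)) (at (x \<bullet> e + c))"
      using flat_exp_has_derivative[of m "x \<bullet> e + c"] by (simp add: has_field_derivative_def)
    ultimately show ?thesis
      using diff_chain_at by (fastforce simp: o_def)
  qed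
  then have "frechet_derivative (\<lambda>x. flat_exp m (x \<bullet> e + c)) (at x) = (\<lambda>h. ?D x * (h \<bullet> e))" for x
    by (intro frechet_derivative_at[symmetric])
  moreover have "C_diff k (\<lambda>x. ?D x * (i \<bullet> e))" for i
  proof -
    have "C_diff k (\<lambda>x. (flat_exp (m + 2) (x \<bullet> e + c)
        + (- real m) * flat_exp (m + 1) (x \<bullet> e + c)) * (i \<bullet> e))"
      by (intro C_diff_mult C_diff_add C_diff_const Suc.IH)
    then show ?thesis by simp
  qed
  ultimately show ?case
    using der by (auto simp: differentiable_def)
qed

text \<open>Each factor has the form \<open>exp (-1/(k t))\<close> with t the distance to a face.
  Increasing k drives it to 1 inside the box while the support does not change, so the bumps
  converge boundedly to the indicator of the open box.\<close>

definition box_bump :: "'a::euclidean_space \<Rightarrow> 'a \<Rightarrow> nat \<Rightarrow> 'a \<Rightarrow> real" where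
  "box_bump a b k x = (\<Prod>i\<in>Basis. flat_exp 0 (real k * ((x - a) \<bullet> i)) * flat_exp 0 (real k * ((b - x) \<bullet> i)))"

lemma C_diff_box_bump: "C_diff n (box_bump a b k)"
proof -
  have 1: "C_diff n (\<lambda>x. flat_exp 0 (real k * ((x - a) \<bullet> i)))" for i
    using C_diff_flat_exp[of n 0 "real k *\<^sub>R i" "- (real k * (a \<bullet> i))"]
    by (simp add: inner_diff_left right_diff_distrib)
  have 2: "C_diff n (\<lambda>x. flat_exp 0 (real k * ((b - x) \<bullet> i)))" for i
    using C_diff_flat_exp[of n 0 "- real k *\<^sub>R i" "real k * (b \<bullet> i)"]
    by (simp add: inner_diff_left right_diff_distrib)
  have "C_diff n (\<lambda>x. box_bump a b k x)"
    unfolding box_bump_def by (intro C_diff_prod C_diff_mult 1 2) auto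
  then show ?thesis by simp
qed

lemma flat_exp_0_bounds: "0 \<le> flat_exp 0 t" "flat_exp 0 t \<le> 1"
  by (auto simp: flat_exp_def)

lemma box_bump_bounds: "0 \<le> box_bump a b k x" "box_bump a b k x \<le> 1"
  unfolding box_bump_def
  by (auto intro!: prod_nonneg prod_le_1 mult_le_one mult_nonneg_nonneg flat_exp_0_bounds)

lemma box_bump_eq_0: "x \<notin> box a b \<Longrightarrow> box_bump a b k x = 0"
  unfolding box_bump_def
  by (force simp: mem_box inner_diff_left flat_exp_def zero_less_mult_iff not_less)

lemma box_bump_tendsto: "(\<lambda>k. box_bump a b k x) \<longlonglongrightarrow> indicator (box a b) x"
proof (cases "x \<in> box a b")
  case True
  have lim: "(\<lambda>k. flat_exp 0 (real k * t)) \<longlonglongrightarrow> 1" if "t > 0" for t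
  proof -
    have "(\<lambda>k. exp (- (1 / (real k * t)))) \<longlonglongrightarrow> exp (- 0)"
      using that by (intro tendsto_intros tendsto_divide_0[OF tendsto_const]
        filterlim_at_top_imp_at_infinity filterlim_at_top_mult_tendsto_pos[OF tendsto_const]
        filterlim_real_sequentially)
    then have "(\<lambda>k. exp (- (1 / (real k * t)))) \<longlonglongrightarrow> 1" by simp
    then show ?thesis
      by (rule Lim_transform_eventually)
        (use that in \<open>auto simp: flat_exp_def intro!: eventually_sequentiallyI[of 1]\<close>)
  qed
  have "(\<lambda>k. box_bump a b k x) \<longlonglongrightarrow> (\<Prod>i\<in>(Basis::'a set). 1 * 1)"
    unfolding box_bump_def using True
    by (intro tendsto_prod tendsto_mult lim) (auto simp: mem_box inner_diff_left)
  with True show ?thesis by simp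
qed (simp add: box_bump_eq_0)

lemma box_bump_test_function:
  assumes "cbox a b \<subseteq> \<Omega>"
  shows "box_bump a b k \<in> test_functions \<Omega>"
proof -
  have "closure {x. box_bump a b k x \<noteq> 0} \<subseteq> cbox a b"
    by (intro closure_minimal) (use box_bump_eq_0 box_subset_cbox in \<open>blast+\<close>)
  moreover from this have "compact (closure {x. box_bump a b k x \<noteq> 0})"
    by (metis bounded_subset bounded_cbox closed_closure compact_eq_bounded_closed)
  ultimately show ?thesis
    using assms by (auto simp: test_functions_def C_diff_box_bump)
qed

section \<open>Support, boundedness and continuity of test functions\<close>

lemma test_functionsD:
  assumes "\<phi> \<in> test_functions \<Omega>"
  shows "C_diff k \<phi>" "compact (closure {x. \<phi> x \<noteq> 0})" "closure {x. \<phi> x \<noteq> 0} \<subseteq> \<Omega>"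
    "\<phi> differentiable (at x)" "continuous_on UNIV \<phi>"
    "i \<in> Basis \<Longrightarrow> continuous_on UNIV (\<lambda>x. frechet_derivative \<phi> (at x) i)"
proof -
  show C: "C_diff k \<phi>" "compact (closure {x. \<phi> x \<noteq> 0})" "closure {x. \<phi> x \<noteq> 0} \<subseteq> \<Omega>" for k
    using assms by (auto simp: test_functions_def)
  show "\<phi> differentiable (at x)" "continuous_on UNIV \<phi>"
    "i \<in> Basis \<Longrightarrow> continuous_on UNIV (\<lambda>x. frechet_derivative \<phi> (at x) i)"
    using C(1)[of "Suc 0"] C(1)[of 0] by auto
qed

lemma frechet_derivative_eq_0_outside_support:
  assumes "x \<notin> closure {x. \<phi> x \<noteq> 0}"
  shows "frechet_derivative \<phi> (at x) = (\<lambda>h. 0)"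
proof -
  have "((\<lambda>_. 0) has_derivative (\<lambda>h. 0)) (at x)" by simp
  then have "(\<phi> has_derivative (\<lambda>h. 0)) (at x)"
    by (rule has_derivative_transform_within_open[of _ _ _ _ "- closure {x. \<phi> x \<noteq> 0}"])
      (use assms closure_subset[of "{x. \<phi> x \<noteq> 0}"] in auto)
  then show ?thesis by (metis frechet_derivative_at)
qed

lemma compact_support_bounded:
  fixes \<phi> :: "'a::topological_space \<Rightarrow> real"
  assumes "continuous_on UNIV \<phi>" "compact K" "\<And>x. x \<notin> K \<Longrightarrow> \<phi> x = 0"
  obtains C where "0 < C" "\<And>x. \<bar>\<phi> x\<bar> \<le> C"
proof -
  have "compact (\<phi> ` K)"
    using assms by (meson compact_continuous_image continuous_on_subset subset_UNIV)
  then obtain B where "0 < B" "\<forall>y\<in>\<phi> ` K. norm y \<le> B"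
    using bounded_pos compact_imp_bounded by blast
  then have "\<bar>\<phi> x\<bar> \<le> B" for x
    using assms(3)[of x] by (cases "x \<in> K") auto
  with \<open>0 < B\<close> show ?thesis using that by blast
qed

section \<open>The fundamental lemma of the calculus of variations\<close>

lemma borel_measurable_lebesgueI: "f \<in> borel_measurable borel \<Longrightarrow> f \<in> borel_measurable lebesgue"
  by (rule measurable_completion) simp

text \<open>Dynkin's argument: boxes form an intersection-stable generator of the Borel sets, and
  the sets over which f integrates to 0 are closed under complements and countable disjoint
  unions.\<close>

lemma AE_eq_0_if_box_integrals_0:
  fixes f :: "'a::euclidean_space \<Rightarrow> real"
  assumes f: "integrable lborel f"
    and box: "\<And>a b. set_lebesgue_integral lborel (box a b) f = 0"
  shows "AE x in lborel. f x = 0"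
proof (rule sigma_finite_measure.density_zero[OF sigma_finite_lborel f])
  let ?G = "range (\<lambda>(a, b). box a b :: 'a set)"
  have int: "set_integrable lborel A f" if "A \<in> sets borel" for A
    using f that unfolding set_integrable_def by (intro integrable_mult_indicator) auto
  \<comment> \<open>Closure under complements needs the integral over the whole space, obtained by
    exhausting it with boxes.\<close>
  have UNIV: "set_lebesgue_integral lborel UNIV f = 0"
  proof -
    let ?B = "\<lambda>n::nat. box (- (real n *\<^sub>R One)) (real n *\<^sub>R One) :: 'a set"
    have "(\<lambda>n. set_lebesgue_integral lborel (?B n) f) \<longlonglongrightarrow> set_lebesgue_integral lborel (\<Union>n. ?B n) f"
      by (intro set_integral_cont_up int) (auto simp: incseq_def box_def)
    then show ?thesis
      by (simp add: UN_box_eq_UNIV box LIMSEQ_const_iff)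
  qed
  fix A :: "'a set" assume "A \<in> sets lborel"
  then have "A \<in> sigma_sets UNIV ?G"
    by (simp add: borel_eq_box)
  have "Int_stable ?G"
    by (auto simp: Int_stable_def box_Int_box)
  moreover have "?G \<subseteq> Pow UNIV" by simp
  moreover note \<open>A \<in> sigma_sets UNIV ?G\<close>
  ultimately show "set_lebesgue_integral lborel A f = 0"
  proof (induction rule: sigma_sets_induct_disjoint)
    case (compl A)
    then have A: "A \<in> sets borel" by (simp add: borel_eq_box)
    have "set_lebesgue_integral lborel (A \<union> (UNIV - A)) f
        = set_lebesgue_integral lborel A f + set_lebesgue_integral lborel (UNIV - A) f"
      using A by (intro set_integral_Un int) auto
    with compl UNIV show ?case by simp
  next
    case (union A)
    then have A: "A i \<in> sets borel" for i by (auto simp: borel_eq_box)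
    have "set_lebesgue_integral lborel (\<Union>i. A i) f = (\<Sum>i. set_lebesgue_integral lborel (A i) f)"
      using union(1) A by (intro lebesgue_integral_countable_add int) (auto simp: disjoint_family_on_def)
    with union show ?case by simp
  qed (use box[of 0 0] in \<open>auto simp: box\<close>)
qed

lemma box_bump_measurable [measurable]: "box_bump a b k \<in> borel_measurable borel"
  using C_diff_box_bump[of 0 a b k] by (auto intro: borel_measurable_continuous_onI)

text \<open>Box bumps are admissible tests bounded by 1, so dominated convergence replaces the test
  function by the indicator of the box.\<close>

lemma set_integral_box_eq_0:
  fixes f :: "'a::euclidean_space \<Rightarrow> real"
  assumes sub: "cbox a b \<subseteq> \<Omega>" "open \<Omega>"
    and int: "set_integrable lebesgue (cbox a b) f"
    and test: "\<And>\<phi>. \<phi> \<in> test_functions \<Omega> \<Longrightarrow> (LINT x|lebesgue_on \<Omega>. f x * \<phi> x) = 0"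
  shows "set_lebesgue_integral lebesgue (box a b) f = 0"
proof -
  let ?f = "\<lambda>x. indicator (cbox a b) x *\<^sub>R f x"
  have zero: "(LINT x|lebesgue. ?f x * box_bump a b k x) = 0" for k
  proof -
    have "(LINT x|lebesgue. ?f x * box_bump a b k x)
        = (LINT x|lebesgue. indicator \<Omega> x *\<^sub>R (f x * box_bump a b k x))"
      using sub box_bump_eq_0[of _ a b k] box_subset_cbox[of a b]
      by (intro Bochner_Integration.integral_cong) (auto simp: indicator_def subset_iff)
    also have "\<dots> = (LINT x|lebesgue_on \<Omega>. f x * box_bump a b k x)"
      using sub(2) by (subst integral_restrict_space) auto
    finally show ?thesis
      using test[OF box_bump_test_function[OF sub(1)]] by simp
  qed
  have f: "integrable lebesgue ?f"
    using int by (simp add: set_integrable_def)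
  have [measurable]: "box_bump a b k \<in> borel_measurable lebesgue" for k
    by (rule borel_measurable_lebesgueI) measurable
  have [measurable]: "?f \<in> borel_measurable lebesgue"
    using f by auto
  have "(\<lambda>k. LINT x|lebesgue. ?f x * box_bump a b k x)
      \<longlonglongrightarrow> (LINT x|lebesgue. ?f x * indicator (box a b) x)"
  proof (rule integral_dominated_convergence[where w="\<lambda>x. \<bar>?f x\<bar>"])
    show "AE x in lebesgue. norm (?f x * box_bump a b k x) \<le> \<bar>?f x\<bar>" for k
      using box_bump_bounds[of a b k] by (auto simp: abs_mult intro!: mult_left_le)
    show "AE x in lebesgue. (\<lambda>k. ?f x * box_bump a b k x) \<longlonglongrightarrow> ?f x * indicator (box a b) x"
      by (intro AE_I2 tendsto_intros box_bump_tendsto)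
    show "(\<lambda>x. ?f x * indicator (box a b) x) \<in> borel_measurable lebesgue"
      using borel_measurable_integrable[OF f] by (intro borel_measurable_times borel_measurable_indicator) auto
  qed (use f in auto)
  then have "(LINT x|lebesgue. ?f x * indicator (box a b) x) = 0"
    unfolding zero by (simp add: LIMSEQ_const_iff)
  moreover have "(LINT x|lebesgue. ?f x * indicator (box a b) x) = set_lebesgue_integral lebesgue (box a b) f"
    unfolding set_lebesgue_integral_def using box_subset_cbox[of a b]
    by (intro Bochner_Integration.integral_cong) (auto simp: indicator_def subset_iff)
  ultimately show ?thesis by simp
qed

text \<open>Since f is integrable only on compact subsets, the question is localised to boxes whose
  closure lies in the domain; there the box integrals determine f almost everywhere.\<close>

proposition fundamental_lemma_of_calculus_of_variations:
  fixes f :: "'a::euclidean_space \<Rightarrow> real"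
  assumes \<Omega>: "open \<Omega>"
    and int: "\<And>K. compact K \<Longrightarrow> K \<subseteq> \<Omega> \<Longrightarrow> set_integrable lebesgue K f"
    and test: "\<And>\<phi>. \<phi> \<in> test_functions \<Omega> \<Longrightarrow> (LINT x|lebesgue_on \<Omega>. f x * \<phi> x) = 0"
  shows "AE x in lebesgue_on \<Omega>. f x = 0"
proof -
  have local: "AE x in lebesgue. x \<in> box c d \<longrightarrow> f x = 0" if cd: "cbox c d \<subseteq> \<Omega>" for c d
  proof -
    let ?f = "\<lambda>x. indicator (box c d) x *\<^sub>R f x"
    have "set_integrable lebesgue (box c d) f"
      by (rule set_integrable_subset[OF int[OF compact_cbox cd]]) (auto simp: box_subset_cbox)
    then have f: "integrable lebesgue ?f" by (simp add: set_integrable_def)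
    \<comment> \<open>Dynkin's argument runs over Borel sets, hence the passage to a Borel
      representative of the restricted function.\<close>
    then obtain h where h[measurable]: "h \<in> borel_measurable borel" and eq: "AE x in lborel. ?f x = h x"
      using completion_ex_borel_measurable_real[of ?f lborel] borel_measurable_integrable[OF f] by auto
    have eq': "AE x in lebesgue. h x = ?f x"
      using AE_completion[OF eq] by (rule AE_mp) auto
    have hm: "h \<in> borel_measurable lebesgue"
      using measurable_completion[of h lborel borel] h by simp
    have "integrable lebesgue h"
      using integrable_cong_AE[OF hm borel_measurable_integrable[OF f] eq'] f by simp
    then have hint: "integrable lborel h" by (simp add: integrable_completion)
    have "AE x in lborel. h x = 0"
    proof (rule AE_eq_0_if_box_integrals_0[OF hint])
      fix a b :: 'a
      obtain a' b' where ab: "box a b \<inter> box c d = box a' b'"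
        using box_Int_box by blast
      have "set_lebesgue_integral lborel (box a b) h = set_lebesgue_integral lebesgue (box a b) h"
        unfolding set_lebesgue_integral_def by (subst integral_completion) auto
      also have "\<dots> = set_lebesgue_integral lebesgue (box a b) ?f"
        unfolding set_lebesgue_integral_def
      proof (rule integral_cong_AE)
        show "AE x in lebesgue. indicator (box a b) x *\<^sub>R h x = indicator (box a b) x *\<^sub>R ?f x"
          using eq' by eventually_elim simp
        have "box a b \<in> sets lebesgue" by auto
        note m = borel_measurable_scaleR[OF borel_measurable_indicator[OF this]]
        show "(\<lambda>x. indicator (box a b) x *\<^sub>R h x) \<in> borel_measurable lebesgue"
          "(\<lambda>x. indicator (box a b) x *\<^sub>R ?f x) \<in> borel_measurable lebesgue"
          by (rule m[OF hm] m[OF borel_measurable_integrable[OF f]])+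
      qed
      also have "\<dots> = set_lebesgue_integral lebesgue (box a' b') f"
        unfolding set_lebesgue_integral_def ab[symmetric]
        by (intro Bochner_Integration.integral_cong) (auto simp: indicator_def)
      also have "\<dots> = 0"
      proof (cases "box a' b' = {}")
        case False
        then have "cbox a' b' \<subseteq> cbox c d"
          using ab closure_mono[of "box a' b'" "box c d"] by (metis closure_box closure_empty inf_le2 subset_empty)
        with cd have sub: "cbox a' b' \<subseteq> \<Omega>" by blast
        show ?thesis
          by (rule set_integral_box_eq_0[OF sub \<Omega> int[OF compact_cbox sub] test])
      qed (simp add: set_lebesgue_integral_def)
      finally show "set_lebesgue_integral lborel (box a b) h = 0" .
    qed
    then have "AE x in lebesgue. h x = 0" by (rule AE_completion)
    with eq' show ?thesis by eventually_elim (auto simp: indicator_def split: if_splits)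
  qed
  have loc_box: "\<exists>a b. x \<in> box a b \<and> cbox a b \<subseteq> \<Omega>" if "x \<in> \<Omega>" for x
  proof -
    obtain e where e: "e > 0" "cball x e \<subseteq> \<Omega>"
      using \<Omega> \<open>x \<in> \<Omega>\<close> open_contains_cball by blast
    obtain a b where ab: "x \<in> box a b" "box a b \<subseteq> ball x e"
      using rational_boxes[OF e(1)] by metis
    then have "closure (box a b) \<subseteq> cball x e"
      by (intro closure_minimal) (use ball_subset_cball in auto)
    with ab e show ?thesis by (metis closure_box emptyE order_trans)
  qed
  obtain F where F: "\<And>x. x \<in> \<Omega> \<Longrightarrow> x \<in> box (fst (F x)) (snd (F x)) \<and> cbox (fst (F x)) (snd (F x)) \<subseteq> \<Omega>"
  proof -
    have "\<forall>x\<in>\<Omega>. \<exists>p. x \<in> box (fst p) (snd p) \<and> cbox (fst p) (snd p) \<subseteq> \<Omega>"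
      using loc_box by simp
    then show ?thesis using that by metis
  qed
  \<comment> \<open>A countable subcover is essential: each box has its own exceptional null set,
    and only countably many of them can be united.\<close>
  obtain D where D: "D \<subseteq> \<Omega>" "countable D" "\<Omega> \<subseteq> (\<Union>x\<in>D. box (fst (F x)) (snd (F x)))"
  proof -
    let ?C = "(\<lambda>x. box (fst (F x)) (snd (F x))) ` \<Omega>"
    obtain \<F>' where "\<F>' \<subseteq> ?C" "countable \<F>'" "\<Union>\<F>' = \<Union>?C"
      using Lindelof[of ?C] by (auto simp: open_box)
    moreover from this obtain D where "D \<subseteq> \<Omega>" "countable D" "\<F>' = (\<lambda>x. box (fst (F x)) (snd (F x))) ` D"
      by (metis (no_types, lifting) countable_subset_image)
    ultimately show ?thesis using that F by (metis (no_types, lifting) UN_iff subsetI)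
  qed
  have "AE x in lebesgue. \<forall>y\<in>D. x \<in> box (fst (F y)) (snd (F y)) \<longrightarrow> f x = 0"
    using D F local by (intro AE_ball_countable[THEN iffD2]) auto
  then have "AE x in lebesgue. x \<in> \<Omega> \<longrightarrow> f x = 0"
    by eventually_elim (use D in blast)
  then show ?thesis
    using \<Omega> by (subst AE_restrict_space_iff) auto
qed

text \<open>This makes the arbitrary choice in \<open>weak_gradient\<close> harmless. Each component
  of the difference of two gradients annihilates all test functions.\<close>

lemma has_weak_gradient_unique:
  assumes \<Omega>: "open \<Omega>" and G: "has_weak_gradient \<Omega> u G" and H: "has_weak_gradient \<Omega> u H"
  shows "AE x in lebesgue_on \<Omega>. G x = H x"
proof -
  have "AE x in lebesgue_on \<Omega>. (G x - H x) \<bullet> i = 0" if i: "i \<in> Basis" for i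
  proof (rule fundamental_lemma_of_calculus_of_variations[OF \<Omega>])
    fix K assume K: "compact K" "K \<subseteq> \<Omega>"
    then have "set_integrable lebesgue K (\<lambda>x. G x - H x)"
      using G H by (auto simp: has_weak_gradient_def)
    then show "set_integrable lebesgue K (\<lambda>x. (G x - H x) \<bullet> i)"
      unfolding set_integrable_def using integrable_inner_left by fastforce
  next
    fix \<phi> assume \<phi>: "\<phi> \<in> test_functions \<Omega>"
    have int: "integrable (lebesgue_on \<Omega>) (\<lambda>x. (G x \<bullet> i) * \<phi> x)" if "has_weak_gradient \<Omega> u G" for G
    proof -
      let ?K = "closure {x. \<phi> x \<noteq> 0}"
      have "set_integrable lebesgue ?K G"
        using that test_functionsD[OF \<phi>] by (auto simp: has_weak_gradient_def)
      then have Gi: "integrable lebesgue (\<lambda>x. (indicator ?K x *\<^sub>R G x) \<bullet> i)"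
        unfolding set_integrable_def by (rule integrable_inner_left)
      obtain C where C: "0 < C" "\<And>x. \<bar>\<phi> x\<bar> \<le> C"
        using compact_support_bounded[OF test_functionsD(5,2)[OF \<phi>]] closure_subset by (metis (mono_tags, lifting) mem_Collect_eq subsetD)
      have [measurable]: "\<phi> \<in> borel_measurable lebesgue"
        using borel_measurable_continuous_onI[OF test_functionsD(5)[OF \<phi>]] by (rule borel_measurable_lebesgueI)
      have "integrable lebesgue (\<lambda>x. ((indicator ?K x *\<^sub>R G x) \<bullet> i) * \<phi> x)"
      proof (rule Bochner_Integration.integrable_bound)
        show "integrable lebesgue (\<lambda>x. C * ((indicator ?K x *\<^sub>R G x) \<bullet> i))"
          using Gi by simp
        show "AE x in lebesgue. norm (((indicator ?K x *\<^sub>R G x) \<bullet> i) * \<phi> x)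
            \<le> norm (C * ((indicator ?K x *\<^sub>R G x) \<bullet> i))"
          using C by (auto simp: abs_mult mult.commute[of C] intro!: mult_left_mono order_trans[OF C(2)])
      qed (use borel_measurable_integrable[OF Gi] in measurable)
      also have "(\<lambda>x. ((indicator ?K x *\<^sub>R G x) \<bullet> i) * \<phi> x) = (\<lambda>x. indicator \<Omega> x *\<^sub>R ((G x \<bullet> i) * \<phi> x))"
        using test_functionsD(3)[OF \<phi>] closure_subset[of "{x. \<phi> x \<noteq> 0}"] by (force simp: indicator_def)
      finally show ?thesis
        using \<Omega> by (subst integrable_restrict_space) auto
    qed
    have "(LINT x|lebesgue_on \<Omega>. ((G x - H x) \<bullet> i) * \<phi> x)
        = (LINT x|lebesgue_on \<Omega>. (G x \<bullet> i) * \<phi> x) - (LINT x|lebesgue_on \<Omega>. (H x \<bullet> i) * \<phi> x)"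
      using int[OF G] int[OF H] by (simp add: inner_diff_left left_diff_distrib)
    also have "\<dots> = 0"
      using G H \<phi> i by (auto simp: has_weak_gradient_def)
    finally show "(LINT x|lebesgue_on \<Omega>. ((G x - H x) \<bullet> i) * \<phi> x) = 0" .
  qed
  then have "AE x in lebesgue_on \<Omega>. \<forall>i\<in>Basis. (G x - H x) \<bullet> i = 0"
    by (intro AE_finite_allI) auto
  then show ?thesis
    by eventually_elim (auto intro: euclidean_eqI simp: inner_diff_left)
qed

section \<open>Continuity of translations in the mean\<close>

lemma integrable_lborel_shift:
  fixes f :: "'a::euclidean_space \<Rightarrow> real"
  shows "integrable lborel (\<lambda>x. f (x + c)) \<longleftrightarrow> integrable lborel f"
proof -
  have *: "integrable lborel (\<lambda>x. f (x + c))" if "integrable lborel f" for f :: "'a \<Rightarrow> real" and c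
  proof -
    from that have "integrable (distr lborel borel ((+) c)) f"
      by (simp add: lborel_distr_plus)
    then have "integrable lborel (\<lambda>x. f (c + x))"
      by (subst (asm) integrable_distr_eq) (use borel_measurable_integrable[OF that] in auto)
    then show ?thesis by (simp add: add.commute)
  qed
  from *[of f c] *[of "\<lambda>x. f (x + c)" "- c"] show ?thesis by auto
qed

lemma integral_lborel_shift:
  fixes f :: "'a::euclidean_space \<Rightarrow> real"
  assumes "f \<in> borel_measurable borel"
  shows "(LINT x|lborel. f (x + c)) = (LINT x|lborel. f x)"
proof -
  have "(LINT x|lborel. f x) = (LINT x|distr lborel borel ((+) c). f x)"
    by (simp add: lborel_distr_plus)
  also have "\<dots> = (LINT x|lborel. f (c + x))"
    using assms by (subst integral_distr) auto
  finally show ?thesis by (simp add: add.commute)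
qed

text \<open>The modulus of continuity of f in the mean, at the single shift y.\<close>

definition L1_shift :: "('a::euclidean_space \<Rightarrow> real) \<Rightarrow> 'a \<Rightarrow> real" where
  "L1_shift f y = (LINT x|lborel. \<bar>f (x + y) - f x\<bar>)"

lemma L1_shift_nonneg: "0 \<le> L1_shift f y"
  by (simp add: L1_shift_def)

text \<open>By translation invariance the shifted error \<open>f - g\<close> has the same L1 norm as
  the unshifted one, so replacing f by g costs twice the approximation error, uniformly in the
  shift.\<close>

lemma L1_shift_tendsto_by_approximation:
  assumes f: "integrable lborel f" and Y: "Y \<longlonglongrightarrow> 0"
    and approx: "\<And>\<epsilon>. \<epsilon> > 0 \<Longrightarrow> \<exists>g. integrable lborel g \<and> (LINT x|lborel. \<bar>f x - g x\<bar>) < \<epsilon> \<and>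
      (\<lambda>n. L1_shift g (Y n)) \<longlonglongrightarrow> 0"
  shows "(\<lambda>n. L1_shift f (Y n)) \<longlonglongrightarrow> 0"
proof (rule LIMSEQ_I)
  fix \<epsilon> :: real assume "\<epsilon> > 0"
  then obtain g where g: "integrable lborel g" "(LINT x|lborel. \<bar>f x - g x\<bar>) < \<epsilon> / 4"
    and lim: "(\<lambda>n. L1_shift g (Y n)) \<longlonglongrightarrow> 0"
    using approx[of "\<epsilon> / 4"] by auto
  obtain N where N: "\<And>n. n \<ge> N \<Longrightarrow> L1_shift g (Y n) < \<epsilon> / 4"
    using LIMSEQ_D[OF lim, of "\<epsilon> / 4"] \<open>\<epsilon> > 0\<close> L1_shift_nonneg[of g] by auto
  have "L1_shift f y \<le> (LINT x|lborel. \<bar>f x - g x\<bar>) + L1_shift g y + (LINT x|lborel. \<bar>f x - g x\<bar>)" for y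
  proof -
    note int = integrable_lborel_shift[of f y, THEN iffD2, OF f] integrable_lborel_shift[of g y, THEN iffD2, OF g(1)] f g(1)
    have m: "(\<lambda>x. \<bar>f x - g x\<bar>) \<in> borel_measurable borel"
      using borel_measurable_integrable[OF f] borel_measurable_integrable[OF g(1)] by auto
    have "L1_shift f y \<le> (LINT x|lborel. \<bar>f (x + y) - g (x + y)\<bar> + \<bar>g (x + y) - g x\<bar> + \<bar>f x - g x\<bar>)"
      unfolding L1_shift_def using int
      by (intro integral_mono integrable_abs Bochner_Integration.integrable_add Bochner_Integration.integrable_diff) auto
    also have "\<dots> = (LINT x|lborel. \<bar>f (x + y) - g (x + y)\<bar>) + L1_shift g y + (LINT x|lborel. \<bar>f x - g x\<bar>)"
      unfolding L1_shift_def using int by simp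
    finally show ?thesis
      using integral_lborel_shift[OF m] by simp
  qed
  note le = this
  have "norm (L1_shift f (Y n) - 0) < \<epsilon>" if "n \<ge> N" for n
    using le[of "Y n"] g(2) N[OF that] L1_shift_nonneg[of f "Y n"] by (simp add: abs_of_nonneg)
  then show "\<exists>N. \<forall>n\<ge>N. norm (L1_shift f (Y n) - 0) < \<epsilon>"
    by blast
qed

text \<open>Openness controls only the points of U that leave U under the shift. Those that enter
  have the same total mass by translation invariance, hence the factor 2 in the identity
  \<open>eq\<close>.\<close>

lemma L1_shift_indicator_open:
  fixes U :: "'a::euclidean_space set"
  assumes U: "open U" "emeasure lborel U < \<infinity>" and Y: "Y \<longlonglongrightarrow> 0"
  shows "(\<lambda>n. L1_shift (indicator U) (Y n)) \<longlonglongrightarrow> 0"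
proof -
  let ?f = "indicator U :: 'a \<Rightarrow> real"
  have [measurable]: "U \<in> sets borel" using U by auto
  have f: "integrable lborel ?f"
    using U by (intro integrable_real_indicator) auto
  have fy: "integrable lborel (\<lambda>x. ?f (x + y))" for y
    using f by (simp only: integrable_lborel_shift)
  have eq: "L1_shift ?f y = 2 * (LINT x|lborel. max 0 (?f x - ?f (x + y)))" for y
  proof -
    have "L1_shift ?f y = (LINT x|lborel. (?f (x + y) - ?f x) + 2 * max 0 (?f x - ?f (x + y)))"
      unfolding L1_shift_def by (intro Bochner_Integration.integral_cong) (auto simp: indicator_def)
    also have "\<dots> = (LINT x|lborel. ?f (x + y)) - (LINT x|lborel. ?f x) + 2 * (LINT x|lborel. max 0 (?f x - ?f (x + y)))"
      using f fy by (simp add: integrable_max)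
    finally show ?thesis
      using integral_lborel_shift[of ?f y] by simp
  qed
  have "(\<lambda>n. LINT x|lborel. max 0 (?f x - ?f (x + Y n))) \<longlonglongrightarrow> (LINT x|(lborel :: 'a measure). 0)"
  proof (rule integral_dominated_convergence[where w="\<lambda>x. indicator U x"])
    show "AE x in lborel. (\<lambda>n. max 0 (?f x - ?f (x + Y n))) \<longlonglongrightarrow> 0"
    proof (rule AE_I2)
      fix x
      show "(\<lambda>n. max 0 (?f x - ?f (x + Y n))) \<longlonglongrightarrow> 0"
      proof (cases "x \<in> U")
        case True
        have "(\<lambda>n. x + Y n) \<longlonglongrightarrow> x"
          using tendsto_add[OF tendsto_const Y, of x] by simp
        then have "eventually (\<lambda>n. x + Y n \<in> U) sequentially"
          using U(1) True by (rule topological_tendstoD)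
        then show ?thesis
          by (intro tendsto_eventually) (auto elim!: eventually_mono simp: True)
      next
        case False
        then have "max 0 (?f x - ?f z) = 0" for z by simp
        then show ?thesis by simp
      qed
    qed
    show "AE x in lborel. norm (max 0 (?f x - ?f (x + Y n))) \<le> indicator U x" for n
      by (auto simp: indicator_def)
  qed (use f in auto)
  then show ?thesis
    unfolding eq using tendsto_mult_right_zero by force
qed

text \<open>Outer regularity approximates an indicator by that of an open set; sums and dominated
  limits then reach every integrable function.\<close>

theorem L1_shift_tendsto:
  fixes f :: "'a::euclidean_space \<Rightarrow> real"
  assumes "integrable lborel f" "Y \<longlonglongrightarrow> 0"
  shows "(\<lambda>n. L1_shift f (Y n)) \<longlonglongrightarrow> 0"
  using assms(1)
proof (induction rule: integrable_induct)
  case (base A c)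
  show ?case
  proof (rule L1_shift_tendsto_by_approximation[OF _ assms(2)])
    show "integrable lborel (\<lambda>x. indicat_real A x *\<^sub>R c)"
      using base by (intro integrable_scaleR_left integrable_real_indicator) auto
    fix \<epsilon> :: real assume \<epsilon>: "\<epsilon> > 0"
    \<comment> \<open>The summand 1 covers the case \<open>c = 0\<close>.\<close>
    define \<eta> where "\<eta> = \<epsilon> / (\<bar>c\<bar> + 1)"
    have \<eta>: "\<eta> > 0" "\<bar>c\<bar> * \<eta> < \<epsilon>"
      using \<epsilon> by (auto simp: \<eta>_def field_simps)
    obtain U where U: "open U" "A \<subseteq> U" "emeasure lborel (U - A) < \<eta>"
      using outer_regular_lborel[of A \<eta>] base \<eta> by auto
    have [measurable]: "A \<in> sets borel" "U \<in> sets borel" using base U by auto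
    have "emeasure lborel U = emeasure lborel A + emeasure lborel (U - A)"
      using U(2) by (subst plus_emeasure) (auto intro: arg_cong[where f="emeasure lborel"])
    also have "\<dots> < \<infinity>"
      using base U(3) by (auto simp: less_top[symmetric] intro: order.strict_trans)
    finally have fin: "emeasure lborel U < \<infinity>" .
    have int: "integrable lborel (\<lambda>x. indicat_real U x * c)"
      using fin by (intro integrable_mult_left integrable_real_indicator) auto
    have "(LINT x|lborel. \<bar>indicat_real A x *\<^sub>R c - indicat_real U x * c\<bar>)
        = (LINT x|lborel. \<bar>c\<bar> * indicat_real (U - A) x)"
      using U(2) by (intro Bochner_Integration.integral_cong) (auto simp: indicator_def)
    also have "\<dots> = \<bar>c\<bar> * measure lborel (U - A)"
      by simp
    also have "\<dots> \<le> \<bar>c\<bar> * \<eta>"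
      using U(3) \<eta>(1) by (intro mult_left_mono) (auto simp: measure_def enn2real_leI less_imp_le)
    also have "\<dots> < \<epsilon>" by fact
    finally have close: "(LINT x|lborel. \<bar>indicat_real A x *\<^sub>R c - indicat_real U x * c\<bar>) < \<epsilon>" .
    have "L1_shift (\<lambda>x. indicat_real U x * c) y = \<bar>c\<bar> * L1_shift (indicat_real U) y" for y
    proof -
      have "\<bar>indicat_real U (x + y) * c - indicat_real U x * c\<bar>
          = \<bar>c\<bar> * \<bar>indicat_real U (x + y) - indicat_real U x\<bar>" for x
        by (metis abs_mult left_diff_distrib mult.commute)
      then show ?thesis by (simp add: L1_shift_def)
    qed
    then have "(\<lambda>n. L1_shift (\<lambda>x. indicat_real U x * c) (Y n)) \<longlonglongrightarrow> 0"
      using L1_shift_indicator_open[OF U(1) fin assms(2)] by (simp add: tendsto_mult_right_zero)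
    with int close show "\<exists>g. integrable lborel g \<and>
        (LINT x|lborel. \<bar>indicat_real A x *\<^sub>R c - g x\<bar>) < \<epsilon> \<and> (\<lambda>n. L1_shift g (Y n)) \<longlonglongrightarrow> 0"
      by blast
  qed
next
  case (add f g)
  have "L1_shift (\<lambda>x. f x + g x) y \<le> L1_shift f y + L1_shift g y" for y
  proof -
    note int = integrable_lborel_shift[of f y, THEN iffD2, OF add(1)]
      integrable_lborel_shift[of g y, THEN iffD2, OF add(2)] add(1,2)
    have "L1_shift (\<lambda>x. f x + g x) y \<le> (LINT x|lborel. \<bar>f (x + y) - f x\<bar> + \<bar>g (x + y) - g x\<bar>)"
      unfolding L1_shift_def using int
      by (intro integral_mono integrable_abs Bochner_Integration.integrable_add Bochner_Integration.integrable_diff) auto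
    also have "\<dots> = L1_shift f y + L1_shift g y"
      unfolding L1_shift_def using int by simp
    finally show ?thesis .
  qed
  then show ?case
    using tendsto_add[OF add(3,4)]
    by (intro Lim_null_comparison[of "\<lambda>n. L1_shift (\<lambda>x. f x + g x) (Y n)" "\<lambda>n. L1_shift f (Y n) + L1_shift g (Y n)"])
      (simp_all add: L1_shift_nonneg)
next
  case (lim f s)
  show ?case
  proof (rule L1_shift_tendsto_by_approximation[OF lim(4) assms(2)])
    fix \<epsilon> :: real assume "\<epsilon> > 0"
    have "(\<lambda>i. LINT x|lborel. \<bar>f x - s i x\<bar>) \<longlonglongrightarrow> (LINT x|(lborel :: 'a measure). 0)"
    proof (rule integral_dominated_convergence[where w="\<lambda>x. 3 * \<bar>f x\<bar>"])
      show "AE x in lborel. (\<lambda>i. \<bar>f x - s i x\<bar>) \<longlonglongrightarrow> 0"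
      proof (intro AE_I2 tendsto_rabs_zero)
        fix x :: 'a
        have "(\<lambda>i. s i x) \<longlonglongrightarrow> f x" by (rule lim(2)) simp
        from tendsto_diff[OF tendsto_const this, of "f x"] show "(\<lambda>i. f x - s i x) \<longlonglongrightarrow> 0" by simp
      qed
      show "AE x in lborel. norm \<bar>f x - s i x\<bar> \<le> 3 * \<bar>f x\<bar>" for i
      proof (rule AE_I2)
        fix x :: 'a
        have "norm (s i x) \<le> 2 * norm (f x)" using lim(3) by simp
        then show "norm \<bar>f x - s i x\<bar> \<le> 3 * \<bar>f x\<bar>" unfolding real_norm_def by linarith
      qed
    qed (use lim(1,4) in auto)
    then obtain i where "(LINT x|lborel. \<bar>f x - s i x\<bar>) < \<epsilon>"
      using \<open>\<epsilon> > 0\<close> by (auto simp: tendsto_iff dist_real_def eventually_sequentially)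
    with lim(1,5) show "\<exists>g. integrable lborel g \<and> (LINT x|lborel. \<bar>f x - g x\<bar>) < \<epsilon> \<and>
        (\<lambda>n. L1_shift g (Y n)) \<longlonglongrightarrow> 0" by blast
  qed
qed

lemma L1_shift_small:
  fixes f :: "'a::euclidean_space \<Rightarrow> real"
  assumes f: "integrable lborel f" and \<epsilon>: "\<epsilon> > 0"
  obtains \<delta> where "\<delta> > 0" "\<And>y. norm y < \<delta> \<Longrightarrow> L1_shift f y < \<epsilon>"
proof (rule ccontr)
  assume "\<not> thesis"
  then have "\<forall>n. \<exists>y. norm y < 1 / real (Suc n) \<and> L1_shift f y \<ge> \<epsilon>"
    using that by (metis of_nat_0_less_iff zero_less_Suc not_less zero_less_divide_1_iff)
  then obtain Y where Y: "\<And>n. norm (Y n) < 1 / real (Suc n)" "\<And>n. L1_shift f (Y n) \<ge> \<epsilon>"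
    by metis
  have "Y \<longlonglongrightarrow> 0"
    using Y(1) by (intro Lim_null_comparison[OF _ LIMSEQ_inverse_real_of_nat])
      (auto simp: inverse_eq_divide less_imp_le)
  from L1_shift_tendsto[OF f this] have "(\<lambda>n. L1_shift f (Y n)) \<longlonglongrightarrow> 0" .
  then have "\<epsilon> \<le> 0"
    using Y(2) by (intro LIMSEQ_le_const) auto
  with \<epsilon> show False by simp
qed

section \<open>The chain rule for weak gradients\<close>

lemma integrable_indicator_Icc: "integrable lborel (indicator {a..b::real} :: real \<Rightarrow> real)"
  by (intro integrable_real_indicator) (auto simp: emeasure_lborel_Icc_eq)

text \<open>For each t in the bounded interval the section in x has the L1 norm of f, so the
  iterated integral of the absolute value is finite. This licenses every later exchange of
  integrals.\<close>

lemma integrable_pair_shift: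
  fixes f :: "'a::euclidean_space \<Rightarrow> real" and e :: 'a
  assumes f: "integrable lborel f"
  shows "integrable (lborel \<Otimes>\<^sub>M lborel) (\<lambda>(x, t). indicator {0..h::real} t * f (x + t *\<^sub>R e))"
proof -
  have [measurable]: "f \<in> borel_measurable borel"
    using borel_measurable_integrable[OF f] by simp
  have shift: "integrable lborel (\<lambda>x. f (x + c))" for c
    using f by (simp add: integrable_lborel_shift)
  have "integrable (lborel \<Otimes>\<^sub>M lborel) (\<lambda>(t, x). indicator {0..h::real} t * f (x + t *\<^sub>R e))"
  proof (rule lborel_pair.Fubini_integrable)
    have "(LINT x|lborel. norm (indicator {0..h} t * f (x + t *\<^sub>R e)))
        = indicator {0..h} t * (LINT x|lborel. \<bar>f x\<bar>)" for t
      using integral_lborel_shift[of "\<lambda>x. \<bar>f x\<bar>" "t *\<^sub>R e"] by (simp add: abs_mult)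
    then show "integrable lborel (\<lambda>t. LINT x|lborel. norm (case (t, x) of (t, x) \<Rightarrow>
        indicator {0..h} t * f (x + t *\<^sub>R e)))"
      by (simp add: integrable_indicator_Icc)
  qed (auto simp: shift)
  from lborel_pair.integrable_product_swap[OF this] show ?thesis
    by (simp add: case_prod_unfold)
qed

lemma integrable_pair_shift_mult:
  fixes f :: "'a::euclidean_space \<Rightarrow> real" and e :: 'a
  assumes f: "integrable lborel f"
    and w: "case_prod w \<in> borel_measurable (borel \<Otimes>\<^sub>M borel)" "\<And>x t. \<bar>w x t\<bar> \<le> C"
  shows "integrable (lborel \<Otimes>\<^sub>M lborel) (\<lambda>(x, t). indicator {0..h::real} t * f (x + t *\<^sub>R e) * w x t)"
proof (rule Bochner_Integration.integrable_bound[OF integrable_mult_right[OF integrable_pair_shift[OF f], of C]])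
  have [measurable]: "f \<in> borel_measurable borel"
    using borel_measurable_integrable[OF f] by simp
  note w(1)[measurable]
  have C: "0 \<le> C" using w(2)[of undefined undefined] by linarith
  show "AE p in lborel \<Otimes>\<^sub>M lborel. norm (case p of (x, t) \<Rightarrow> indicator {0..h} t * f (x + t *\<^sub>R e) * w x t)
      \<le> norm (C * (case p of (x, t) \<Rightarrow> indicator {0..h} t * f (x + t *\<^sub>R e)))"
    using w(2) C by (intro AE_I2) (auto simp: abs_mult mult.commute[of C] intro!: mult_left_mono)
  show "(\<lambda>(x, t). indicator {0..h} t * f (x + t *\<^sub>R e) * w x t) \<in> borel_measurable (lborel \<Otimes>\<^sub>M lborel)"
    by measurable
qed

lemma test_functions_shift:
  fixes \<psi> :: "'a::euclidean_space \<Rightarrow> real"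
  assumes \<psi>: "\<psi> \<in> test_functions A" and sub: "\<And>x. x \<in> A \<Longrightarrow> x + v \<in> S"
  shows "(\<lambda>x. \<psi> (x - v)) \<in> test_functions S"
    "frechet_derivative (\<lambda>x. \<psi> (x - v)) (at x) = frechet_derivative \<psi> (at (x - v))"
proof -
  have "x \<in> (+) v ` {x. \<psi> x \<noteq> 0}" if "\<psi> (x - v) \<noteq> 0" for x
    using that by (intro image_eqI[of _ _ "x - v"]) auto
  then have "{x. \<psi> (x - v) \<noteq> 0} = (+) v ` {x. \<psi> x \<noteq> 0}"
    by auto
  then have cl: "closure {x. \<psi> (x - v) \<noteq> 0} = (+) v ` closure {x. \<psi> x \<noteq> 0}"
    by (simp add: closure_translation)
  have "compact (closure {x. \<psi> (x - v) \<noteq> 0})"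
    unfolding cl by (rule compact_translation[OF test_functionsD(2)[OF \<psi>]])
  moreover have "closure {x. \<psi> (x - v) \<noteq> 0} \<subseteq> S"
    unfolding cl using test_functionsD(3)[OF \<psi>] sub by (auto simp: add.commute[of v])
  ultimately show "(\<lambda>x. \<psi> (x - v)) \<in> test_functions S"
    using test_functionsD(1)[OF \<psi>] C_diff_shift[of _ \<psi> "- v"] by (simp add: test_functions_def)
  show "frechet_derivative (\<lambda>x. \<psi> (x - v)) (at x) = frechet_derivative \<psi> (at (x - v))"
    using frechet_derivative_shift[of \<psi> "- v"] test_functionsD(4)[OF \<psi>]
    by (intro frechet_derivative_at[symmetric]) auto
qed

lemma test_function_directional_derivative:
  assumes "\<psi> \<in> test_functions A"
  shows "((\<lambda>t. \<psi> (x - t *\<^sub>R e)) has_real_derivative - frechet_derivative \<psi> (at (x - t *\<^sub>R e)) e) (at t)"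
proof -
  let ?D = "frechet_derivative \<psi> (at (x - t *\<^sub>R e))"
  have d: "(\<psi> has_derivative ?D) (at (x - t *\<^sub>R e))"
    using test_functionsD(4)[OF assms] frechet_derivative_works by blast
  have "((\<lambda>t. x - t *\<^sub>R e) has_derivative (\<lambda>s. - (s *\<^sub>R e))) (at t)"
    by (auto intro!: derivative_eq_intros)
  from diff_chain_at[OF this d] have "((\<lambda>t. \<psi> (x - t *\<^sub>R e)) has_derivative (\<lambda>s. ?D (- (s *\<^sub>R e)))) (at t)"
    by (simp add: o_def)
  moreover have "(\<lambda>s. ?D (- (s *\<^sub>R e))) = (*) (- ?D e)"
    using has_derivative_linear[OF d] by (auto simp: fun_eq_iff linear_neg linear_cmul)
  ultimately show ?thesis by (simp add: has_field_derivative_def)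
qed

lemma test_function_bounds:
  fixes \<psi> :: "'a::euclidean_space \<Rightarrow> real"
  assumes \<psi>: "\<psi> \<in> test_functions A" and e: "e \<in> Basis"
  obtains C where "0 < C" "\<And>x. \<bar>\<psi> x\<bar> \<le> C" "\<And>x. \<bar>frechet_derivative \<psi> (at x) e\<bar> \<le> C"
proof -
  let ?K = "closure {x. \<psi> x \<noteq> 0}"
  obtain C1 where "0 < C1" "\<And>x. \<bar>\<psi> x\<bar> \<le> C1"
    using compact_support_bounded[OF test_functionsD(5,2)[OF \<psi>]] closure_subset
    by (metis (mono_tags, lifting) mem_Collect_eq subsetD)
  moreover obtain C2 where "0 < C2" "\<And>x. \<bar>frechet_derivative \<psi> (at x) e\<bar> \<le> C2"
    using compact_support_bounded[OF test_functionsD(6)[OF \<psi> e] test_functionsD(2)[OF \<psi>]]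
      frechet_derivative_eq_0_outside_support[of _ \<psi>] by metis
  ultimately show ?thesis using that[of "max C1 C2"] by (auto simp: le_max_iff_disj)
qed

lemma test_function_measurable:
  assumes "\<psi> \<in> test_functions A"
  shows "\<psi> \<in> borel_measurable borel"
    "e \<in> Basis \<Longrightarrow> (\<lambda>x. frechet_derivative \<psi> (at x) e) \<in> borel_measurable borel"
  using test_functionsD(5,6)[OF assms] by (auto intro: borel_measurable_continuous_onI)

text \<open>The fundamental theorem of calculus holds by duality. The shift is moved from U to
  \<psi>, the increment of \<psi> is written as the integral of its derivative, Fubini isolates a
  fixed t, the weak derivative is applied there, and the shift is moved back. The fundamental lemma
  then removes \<psi>.\<close>

lemma weak_derivative_increment:
  fixes U \<Gamma> :: "'a::euclidean_space \<Rightarrow> real"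
  assumes U: "integrable lborel U" and \<Gamma>: "integrable lborel \<Gamma>"
    and e: "e \<in> Basis" and h: "0 \<le> h" and A: "open A"
    and ibp: "\<And>\<psi>. \<psi> \<in> test_functions S \<Longrightarrow>
      (LINT x|lborel. U x * frechet_derivative \<psi> (at x) e) = - (LINT x|lborel. \<Gamma> x * \<psi> x)"
    and sub: "\<And>x t. x \<in> A \<Longrightarrow> 0 \<le> t \<Longrightarrow> t \<le> h \<Longrightarrow> x + t *\<^sub>R e \<in> S"
  shows "AE x in lborel. x \<in> A \<longrightarrow>
    U (x + h *\<^sub>R e) - U x = (LINT t|lborel. indicator {0..h} t * \<Gamma> (x + t *\<^sub>R e))"
proof -
  have Um[measurable]: "U \<in> borel_measurable borel" and [measurable]: "\<Gamma> \<in> borel_measurable borel"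
    using borel_measurable_integrable[OF U] borel_measurable_integrable[OF \<Gamma>] by simp_all
  define I where "I x = (LINT t|lborel. indicator {0..h} t * \<Gamma> (x + t *\<^sub>R e))" for x
  have I: "integrable lborel I"
    using lborel_pair.integrable_fst[OF integrable_pair_shift[OF \<Gamma>, of h e]]
    by (simp add: I_def[abs_def])
  have shiftU: "integrable lborel (\<lambda>x. U (x + c))" for c
    using U by (simp add: integrable_lborel_shift)
  let ?f = "\<lambda>x. U (x + h *\<^sub>R e) - U x - I x"
  have f: "integrable lborel ?f"
    using I U shiftU by auto
  have key: "(LINT x|lborel. ?f x * \<psi> x) = 0" if \<psi>: "\<psi> \<in> test_functions A" for \<psi>
  proof -
    let ?d = "\<lambda>x. frechet_derivative \<psi> (at x) e"
    note [measurable] = test_function_measurable(1)[OF \<psi>] test_function_measurable(2)[OF \<psi> e]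
    obtain C where C: "0 < C" "\<And>x. \<bar>\<psi> x\<bar> \<le> C" "\<And>x. \<bar>?d x\<bar> \<le> C"
      using test_function_bounds[OF \<psi> e] by blast
    have mult_int: "integrable lborel (\<lambda>x. F x * \<psi> (x - c))" if "integrable lborel F" for F c
      by (rule Bochner_Integration.integrable_bound[OF integrable_mult_right[OF that, of C]])
        (use borel_measurable_integrable[OF that] C in
          \<open>auto simp: abs_mult mult.commute[of C] intro!: mult_left_mono AE_I2\<close>)
    have mult_int0: "integrable lborel (\<lambda>x. F x * \<psi> x)" if "integrable lborel F" for F
      using mult_int[OF that, of 0] by simp
    have ftc: "\<psi> (x - h *\<^sub>R e) - \<psi> x = (LINT t|lborel. - indicator {0..h} t * ?d (x - t *\<^sub>R e))" for x
    proof -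
      have "(LINT t|lborel. - ?d (x - t *\<^sub>R e) * indicator {0..h} t) = \<psi> (x - h *\<^sub>R e) - \<psi> (x - 0 *\<^sub>R e)"
      proof (rule integral_FTC_Icc_real[OF h])
        show "((\<lambda>t. \<psi> (x - t *\<^sub>R e)) has_real_derivative - ?d (x - t *\<^sub>R e)) (at t)" for t
          by (rule test_function_directional_derivative[OF \<psi>])
        have "continuous_on UNIV (\<lambda>t. - ?d (x - t *\<^sub>R e))"
          by (intro continuous_intros continuous_on_compose2[OF test_functionsD(6)[OF \<psi> e]]) auto
        then show "isCont (\<lambda>t. - ?d (x - t *\<^sub>R e)) t" for t
          by (simp add: continuous_on_eq_continuous_at)
      qed
      then show ?thesis by (simp add: mult.commute)
    qed
    have "(LINT x|lborel. (U (x + h *\<^sub>R e) - U x) * \<psi> x)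
        = (LINT x|lborel. U (x + h *\<^sub>R e) * \<psi> x) - (LINT x|lborel. U x * \<psi> x)"
      using mult_int0[OF shiftU] mult_int0[OF U] by (simp add: left_diff_distrib)
    also have "(LINT x|lborel. U (x + h *\<^sub>R e) * \<psi> x) = (LINT x|lborel. U x * \<psi> (x - h *\<^sub>R e))"
      using integral_lborel_shift[of "\<lambda>x. U x * \<psi> (x - h *\<^sub>R e)" "h *\<^sub>R e"] by simp
    also have "(LINT x|lborel. U x * \<psi> (x - h *\<^sub>R e)) - (LINT x|lborel. U x * \<psi> x)
        = (LINT x|lborel. U x * (\<psi> (x - h *\<^sub>R e) - \<psi> x))"
      using mult_int[OF U] mult_int0[OF U] by (simp add: right_diff_distrib)
    also have "\<dots> = (LINT x|lborel. LINT t|lborel. - (indicator {0..h} t * U x * ?d (x - t *\<^sub>R e)))"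
      unfolding ftc by (subst integral_mult_right_zero[symmetric]) (simp add: ac_simps)
    also have "\<dots> = (LINT t|lborel. LINT x|lborel. - (indicator {0..h} t * U x * ?d (x - t *\<^sub>R e)))"
    proof (rule lborel_pair.Fubini_integral[symmetric])
      \<comment> \<open>Direction 0 in \<open>integrable_pair_shift_mult\<close> produces the
        unshifted factor \<open>U x\<close>; the shift sits in the bounded weight instead.\<close>
      have "integrable (lborel \<Otimes>\<^sub>M lborel) (\<lambda>(x, t). indicator {0..h} t * U (x + t *\<^sub>R 0) * - ?d (x - t *\<^sub>R e))"
        by (rule integrable_pair_shift_mult[OF U, where C = C]) (use C in auto)
      then show "integrable (lborel \<Otimes>\<^sub>M lborel) (\<lambda>(x, t). - (indicator {0..h} t * U x * ?d (x - t *\<^sub>R e)))"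
        by simp
    qed
    also have "\<dots> = (LINT t|lborel. LINT x|lborel. indicator {0..h} t * \<Gamma> (x + t *\<^sub>R e) * \<psi> x)"
    proof (rule Bochner_Integration.integral_cong[OF refl])
      fix t :: real
      show "(LINT x|lborel. - (indicator {0..h} t * U x * ?d (x - t *\<^sub>R e)))
          = (LINT x|lborel. indicator {0..h} t * \<Gamma> (x + t *\<^sub>R e) * \<psi> x)"
      proof (cases "t \<in> {0..h}")
        case True
        note sh = test_functions_shift[OF \<psi>, of "t *\<^sub>R e" S]
        \<comment> \<open>The weak derivative is tested against \<psi> shifted by
          \<open>t *\<^sub>R e\<close>, whose support stays in S by \<open>sub\<close>.\<close>
        have "(LINT x|lborel. U x * ?d (x - t *\<^sub>R e)) = - (LINT x|lborel. \<Gamma> x * \<psi> (x - t *\<^sub>R e))"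
          using ibp[OF sh(1)] sh(2) sub True by simp
        also have "(LINT x|lborel. \<Gamma> x * \<psi> (x - t *\<^sub>R e)) = (LINT x|lborel. \<Gamma> (x + t *\<^sub>R e) * \<psi> x)"
          using integral_lborel_shift[of "\<lambda>x. \<Gamma> x * \<psi> (x - t *\<^sub>R e)" "t *\<^sub>R e"] by simp
        finally show ?thesis using True by simp
      qed simp
    qed
    also have "\<dots> = (LINT x|lborel. LINT t|lborel. indicator {0..h} t * \<Gamma> (x + t *\<^sub>R e) * \<psi> x)"
      by (rule lborel_pair.Fubini_integral, rule integrable_pair_shift_mult[OF \<Gamma>, where C = C])
        (use C in auto)
    also have "\<dots> = (LINT x|lborel. I x * \<psi> x)"
      by (simp add: I_def)
    finally show ?thesis
      using mult_int0[OF I] mult_int0[OF U] mult_int0[OF shiftU] by (simp add: left_diff_distrib)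
  qed
  have "AE x in lebesgue_on A. ?f x = 0"
  proof (rule fundamental_lemma_of_calculus_of_variations[OF A])
    have leb: "integrable lebesgue ?f"
      using f by (simp add: integrable_completion)
    fix K :: "'a set" assume "compact K"
    then have "K \<in> sets lebesgue" by (auto simp: borel_compact)
    then show "set_integrable lebesgue K ?f"
      unfolding set_integrable_def using leb by (rule integrable_mult_indicator)
  next
    fix \<psi> assume \<psi>: "\<psi> \<in> test_functions A"
    have "\<psi> x = 0" if "x \<notin> A" for x
      using test_functionsD(3)[OF \<psi>] closure_subset[of "{x. \<psi> x \<noteq> 0}"] that by blast
    then have eq: "indicator A x *\<^sub>R (?f x * \<psi> x) = ?f x * \<psi> x" for x
      by (cases "x \<in> A") auto
    have "(LINT x|lebesgue_on A. ?f x * \<psi> x) = (LINT x|lebesgue. indicator A x *\<^sub>R (?f x * \<psi> x))"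
      using A by (subst integral_restrict_space) auto
    also have "\<dots> = (LINT x|lebesgue. ?f x * \<psi> x)"
      by (simp only: eq)
    also have "\<dots> = (LINT x|lborel. ?f x * \<psi> x)"
      using borel_measurable_integrable[OF f] test_function_measurable(1)[OF \<psi>]
      by (subst integral_completion) auto
    finally show "(LINT x|lebesgue_on A. ?f x * \<psi> x) = 0"
      using key[OF \<psi>] by simp
  qed
  then have "AE x in lebesgue. x \<in> A \<longrightarrow> ?f x = 0"
    using A by (subst (asm) AE_restrict_space_iff) auto
  then have "AE x in lborel. x \<in> A \<longrightarrow> ?f x = 0"
    by (simp add: AE_completion_iff)
  then show ?thesis by eventually_elim (simp add: I_def)
qed

text \<open>The difference quotient is the average of \<Gamma> over a segment of length h. Its L1
  distance to \<Gamma> is therefore at most the average of the moduli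
  \<open>L1_shift \<Gamma> (t *\<^sub>R e)\<close>, by Fubini.\<close>

lemma difference_quotient_L1_bound:
  fixes U \<Gamma> :: "'a::euclidean_space \<Rightarrow> real"
  assumes U: "integrable lborel U" and \<Gamma>: "integrable lborel \<Gamma>" and h: "0 < h" and A: "A \<in> sets borel"
    and incr: "AE x in lborel. x \<in> A \<longrightarrow>
      U (x + h *\<^sub>R e) - U x = (LINT t|lborel. indicator {0..h} t * \<Gamma> (x + t *\<^sub>R e))"
    and small: "\<And>t. 0 \<le> t \<Longrightarrow> t \<le> h \<Longrightarrow> L1_shift \<Gamma> (t *\<^sub>R e) \<le> \<epsilon>"
  shows "(LINT x|lborel. \<bar>indicator A x * ((U (x + h *\<^sub>R e) - U x) / h - \<Gamma> x)\<bar>) \<le> \<epsilon>"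
proof -
  note [measurable] = A
  have [measurable]: "U \<in> borel_measurable borel" "\<Gamma> \<in> borel_measurable borel"
    using borel_measurable_integrable[OF U] borel_measurable_integrable[OF \<Gamma>] by simp_all
  have shift: "integrable lborel (\<lambda>x. F (x + c))" if "integrable lborel F" for F :: "'a \<Rightarrow> real" and c
    using that by (simp add: integrable_lborel_shift)
  have p1: "integrable (lborel \<Otimes>\<^sub>M lborel) (\<lambda>(x, t). indicator {0..h} t * \<Gamma> (x + t *\<^sub>R e))"
    by (rule integrable_pair_shift[OF \<Gamma>])
  have p2: "integrable (lborel \<Otimes>\<^sub>M lborel) (\<lambda>(x, t). indicator {0..h::real} t * \<Gamma> x)"
    using integrable_pair_shift[OF \<Gamma>, of h 0] by simp
  have p: "integrable (lborel \<Otimes>\<^sub>M lborel) (\<lambda>(x, t). indicator {0..h} t * (\<Gamma> (x + t *\<^sub>R e) - \<Gamma> x))"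
    using Bochner_Integration.integrable_diff[OF p1 p2] by (simp add: case_prod_unfold right_diff_distrib)
  then have pa: "integrable (lborel \<Otimes>\<^sub>M lborel) (\<lambda>(x, t). indicator {0..h} t * \<bar>\<Gamma> (x + t *\<^sub>R e) - \<Gamma> x\<bar>)"
    using integrable_abs[OF p] by (simp add: case_prod_unfold abs_mult)
  have pt: "AE x in lborel. integrable lborel (\<lambda>t. indicator {0..h} t * \<Gamma> (x + t *\<^sub>R e))"
    using lborel_pair.AE_integrable_fst[OF p1] by simp
  have bound: "AE x in lborel. \<bar>indicator A x * ((U (x + h *\<^sub>R e) - U x) / h - \<Gamma> x)\<bar>
      \<le> (LINT t|lborel. indicator {0..h} t * \<bar>\<Gamma> (x + t *\<^sub>R e) - \<Gamma> x\<bar>) / h"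
    using incr pt
  proof eventually_elim
    case (elim x)
    have ii: "integrable lborel (\<lambda>t. indicator {0..h} t * \<Gamma> x)"
      by (rule integrable_mult_left) (rule integrable_indicator_Icc)
    have nn: "0 \<le> (LINT t|lborel. indicator {0..h} t * \<bar>\<Gamma> (x + t *\<^sub>R e) - \<Gamma> x\<bar>)"
      by (intro Bochner_Integration.integral_nonneg) auto
    show ?case
    proof (cases "x \<in> A")
      case True
      have "(U (x + h *\<^sub>R e) - U x) - h * \<Gamma> x
          = (LINT t|lborel. indicator {0..h} t * \<Gamma> (x + t *\<^sub>R e)) - (LINT t|lborel. indicator {0..h} t * \<Gamma> x)"
        using elim True h by simp
      also have "\<dots> = (LINT t|lborel. indicator {0..h} t * (\<Gamma> (x + t *\<^sub>R e) - \<Gamma> x))"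
        using elim ii by (simp add: right_diff_distrib)
      also have "\<bar>\<dots>\<bar> \<le> (LINT t|lborel. \<bar>indicator {0..h} t * (\<Gamma> (x + t *\<^sub>R e) - \<Gamma> x)\<bar>)"
        by (rule integral_abs_bound)
      finally have "\<bar>(U (x + h *\<^sub>R e) - U x) - h * \<Gamma> x\<bar> \<le>
          (LINT t|lborel. indicator {0..h} t * \<bar>\<Gamma> (x + t *\<^sub>R e) - \<Gamma> x\<bar>)"
        by (simp add: abs_mult)
      moreover have "(U (x + h *\<^sub>R e) - U x) / h - \<Gamma> x = ((U (x + h *\<^sub>R e) - U x) - h * \<Gamma> x) / h"
        using h by (simp add: field_simps)
      ultimately show ?thesis
        using True h by (simp add: divide_right_mono)
    qed (use nn h in simp)
  qed
  have int1: "integrable lborel (\<lambda>x. \<bar>indicator A x * ((U (x + h *\<^sub>R e) - U x) / h - \<Gamma> x)\<bar>)"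
  proof -
    have "integrable lborel (\<lambda>x. (U (x + h *\<^sub>R e) - U x) / h - \<Gamma> x)"
      using shift[OF U] U \<Gamma> by auto
    from integrable_mult_indicator[of A, OF _ this] show ?thesis by auto
  qed
  have int2: "integrable lborel (\<lambda>x. (LINT t|lborel. indicator {0..h} t * \<bar>\<Gamma> (x + t *\<^sub>R e) - \<Gamma> x\<bar>))"
    using lborel_pair.integrable_fst[OF pa] by simp
  have "(LINT x|lborel. \<bar>indicator A x * ((U (x + h *\<^sub>R e) - U x) / h - \<Gamma> x)\<bar>)
      \<le> (LINT x|lborel. (LINT t|lborel. indicator {0..h} t * \<bar>\<Gamma> (x + t *\<^sub>R e) - \<Gamma> x\<bar>) / h)"
    using int1 int2 bound by (intro integral_mono_AE) auto
  also have "\<dots> = (LINT x|lborel. (LINT t|lborel. indicator {0..h} t * \<bar>\<Gamma> (x + t *\<^sub>R e) - \<Gamma> x\<bar>)) / h"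
    by simp
  also have "(LINT x|lborel. (LINT t|lborel. indicator {0..h} t * \<bar>\<Gamma> (x + t *\<^sub>R e) - \<Gamma> x\<bar>))
      = (LINT t|lborel. LINT x|lborel. indicator {0..h} t * \<bar>\<Gamma> (x + t *\<^sub>R e) - \<Gamma> x\<bar>)"
    by (rule lborel_pair.Fubini_integral[symmetric, OF pa])
  also have "\<dots> \<le> (LINT t|lborel. indicator {0..h} t * \<epsilon>)"
  proof (rule integral_mono)
    show "integrable lborel (\<lambda>t. LINT x|lborel. indicator {0..h} t * \<bar>\<Gamma> (x + t *\<^sub>R e) - \<Gamma> x\<bar>)"
      using lborel_pair.integrable_snd[OF pa] by simp
    show "integrable lborel (\<lambda>t. indicator {0..h} t * \<epsilon>)"
      by (rule integrable_mult_left) (rule integrable_indicator_Icc)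
    show "(LINT x|lborel. indicator {0..h} t * \<bar>\<Gamma> (x + t *\<^sub>R e) - \<Gamma> x\<bar>) \<le> indicator {0..h} t * \<epsilon>" for t
      using small[of t] by (auto simp: L1_shift_def indicator_def)
  qed
  also have "\<dots> = h * \<epsilon>" using h by simp
  finally show ?thesis using h by (simp add: divide_right_mono)
qed

lemma abs_integral_le_AE:
  fixes f g :: "'a \<Rightarrow> real"
  assumes g: "integrable M g" and le: "AE x in M. \<bar>f x\<bar> \<le> g x"
  shows "\<bar>LINT x|M. f x\<bar> \<le> (LINT x|M. g x)"
proof (cases "integrable M f")
  case True
  have "\<bar>LINT x|M. f x\<bar> \<le> (LINT x|M. \<bar>f x\<bar>)" by (rule integral_abs_bound)
  also have "\<dots> \<le> (LINT x|M. g x)"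
    using True g le by (intro integral_mono_AE) auto
  finally show ?thesis .
next
  \<comment> \<open>The integral of a non-integrable f is 0 by convention, and the claim reduces to
    nonnegativity of the integral of g.\<close>
  case False
  have "AE x in M. 0 \<le> g x" using le by eventually_elim auto
  then show ?thesis
    using False by (simp add: not_integrable_integral_eq integral_nonneg_AE)
qed

section \<open>Transfer from a domain to the whole space\<close>

lemma integral_lebesgue_on_eq_lborel:
  fixes w W \<eta> :: "'a::euclidean_space \<Rightarrow> real"
  assumes \<Omega>: "open \<Omega>" and w: "w \<in> borel_measurable (lebesgue_on \<Omega>)" and W: "W \<in> borel_measurable borel"
    and eq: "AE x in lebesgue. x \<in> \<Omega> \<longrightarrow> w x = W x"
    and \<eta>: "\<eta> \<in> borel_measurable borel" "\<And>x. x \<notin> \<Omega> \<Longrightarrow> \<eta> x = 0"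
  shows "(LINT x|lebesgue_on \<Omega>. w x * \<eta> x) = (LINT x|lborel. W x * \<eta> x)"
proof -
  have "(LINT x|lebesgue_on \<Omega>. w x * \<eta> x) = (LINT x|lebesgue. indicator \<Omega> x *\<^sub>R (w x * \<eta> x))"
    using \<Omega> by (subst integral_restrict_space) auto
  also have "\<dots> = (LINT x|lebesgue. W x * \<eta> x)"
  proof (rule integral_cong_AE)
    have \<eta>': "\<eta> \<in> borel_measurable (lebesgue_on \<Omega>)" "\<eta> \<in> borel_measurable lebesgue"
      using \<eta>(1) by (auto intro: borel_measurable_lebesgueI measurable_restrict_space1)
    have "(\<lambda>x. w x * \<eta> x) \<in> borel_measurable (lebesgue_on \<Omega>)"
      using w \<eta>' by auto
    then show "(\<lambda>x. indicator \<Omega> x *\<^sub>R (w x * \<eta> x)) \<in> borel_measurable lebesgue"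
      using \<Omega> by (subst (asm) borel_measurable_restrict_space_iff) auto
    show "(\<lambda>x. W x * \<eta> x) \<in> borel_measurable lebesgue"
      by (rule borel_measurable_times[OF borel_measurable_lebesgueI[OF W] \<eta>'(2)])
    show "AE x in lebesgue. indicator \<Omega> x *\<^sub>R (w x * \<eta> x) = W x * \<eta> x"
      using eq by eventually_elim (use \<eta>(2) in \<open>auto simp: indicator_def\<close>)
  qed
  also have "\<dots> = (LINT x|lborel. W x * \<eta> x)"
    using W \<eta>(1) by (subst integral_completion) auto
  finally show ?thesis .
qed

text \<open>Translations act on the whole space and Fubini is applied to Borel functions. Extension
  by zero followed by a Borel modification on a null set provides both.\<close>

lemma lebesgue_on_borel_representative:
  fixes w :: "'a::euclidean_space \<Rightarrow> real"
  assumes \<Omega>: "open \<Omega>" and w: "integrable (lebesgue_on \<Omega>) w"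
  obtains W where "W \<in> borel_measurable borel" "integrable lborel W"
    "AE x in lebesgue. x \<in> \<Omega> \<longrightarrow> w x = W x"
proof -
  have f: "integrable lebesgue (\<lambda>x. indicator \<Omega> x *\<^sub>R w x)"
    using w \<Omega> by (subst (asm) integrable_restrict_space) auto
  then obtain W where W: "W \<in> borel_measurable borel" and eq: "AE x in lborel. indicator \<Omega> x *\<^sub>R w x = W x"
    using completion_ex_borel_measurable_real[of "\<lambda>x. indicator \<Omega> x *\<^sub>R w x" lborel]
      borel_measurable_integrable[OF f] by auto
  have eq': "AE x in lebesgue. W x = indicator \<Omega> x *\<^sub>R w x"
    using AE_completion[OF eq] by (rule AE_mp) auto
  have "integrable lebesgue W"
    using integrable_cong_AE[OF borel_measurable_lebesgueI[OF W] borel_measurable_integrable[OF f] eq'] f by simp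
  then have "integrable lborel W" using W by (simp add: integrable_completion)
  moreover have "AE x in lebesgue. x \<in> \<Omega> \<longrightarrow> w x = W x"
    using eq' by eventually_elim auto
  ultimately show ?thesis using that W by blast
qed

section \<open>The chain rule for continuously differentiable outer functions\<close>

lemma Lipschitz_of_bounded_deriv:
  assumes f: "\<And>s. (f has_real_derivative f' s) (at s)" and L: "\<And>s. \<bar>f' s\<bar> \<le> L"
  shows "\<bar>f a - f b\<bar> \<le> L * \<bar>a - b\<bar>"
  using field_differentiable_bound[of UNIV f f' L a b] f L by simp

text \<open>The increment of \<open>f \<circ> U\<close> is a bounded chord slope of f times the
  increment of U. A discrete integration by parts puts the difference quotient on \<phi>; on the
  other side the quotient of U converges in the mean near the support of \<phi>, while the slope
  converges almost everywhere to \<open>f' (U x)\<close>.\<close>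

lemma weak_derivative_chain_lborel:
  fixes U \<Gamma> \<phi> :: "'a::euclidean_space \<Rightarrow> real"
  assumes U: "integrable lborel U" and \<Gamma>: "integrable lborel \<Gamma>" and e: "e \<in> Basis" and S: "open S"
    and ibp: "\<And>\<psi>. \<psi> \<in> test_functions S \<Longrightarrow>
      (LINT x|lborel. U x * frechet_derivative \<psi> (at x) e) = - (LINT x|lborel. \<Gamma> x * \<psi> x)"
    and f: "\<And>s. (f has_real_derivative f' s) (at s)" and f': "continuous_on UNIV f'"
    and L: "\<And>s. \<bar>f' s\<bar> \<le> L" and \<phi>: "\<phi> \<in> test_functions S"
  shows "(LINT x|lborel. f (U x) * frechet_derivative \<phi> (at x) e) = - (LINT x|lborel. f' (U x) * \<Gamma> x * \<phi> x)"
proof -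
  define K where "K = closure {x. \<phi> x \<noteq> 0}"
  have K: "compact K" "K \<subseteq> S" and \<phi>0: "\<And>x. x \<notin> K \<Longrightarrow> \<phi> x = 0"
    using test_functionsD[OF \<phi>] closure_subset[of "{x. \<phi> x \<noteq> 0}"] by (auto simp: K_def)
  obtain r where r: "r > 0" "(\<Union>x\<in>K. ball x r) \<subseteq> S"
    using compact_subset_open_imp_ball_epsilon_subset[OF K(1) S K(2)] by blast
  \<comment> \<open>Half the radius: from a point of A, a segment of length at most r/2 still stays
    inside S.\<close>
  define A where "A = (\<Union>x\<in>K. ball x (r / 2))"
  have A_open: "open A" "K \<subseteq> A"
    using r by (auto simp: A_def)
  then have A: "open A" "K \<subseteq> A" "A \<in> sets borel"
    by auto
  note A(3)[measurable]
  have e1: "norm e = 1" using e by simp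
  have L0: "0 \<le> L" using L[of 0] by linarith
  have lip: "\<bar>f a - f b\<bar> \<le> L * \<bar>a - b\<bar>" for a b
    by (rule Lipschitz_of_bounded_deriv[OF f L])
  have [measurable]: "f \<in> borel_measurable borel"
    by (intro borel_measurable_continuous_onI) (meson DERIV_isCont continuous_at_imp_continuous_on f)
  have [measurable]: "f' \<in> borel_measurable borel"
    by (intro borel_measurable_continuous_onI f')
  have [measurable]: "U \<in> borel_measurable borel" "\<Gamma> \<in> borel_measurable borel"
    using borel_measurable_integrable[OF U] borel_measurable_integrable[OF \<Gamma>] by simp_all
  let ?d = "\<lambda>x. frechet_derivative \<phi> (at x) e"
  note [measurable] = test_function_measurable(1)[OF \<phi>] test_function_measurable(2)[OF \<phi> e]
  obtain C where C: "0 < C" "\<And>x. \<bar>\<phi> x\<bar> \<le> C" "\<And>x. \<bar>?d x\<bar> \<le> C"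
    using test_function_bounds[OF \<phi> e] by blast

  \<comment> \<open>With \<open>n + 2\<close> in the denominator even the step for
    \<open>n = 0\<close> is strictly below r/2.\<close>
  define h0 where "h0 n = (r / 2) / (real n + 2)" for n
  have h0: "0 < h0 n" "h0 n < r / 2" for n
    using r by (auto simp: h0_def field_simps intro!: add_pos_nonneg)
  have "(\<lambda>n. (r / 2) * inverse (real (n + 2))) \<longlonglongrightarrow> (r / 2) * 0"
    by (intro tendsto_mult_left LIMSEQ_ignore_initial_segment[OF lim_inverse_n])
  then have h0_lim: "h0 \<longlonglongrightarrow> 0"
    by (simp add: h0_def[abs_def] field_simps)
  have shift_int: "integrable lborel (\<lambda>x. F (x + c))" if "integrable lborel F" for F :: "'a \<Rightarrow> real" and c
    using that by (simp add: integrable_lborel_shift)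
  have "(\<lambda>n. h0 n *\<^sub>R e) \<longlonglongrightarrow> 0"
    using tendsto_scaleR[OF h0_lim tendsto_const[of e]] by simp
  from L1_shift_tendsto[OF U this]
  have "(\<lambda>n. LINT x|lborel. norm (U (x + h0 n *\<^sub>R e) - U x)) \<longlonglongrightarrow> 0"
    by (simp add: L1_shift_def)
  \<comment> \<open>Continuity in the mean gives only L1 convergence of the shifted functions; the
    subsequence makes it almost everywhere, as the limit of the chord slopes requires.\<close>
  then obtain k where k: "strict_mono k" "AE x in lborel. (\<lambda>n. U (x + h0 (k n) *\<^sub>R e) - U x) \<longlonglongrightarrow> 0"
    using tendsto_L1_AE_subseq[of lborel "\<lambda>n x. U (x + h0 n *\<^sub>R e) - U x"] shift_int[OF U] U by auto
  define h where "h = h0 \<circ> k"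
  have h: "0 < h n" "h n < r / 2" for n using h0 by (auto simp: h_def)
  have h_lim: "h \<longlonglongrightarrow> 0"
    unfolding h_def by (rule LIMSEQ_subseq_LIMSEQ[OF h0_lim k(1)])
  have U_lim: "AE x in lborel. (\<lambda>n. U (x + h n *\<^sub>R e)) \<longlonglongrightarrow> U x"
    using k(2) by eventually_elim (auto simp: h_def LIM_zero_iff)

  define D where "D n x = (U (x + h n *\<^sub>R e) - U x) / h n" for n x
  have D_meas[measurable]: "D n \<in> borel_measurable borel" for n
    unfolding D_def by measurable
  have D_lim: "(\<lambda>n. LINT x|lborel. \<bar>indicator A x * (D n x - \<Gamma> x)\<bar>) \<longlonglongrightarrow> 0"
  proof (rule LIMSEQ_I)
    fix \<epsilon> :: real assume "\<epsilon> > 0"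
    then obtain \<delta> where \<delta>: "\<delta> > 0" "\<And>y. norm y < \<delta> \<Longrightarrow> L1_shift \<Gamma> y < \<epsilon> / 2"
      using L1_shift_small[OF \<Gamma>, of "\<epsilon> / 2"] by auto
    obtain N where N: "\<And>n. n \<ge> N \<Longrightarrow> h n < \<delta>"
      using LIMSEQ_D[OF h_lim \<delta>(1)] by fastforce
    have le: "(LINT x|lborel. \<bar>indicator A x * (D n x - \<Gamma> x)\<bar>) \<le> \<epsilon> / 2" if "n \<ge> N" for n
      unfolding D_def
    proof (rule difference_quotient_L1_bound[OF U \<Gamma> h(1) A(3)])
      show "AE x in lborel. x \<in> A \<longrightarrow>
          U (x + h n *\<^sub>R e) - U x = (LINT t|lborel. indicator {0..h n} t * \<Gamma> (x + t *\<^sub>R e))"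
      proof (rule weak_derivative_increment[OF U \<Gamma> e _ A(1) ibp])
        show "x + t *\<^sub>R e \<in> S" if "x \<in> A" "0 \<le> t" "t \<le> h n" for x t
        proof -
          obtain z where z: "z \<in> K" "dist z x < r / 2" using \<open>x \<in> A\<close> by (auto simp: A_def)
          have "dist z (x + t *\<^sub>R e) \<le> dist z x + dist x (x + t *\<^sub>R e)" by (rule dist_triangle)
          also have "dist x (x + t *\<^sub>R e) = t" using that e1 by (simp add: dist_norm)
          finally have "x + t *\<^sub>R e \<in> ball z r" using z that h(2)[of n] by simp
          with z r(2) show ?thesis by blast
        qed
      qed (use h(1)[of n] in auto)
      show "L1_shift \<Gamma> (t *\<^sub>R e) \<le> \<epsilon> / 2" if "0 \<le> t" "t \<le> h n" for t
        using \<delta>(2)[of "t *\<^sub>R e"] that N[OF \<open>n \<ge> N\<close>] e1 by simp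
    qed
    have nn: "0 \<le> (LINT x|lborel. \<bar>indicator A x * (D n x - \<Gamma> x)\<bar>)" for n
      by (rule Bochner_Integration.integral_nonneg) simp
    have "norm ((LINT x|lborel. \<bar>indicator A x * (D n x - \<Gamma> x)\<bar>) - 0) < \<epsilon>" if "n \<ge> N" for n
      using le[OF that] nn[of n] \<open>\<epsilon> > 0\<close> by (simp only: real_norm_def diff_zero abs_of_nonneg)
    then show "\<exists>N. \<forall>n\<ge>N. norm ((LINT x|lborel. \<bar>indicator A x * (D n x - \<Gamma> x)\<bar>) - 0) < \<epsilon>"
      by blast
  qed
  have D_int: "integrable lborel (D n)" for n
    unfolding D_def using shift_int[OF U] U by auto

  \<comment> \<open>The chord slope of f, filled in by the derivative where U does not change, so
    that the increment of \<open>f \<circ> U\<close> is always c times that of U.\<close>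
  define c where "c n x = (if U (x + h n *\<^sub>R e) = U x then f' (U x)
     else (f (U (x + h n *\<^sub>R e)) - f (U x)) / (U (x + h n *\<^sub>R e) - U x))" for n x
  have c_meas[measurable]: "c n \<in> borel_measurable borel" for n
    unfolding c_def by measurable
  have c_bound: "\<bar>c n x\<bar> \<le> L" for n x
    using lip[of "U (x + h n *\<^sub>R e)" "U x"] L[of "U x"] by (auto simp: c_def field_simps)
  have c_lim: "AE x in lborel. (\<lambda>n. c n x) \<longlonglongrightarrow> f' (U x)"
    using U_lim
  proof eventually_elim
    case (elim x)
    let ?g = "\<lambda>y. if y = U x then f' (U x) else (f y - f (U x)) / (y - U x)"
    have "((\<lambda>y. (f y - f (U x)) / (y - U x)) \<longlongrightarrow> f' (U x)) (at (U x))"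
      using f[of "U x"] by (simp add: has_field_derivative_iff)
    then have "(?g \<longlongrightarrow> f' (U x)) (at (U x))"
      by (rule Lim_transform_eventually) (auto simp: eventually_at_filter)
    then have "isCont ?g (U x)" by (simp add: isCont_def)
    from isCont_tendsto_compose[OF this elim] show ?case by (simp add: c_def)
  qed

  have fU_int: "integrable lborel (\<lambda>x. f (U x) * \<psi> x)"
    if "compact K'" "\<psi> \<in> borel_measurable borel" "\<And>x. x \<notin> K' \<Longrightarrow> \<psi> x = 0" "\<And>x. \<bar>\<psi> x\<bar> \<le> C" for \<psi> K'
  proof (rule Bochner_Integration.integrable_bound)
    show "integrable lborel (\<lambda>x. C * (\<bar>f 0\<bar> * indicator K' x + L * \<bar>U x\<bar>))"
      using U that(1) emeasure_compact_finite[OF that(1)] by (intro integrable_mult_right Bochner_Integration.integrable_add integrable_abs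
          integrable_real_indicator) (auto simp: borel_compact)
    show "AE x in lborel. norm (f (U x) * \<psi> x) \<le> norm (C * (\<bar>f 0\<bar> * indicator K' x + L * \<bar>U x\<bar>))"
    proof (rule AE_I2)
      fix x
      show "norm (f (U x) * \<psi> x) \<le> norm (C * (\<bar>f 0\<bar> * indicator K' x + L * \<bar>U x\<bar>))"
      proof (cases "x \<in> K'")
        case True
        have "\<bar>f (U x)\<bar> \<le> \<bar>f 0\<bar> + L * \<bar>U x\<bar>" using lip[of "U x" 0] by simp
        then have "\<bar>f (U x)\<bar> * \<bar>\<psi> x\<bar> \<le> (\<bar>f 0\<bar> + L * \<bar>U x\<bar>) * C"
          using that(4)[of x] by (intro mult_mono) auto
        also have "\<dots> \<le> norm (C * (\<bar>f 0\<bar> * indicator K' x + L * \<bar>U x\<bar>))"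
          using True C(1) L0 by (simp add: abs_mult mult.commute)
        finally show ?thesis by (simp add: abs_mult)
      qed (simp add: that)
    qed
  qed (use that in measurable)
  \<comment> \<open>One compact set containing the supports of all shifted copies of \<phi>, on
    which \<open>f (U x)\<close> is dominated uniformly in n.\<close>
  define K1 where "K1 = {x + y | x y. x \<in> K \<and> y \<in> cball (0::'a) r}"
  have K1: "compact K1"
    unfolding K1_def by (rule compact_sums[OF K(1) compact_cball])
  have \<phi>K1: "\<phi> x = 0" "\<phi> (x - h n *\<^sub>R e) = 0" if "x \<notin> K1" for x n
  proof -
    have "x = (x - h n *\<^sub>R e) + h n *\<^sub>R e" "h n *\<^sub>R e \<in> cball 0 r" for n
      using h[of n] e1 r by auto
    then have "x - h n *\<^sub>R e \<notin> K" for n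
      using that unfolding K1_def by (metis (mono_tags, lifting) mem_Collect_eq)
    then show "\<phi> (x - h n *\<^sub>R e) = 0" by (rule \<phi>0)
    have "x = x + 0" "(0::'a) \<in> cball 0 r" using r by auto
    then have "x \<notin> K"
      using that unfolding K1_def by (metis (mono_tags, lifting) mem_Collect_eq)
    then show "\<phi> x = 0" by (rule \<phi>0)
  qed
  define dq where "dq n x = (\<phi> (x - h n *\<^sub>R e) - \<phi> x) / h n" for n x
  have [measurable]: "dq n \<in> borel_measurable borel" for n
    unfolding dq_def by measurable
  have dq_bound: "\<bar>dq n x\<bar> \<le> C" for n x
  proof -
    have "\<bar>\<phi> (x - h n *\<^sub>R e) - \<phi> (x - 0 *\<^sub>R e)\<bar> \<le> C * \<bar>h n - 0\<bar>"
      by (rule Lipschitz_of_bounded_deriv[OF test_function_directional_derivative[OF \<phi>]]) (use C in auto)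
    then show ?thesis using h(1)[of n] by (simp add: dq_def field_simps)
  qed
  have dq_lim: "(\<lambda>n. dq n x) \<longlonglongrightarrow> - ?d x" for x
  proof -
    have "((\<lambda>s. (\<phi> (x - (0 + s) *\<^sub>R e) - \<phi> (x - 0 *\<^sub>R e)) / s) \<longlongrightarrow> - ?d (x - 0 *\<^sub>R e)) (at 0)"
      using test_function_directional_derivative[OF \<phi>, of x e 0] by (simp only: DERIV_def)
    moreover have "filterlim h (at 0) sequentially"
      using h_lim h(1) by (auto simp: filterlim_at intro!: always_eventually) (metis less_irrefl)
    ultimately show ?thesis
      unfolding dq_def using filterlim_compose by fastforce
  qed
  have lhs: "(\<lambda>n. LINT x|lborel. f (U x) * dq n x) \<longlonglongrightarrow> (LINT x|lborel. f (U x) * - ?d x)"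
  proof (rule integral_dominated_convergence[where w="\<lambda>x. \<bar>f (U x) * (C * indicator K1 x)\<bar>"])
    have "K1 \<in> sets borel" using K1 by (simp add: borel_compact)
    then show "integrable lborel (\<lambda>x. \<bar>f (U x) * (C * indicator K1 x)\<bar>)"
      using C by (intro integrable_abs fU_int[OF K1]) (auto simp: indicator_def)
    show "AE x in lborel. norm (f (U x) * dq n x) \<le> \<bar>f (U x) * (C * indicator K1 x)\<bar>" for n
    proof (rule AE_I2)
      fix x
      show "norm (f (U x) * dq n x) \<le> \<bar>f (U x) * (C * indicator K1 x)\<bar>"
        using dq_bound[of n x] C(1) \<phi>K1(1)[of x] \<phi>K1(2)[of x n]
        by (cases "x \<in> K1") (simp_all add: abs_mult mult_left_mono, simp add: dq_def)
    qed
    show "AE x in lborel. (\<lambda>n. f (U x) * dq n x) \<longlonglongrightarrow> f (U x) * - ?d x"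
      by (intro AE_I2 tendsto_mult_left dq_lim)
  qed measurable
  \<comment> \<open>Discrete integration by parts with \<open>D n\<close> split as
    \<open>(D n - \<Gamma>) + \<Gamma>\<close>. The indicator of A may be inserted because \<phi>
    vanishes off K, which lies in A.\<close>
  have eqn: "(LINT x|lborel. f (U x) * dq n x)
      = (LINT x|lborel. c n x * (indicator A x * (D n x - \<Gamma> x)) * \<phi> x) + (LINT x|lborel. c n x * \<Gamma> x * \<phi> x)" for n
  proof -
    have i1: "integrable lborel (\<lambda>x. f (U x) * \<phi> x)"
      by (rule fU_int[OF K(1)]) (use \<phi>0 C in auto)
    have i2: "integrable lborel (\<lambda>x. f (U x) * \<phi> (x - h n *\<^sub>R e))"
      by (rule fU_int[OF K1]) (use \<phi>K1 C in auto)
    have i3: "integrable lborel (\<lambda>x. f (U (x + h n *\<^sub>R e)) * \<phi> x)"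
      using shift_int[OF i2, of "h n *\<^sub>R e"] by simp
    have "(LINT x|lborel. f (U x) * dq n x)
        = ((LINT x|lborel. f (U x) * \<phi> (x - h n *\<^sub>R e)) - (LINT x|lborel. f (U x) * \<phi> x)) / h n"
      using i1 i2 by (simp add: dq_def right_diff_distrib diff_divide_distrib)
    also have "(LINT x|lborel. f (U x) * \<phi> (x - h n *\<^sub>R e)) = (LINT x|lborel. f (U (x + h n *\<^sub>R e)) * \<phi> x)"
      using integral_lborel_shift[of "\<lambda>x. f (U x) * \<phi> (x - h n *\<^sub>R e)" "h n *\<^sub>R e"] by simp
    also have "((LINT x|lborel. f (U (x + h n *\<^sub>R e)) * \<phi> x) - (LINT x|lborel. f (U x) * \<phi> x)) / h n
        = (LINT x|lborel. (f (U (x + h n *\<^sub>R e)) - f (U x)) / h n * \<phi> x)"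
      using i1 i3 by (simp add: left_diff_distrib diff_divide_distrib)
    also have "\<dots> = (LINT x|lborel. c n x * (indicator A x * (D n x - \<Gamma> x)) * \<phi> x + c n x * \<Gamma> x * \<phi> x)"
    proof (rule Bochner_Integration.integral_cong[OF refl])
      fix x
      have "(f (U (x + h n *\<^sub>R e)) - f (U x)) / h n = c n x * D n x"
        using h(1)[of n] by (auto simp: c_def D_def)
      then show "(f (U (x + h n *\<^sub>R e)) - f (U x)) / h n * \<phi> x
          = c n x * (indicator A x * (D n x - \<Gamma> x)) * \<phi> x + c n x * \<Gamma> x * \<phi> x"
        using \<phi>0[of x] A(2) by (cases "x \<in> K") (auto simp: algebra_simps)
    qed
    also have "\<dots> = (LINT x|lborel. c n x * (indicator A x * (D n x - \<Gamma> x)) * \<phi> x) + (LINT x|lborel. c n x * \<Gamma> x * \<phi> x)"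
    proof (rule Bochner_Integration.integral_add)
      have "norm (c n x * (indicator A x * (D n x - \<Gamma> x)) * \<phi> x) \<le> norm (L * C * (D n x - \<Gamma> x))" for x
      proof -
        have "\<bar>c n x\<bar> * \<bar>indicator A x * (D n x - \<Gamma> x)\<bar> * \<bar>\<phi> x\<bar> \<le> L * \<bar>D n x - \<Gamma> x\<bar> * C"
          using c_bound[of n x] C(2)[of x] L0 by (intro mult_mono) (auto simp: indicator_def)
        then show ?thesis using L0 C(1) by (simp add: abs_mult ac_simps)
      qed
      then show "integrable lborel (\<lambda>x. c n x * (indicator A x * (D n x - \<Gamma> x)) * \<phi> x)"
        by (intro Bochner_Integration.integrable_bound[OF integrable_mult_right[OF
            Bochner_Integration.integrable_diff[OF D_int[of n] \<Gamma>], of "L * C"]] AE_I2) measurable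
      have "norm (c n x * \<Gamma> x * \<phi> x) \<le> norm (L * C * \<Gamma> x)" for x
      proof -
        have "\<bar>c n x\<bar> * \<bar>\<Gamma> x\<bar> * \<bar>\<phi> x\<bar> \<le> L * \<bar>\<Gamma> x\<bar> * C"
          using c_bound[of n x] C(2)[of x] L0 by (intro mult_mono) auto
        then show ?thesis using L0 C(1) by (simp add: abs_mult ac_simps)
      qed
      then show "integrable lborel (\<lambda>x. c n x * \<Gamma> x * \<phi> x)"
        by (intro Bochner_Integration.integrable_bound[OF integrable_mult_right[OF \<Gamma>, of "L * C"]] AE_I2) measurable
    qed
    finally show ?thesis .
  qed
  have r1: "(\<lambda>n. LINT x|lborel. c n x * (indicator A x * (D n x - \<Gamma> x)) * \<phi> x) \<longlonglongrightarrow> 0"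
  proof (rule Lim_null_comparison[OF always_eventually])
    show "(\<lambda>n. L * C * (LINT x|lborel. \<bar>indicator A x * (D n x - \<Gamma> x)\<bar>)) \<longlonglongrightarrow> 0"
      using tendsto_mult_left[OF D_lim, of "L * C"] by simp
    show "\<forall>n. norm (LINT x|lborel. c n x * (indicator A x * (D n x - \<Gamma> x)) * \<phi> x)
        \<le> L * C * (LINT x|lborel. \<bar>indicator A x * (D n x - \<Gamma> x)\<bar>)"
    proof
      fix n
      have i: "integrable lborel (\<lambda>x. \<bar>indicator A x * (D n x - \<Gamma> x)\<bar>)"
        using integrable_mult_indicator[of A lborel "\<lambda>x. D n x - \<Gamma> x"] A(3) D_int[of n] \<Gamma>
        by (auto simp del: real_scaleR_def simp: real_scaleR_def[symmetric])
      have "norm (LINT x|lborel. c n x * (indicator A x * (D n x - \<Gamma> x)) * \<phi> x)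
          \<le> (LINT x|lborel. L * C * \<bar>indicator A x * (D n x - \<Gamma> x)\<bar>)"
      unfolding real_norm_def
      proof (rule abs_integral_le_AE)
        show "AE x in lborel. \<bar>c n x * (indicator A x * (D n x - \<Gamma> x)) * \<phi> x\<bar> \<le> L * C * \<bar>indicator A x * (D n x - \<Gamma> x)\<bar>"
        proof (rule AE_I2)
          fix x
          have "\<bar>c n x\<bar> * \<bar>indicator A x * (D n x - \<Gamma> x)\<bar> * \<bar>\<phi> x\<bar> \<le> L * \<bar>indicator A x * (D n x - \<Gamma> x)\<bar> * C"
            using c_bound[of n x] C(2)[of x] L0 by (intro mult_mono) auto
          then show "\<bar>c n x * (indicator A x * (D n x - \<Gamma> x)) * \<phi> x\<bar> \<le> L * C * \<bar>indicator A x * (D n x - \<Gamma> x)\<bar>"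
            by (simp add: abs_mult ac_simps)
        qed
      qed (use i in simp)
      then show "norm (LINT x|lborel. c n x * (indicator A x * (D n x - \<Gamma> x)) * \<phi> x)
        \<le> L * C * (LINT x|lborel. \<bar>indicator A x * (D n x - \<Gamma> x)\<bar>)" by simp
    qed
  qed
  have r2: "(\<lambda>n. LINT x|lborel. c n x * \<Gamma> x * \<phi> x) \<longlonglongrightarrow> (LINT x|lborel. f' (U x) * \<Gamma> x * \<phi> x)"
  proof (rule integral_dominated_convergence[where w="\<lambda>x. \<bar>L * C * \<Gamma> x\<bar>"])
    show "AE x in lborel. norm (c n x * \<Gamma> x * \<phi> x) \<le> \<bar>L * C * \<Gamma> x\<bar>" for n
    proof (rule AE_I2)
      fix x
      have "\<bar>c n x\<bar> * \<bar>\<Gamma> x\<bar> * \<bar>\<phi> x\<bar> \<le> L * \<bar>\<Gamma> x\<bar> * C"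
        using c_bound[of n x] C(2)[of x] L0 by (intro mult_mono) auto
      then show "norm (c n x * \<Gamma> x * \<phi> x) \<le> \<bar>L * C * \<Gamma> x\<bar>"
        using L0 C(1) by (simp add: abs_mult ac_simps)
    qed
    show "AE x in lborel. (\<lambda>n. c n x * \<Gamma> x * \<phi> x) \<longlonglongrightarrow> f' (U x) * \<Gamma> x * \<phi> x"
      using c_lim by eventually_elim (intro tendsto_mult_right)
  qed (use \<Gamma> in auto)
  have "(\<lambda>n. LINT x|lborel. f (U x) * dq n x) \<longlonglongrightarrow> 0 + (LINT x|lborel. f' (U x) * \<Gamma> x * \<phi> x)"
    unfolding eqn by (rule tendsto_add[OF r1 r2])
  with lhs have "(LINT x|lborel. f (U x) * - ?d x) = (LINT x|lborel. f' (U x) * \<Gamma> x * \<phi> x)"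
    using LIMSEQ_unique by fastforce
  then show ?thesis by simp
qed

lemma set_integrable_compact:
  fixes w :: "'a::euclidean_space \<Rightarrow> 'b::euclidean_space"
  assumes \<Omega>: "open \<Omega>" and w: "integrable (lebesgue_on \<Omega>) w" and K: "compact K" "K \<subseteq> \<Omega>"
  shows "set_integrable lebesgue K w"
proof -
  have "set_integrable lebesgue \<Omega> w"
    using w \<Omega> by (subst (asm) integrable_restrict_space) (auto simp: set_integrable_def)
  moreover have "K \<in> sets lebesgue" using K by (auto simp: borel_compact)
  ultimately show ?thesis
    using K(2) set_integrable_subset by blast
qed

lemma has_weak_gradientD:
  assumes "has_weak_gradient \<Omega> u G" "\<phi> \<in> test_functions \<Omega>" "i \<in> Basis"
  shows "(LINT x|lebesgue_on \<Omega>. u x * frechet_derivative \<phi> (at x) i) = - (LINT x|lebesgue_on \<Omega>. (G x \<bullet> i) * \<phi> x)"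
  using assms by (auto simp: has_weak_gradient_def)

lemma has_weak_gradientI:
  assumes "open \<Omega>" "integrable (lebesgue_on \<Omega>) u" "integrable (lebesgue_on \<Omega>) G"
    and "\<And>\<phi> i. \<phi> \<in> test_functions \<Omega> \<Longrightarrow> i \<in> Basis \<Longrightarrow>
      (LINT x|lebesgue_on \<Omega>. u x * frechet_derivative \<phi> (at x) i) = - (LINT x|lebesgue_on \<Omega>. (G x \<bullet> i) * \<phi> x)"
  shows "has_weak_gradient \<Omega> u G"
  using assms(4) set_integrable_compact[OF assms(1,2)] set_integrable_compact[OF assms(1,3)]
  by (simp add: has_weak_gradient_def)

lemma test_function_measurable_lebesgue_on:
  assumes "\<phi> \<in> test_functions \<Omega>"
  shows "\<phi> \<in> borel_measurable (lebesgue_on A)"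
    "i \<in> Basis \<Longrightarrow> (\<lambda>x. frechet_derivative \<phi> (at x) i) \<in> borel_measurable (lebesgue_on A)"
  using test_function_measurable[OF assms]
  by (auto intro: measurable_restrict_space1 borel_measurable_lebesgueI)

lemma integrable_mult_bounded:
  fixes u :: "'a \<Rightarrow> real"
  assumes u: "integrable M u" and v: "v \<in> borel_measurable M" "AE x in M. \<bar>v x\<bar> \<le> C"
  shows "integrable M (\<lambda>x. u x * v x)"
proof (rule Bochner_Integration.integrable_bound[OF integrable_mult_right[OF u, of C]])
  show "(\<lambda>x. u x * v x) \<in> borel_measurable M"
    using borel_measurable_integrable[OF u] v(1) by simp
  show "AE x in M. norm (u x * v x) \<le> norm (C * u x)"
    using v(2)
  proof eventually_elim
    case (elim x)
    then show ?case
      by (auto simp: abs_mult mult.commute[of _ "\<bar>u x\<bar>"] intro!: mult_left_mono)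
  qed
qed

text \<open>The chain rule is applied to each component separately, with Borel representatives of u
  and of that component on the whole space.\<close>

lemma has_weak_gradient_compose:
  fixes u :: "'a::euclidean_space \<Rightarrow> real"
  assumes \<Omega>: "open \<Omega>" and u: "integrable (lebesgue_on \<Omega>) u" and G: "integrable (lebesgue_on \<Omega>) G"
    and fu: "integrable (lebesgue_on \<Omega>) (\<lambda>x. f (u x))"
    and wg: "has_weak_gradient \<Omega> u G"
    and f: "\<And>s. (f has_real_derivative f' s) (at s)" and f': "continuous_on UNIV f'"
    and L: "\<And>s. \<bar>f' s\<bar> \<le> L"
  shows "has_weak_gradient \<Omega> (\<lambda>x. f (u x)) (\<lambda>x. f' (u x) *\<^sub>R G x)"
proof (rule has_weak_gradientI[OF \<Omega> fu])
  have fm: "f \<in> borel_measurable borel" "f' \<in> borel_measurable borel"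
    by (intro borel_measurable_continuous_onI; meson DERIV_isCont continuous_at_imp_continuous_on f f')+
  have um: "u \<in> borel_measurable (lebesgue_on \<Omega>)" using u by simp
  have f'u: "(\<lambda>x. f' (u x)) \<in> borel_measurable (lebesgue_on \<Omega>)"
    using measurable_compose[OF um fm(2)] .
  show "integrable (lebesgue_on \<Omega>) (\<lambda>x. f' (u x) *\<^sub>R G x)"
  proof (rule Bochner_Integration.integrable_bound)
    show "integrable (lebesgue_on \<Omega>) (\<lambda>x. L * norm (G x))"
      using G by simp
    show "AE x in lebesgue_on \<Omega>. norm (f' (u x) *\<^sub>R G x) \<le> norm (L * norm (G x))"
      using L by (auto simp: abs_mult intro!: mult_right_mono order_trans[OF L])
    show "(\<lambda>x. f' (u x) *\<^sub>R G x) \<in> borel_measurable (lebesgue_on \<Omega>)"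
      using f'u borel_measurable_integrable[OF G] by simp
  qed
  fix \<phi> and i :: 'a assume \<phi>: "\<phi> \<in> test_functions \<Omega>" and i: "i \<in> Basis"
  have out: "\<psi> x = 0" "frechet_derivative \<psi> (at x) i = 0" if "\<psi> \<in> test_functions \<Omega>" "x \<notin> \<Omega>" for \<psi> x
  proof -
    have "x \<notin> closure {x. \<psi> x \<noteq> 0}" using test_functionsD(3)[OF that(1)] that(2) by blast
    then show "\<psi> x = 0" "frechet_derivative \<psi> (at x) i = 0"
      using closure_subset[of "{x. \<psi> x \<noteq> 0}"] fun_cong[OF frechet_derivative_eq_0_outside_support[of x \<psi>], of i] by auto
  qed
  have Gi: "integrable (lebesgue_on \<Omega>) (\<lambda>x. G x \<bullet> i)"
    using G by (rule integrable_inner_left)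
  have Gim: "(\<lambda>x. G x \<bullet> i) \<in> borel_measurable (lebesgue_on \<Omega>)"
    using Gi by simp
  obtain U where U: "U \<in> borel_measurable borel" "integrable lborel U"
    and Ueq: "AE x in lebesgue. x \<in> \<Omega> \<longrightarrow> u x = U x"
    using lebesgue_on_borel_representative[OF \<Omega> u] by blast
  obtain \<Gamma> where \<Gamma>: "\<Gamma> \<in> borel_measurable borel" "integrable lborel \<Gamma>"
    and \<Gamma>eq: "AE x in lebesgue. x \<in> \<Omega> \<longrightarrow> G x \<bullet> i = \<Gamma> x"
    using lebesgue_on_borel_representative[OF \<Omega> Gi] by blast
  have fUeq: "AE x in lebesgue. x \<in> \<Omega> \<longrightarrow> f (u x) = f (U x)"
    using Ueq by eventually_elim auto
  have f'Ueq: "AE x in lebesgue. x \<in> \<Omega> \<longrightarrow> f' (u x) * (G x \<bullet> i) = f' (U x) * \<Gamma> x"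
    using Ueq \<Gamma>eq by eventually_elim auto
  have "(LINT x|lebesgue_on \<Omega>. f (u x) * frechet_derivative \<phi> (at x) i)
      = (LINT x|lborel. f (U x) * frechet_derivative \<phi> (at x) i)"
    using measurable_compose[OF um fm(1)] measurable_compose[OF U(1) fm(1)] fUeq
    by (rule integral_lebesgue_on_eq_lborel[OF \<Omega>]) (use test_function_measurable[OF \<phi>] i out(2)[OF \<phi>] in auto)
  also have "\<dots> = - (LINT x|lborel. f' (U x) * \<Gamma> x * \<phi> x)"
  proof (rule weak_derivative_chain_lborel[OF U(2) \<Gamma>(2) i \<Omega> _ f f' L \<phi>])
    fix \<psi> assume \<psi>: "\<psi> \<in> test_functions \<Omega>"
    have "(LINT x|lborel. U x * frechet_derivative \<psi> (at x) i) = (LINT x|lebesgue_on \<Omega>. u x * frechet_derivative \<psi> (at x) i)"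
      by (rule integral_lebesgue_on_eq_lborel[OF \<Omega> um U(1) Ueq, symmetric])
        (use test_function_measurable[OF \<psi>] i out(2)[OF \<psi>] in auto)
    also have "\<dots> = - (LINT x|lebesgue_on \<Omega>. (G x \<bullet> i) * \<psi> x)"
      by (rule has_weak_gradientD[OF wg \<psi> i])
    also have "(LINT x|lebesgue_on \<Omega>. (G x \<bullet> i) * \<psi> x) = (LINT x|lborel. \<Gamma> x * \<psi> x)"
      by (rule integral_lebesgue_on_eq_lborel[OF \<Omega> Gim \<Gamma>(1) \<Gamma>eq])
        (use test_function_measurable[OF \<psi>] out(1)[OF \<psi>] in auto)
    finally show "(LINT x|lborel. U x * frechet_derivative \<psi> (at x) i) = - (LINT x|lborel. \<Gamma> x * \<psi> x)" .
  qed
  also have "(LINT x|lborel. f' (U x) * \<Gamma> x * \<phi> x) = (LINT x|lebesgue_on \<Omega>. f' (u x) * (G x \<bullet> i) * \<phi> x)"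
    by (rule integral_lebesgue_on_eq_lborel[OF \<Omega> _ _ f'Ueq, symmetric])
      (use f'u Gim measurable_compose[OF U(1) fm(2)] \<Gamma>(1) test_function_measurable[OF \<phi>] out(1)[OF \<phi>] in auto)
  finally show "(LINT x|lebesgue_on \<Omega>. f (u x) * frechet_derivative \<phi> (at x) i)
      = - (LINT x|lebesgue_on \<Omega>. ((f' (u x) *\<^sub>R G x) \<bullet> i) * \<phi> x)"
    by simp
qed

section \<open>Limits and linear combinations of weak gradients\<close>

lemma integral_mult_bounded_tendsto:
  fixes u :: "'a \<Rightarrow> real"
  assumes u: "integrable M u" "\<And>n. integrable M (v n)" and lim: "(\<lambda>n. LINT x|M. \<bar>v n x - u x\<bar>) \<longlonglongrightarrow> 0"
    and w: "w \<in> borel_measurable M" "\<And>x. \<bar>w x\<bar> \<le> C"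
  shows "(\<lambda>n. LINT x|M. v n x * w x) \<longlonglongrightarrow> (LINT x|M. u x * w x)"
proof -
  have i: "integrable M (\<lambda>x. f x * w x)" if "integrable M f" for f
    using that w by (intro integrable_mult_bounded) auto
  have "(\<lambda>n. (LINT x|M. v n x * w x) - (LINT x|M. u x * w x)) \<longlonglongrightarrow> 0"
  proof (rule Lim_null_comparison[OF always_eventually])
    show "(\<lambda>n. (LINT x|M. \<bar>v n x - u x\<bar>) * C) \<longlonglongrightarrow> 0"
      using tendsto_mult_right[OF lim, of C] by simp
    show "\<forall>n. norm ((LINT x|M. v n x * w x) - (LINT x|M. u x * w x)) \<le> (LINT x|M. \<bar>v n x - u x\<bar>) * C"
    proof
      fix n
      have "norm ((LINT x|M. v n x * w x) - (LINT x|M. u x * w x)) = \<bar>LINT x|M. (v n x - u x) * w x\<bar>"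
        using i[OF u(1)] i[OF u(2)] by (simp add: left_diff_distrib)
      also have "\<dots> \<le> (LINT x|M. \<bar>v n x - u x\<bar> * C)"
        using u w by (intro abs_integral_le_AE) (auto simp: abs_mult intro!: mult_left_mono)
      finally show "norm ((LINT x|M. v n x * w x) - (LINT x|M. u x * w x)) \<le> (LINT x|M. \<bar>v n x - u x\<bar>) * C"
        by simp
    qed
  qed
  then show ?thesis by (simp add: LIM_zero_iff)
qed

text \<open>The weak gradient is a closed operator in L1: both sides of its defining identity pair
  the functions with bounded weights.\<close>

lemma has_weak_gradient_L1_limit:
  fixes u :: "'a::euclidean_space \<Rightarrow> real"
  assumes \<Omega>: "open \<Omega>" and u: "integrable (lebesgue_on \<Omega>) u" and G: "integrable (lebesgue_on \<Omega>) G"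
    and un: "\<And>n. integrable (lebesgue_on \<Omega>) (v n)" and Gn: "\<And>n. integrable (lebesgue_on \<Omega>) (H n)"
    and wg: "\<And>n. has_weak_gradient \<Omega> (v n) (H n)"
    and ulim: "(\<lambda>n. LINT x|lebesgue_on \<Omega>. \<bar>v n x - u x\<bar>) \<longlonglongrightarrow> 0"
    and Glim: "(\<lambda>n. LINT x|lebesgue_on \<Omega>. norm (H n x - G x)) \<longlonglongrightarrow> 0"
  shows "has_weak_gradient \<Omega> u G"
proof (rule has_weak_gradientI[OF \<Omega> u G])
  fix \<phi> and i :: 'a assume \<phi>: "\<phi> \<in> test_functions \<Omega>" and i: "i \<in> Basis"
  obtain C where "0 < C" and C: "\<And>x. \<bar>\<phi> x\<bar> \<le> C" "\<And>x. \<bar>frechet_derivative \<phi> (at x) i\<bar> \<le> C"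
    using test_function_bounds[OF \<phi> i] by blast
  have 1: "(\<lambda>n. LINT x|lebesgue_on \<Omega>. v n x * frechet_derivative \<phi> (at x) i)
      \<longlonglongrightarrow> (LINT x|lebesgue_on \<Omega>. u x * frechet_derivative \<phi> (at x) i)"
    by (rule integral_mult_bounded_tendsto[OF u un ulim test_function_measurable_lebesgue_on(2)[OF \<phi> i] C(2)])
  have "(\<lambda>n. LINT x|lebesgue_on \<Omega>. \<bar>H n x \<bullet> i - G x \<bullet> i\<bar>) \<longlonglongrightarrow> 0"
  proof (rule Lim_null_comparison[OF always_eventually Glim], rule allI)
    fix n
    have "norm (LINT x|lebesgue_on \<Omega>. \<bar>H n x \<bullet> i - G x \<bullet> i\<bar>) = \<bar>LINT x|lebesgue_on \<Omega>. \<bar>H n x \<bullet> i - G x \<bullet> i\<bar>\<bar>"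
      by simp
    also have "\<dots> \<le> (LINT x|lebesgue_on \<Omega>. norm (H n x - G x))"
      using Gn[of n] G i by (intro abs_integral_le_AE AE_I2) (auto simp: inner_diff_left[symmetric] Basis_le_norm)
    finally show "norm (LINT x|lebesgue_on \<Omega>. \<bar>H n x \<bullet> i - G x \<bullet> i\<bar>) \<le> (LINT x|lebesgue_on \<Omega>. norm (H n x - G x))" .
  qed
  then have 2: "(\<lambda>n. LINT x|lebesgue_on \<Omega>. (H n x \<bullet> i) * \<phi> x) \<longlonglongrightarrow> (LINT x|lebesgue_on \<Omega>. (G x \<bullet> i) * \<phi> x)"
    using G Gn by (intro integral_mult_bounded_tendsto[OF _ _ _ test_function_measurable_lebesgue_on(1)[OF \<phi>] C(1)]) auto
  have "(\<lambda>n. LINT x|lebesgue_on \<Omega>. v n x * frechet_derivative \<phi> (at x) i)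
      \<longlonglongrightarrow> - (LINT x|lebesgue_on \<Omega>. (G x \<bullet> i) * \<phi> x)"
    using tendsto_minus[OF 2] has_weak_gradientD[OF wg \<phi> i] by simp
  then show "(LINT x|lebesgue_on \<Omega>. u x * frechet_derivative \<phi> (at x) i) = - (LINT x|lebesgue_on \<Omega>. (G x \<bullet> i) * \<phi> x)"
    using 1 LIMSEQ_unique by blast
qed

lemma has_weak_gradient_add_scale:
  fixes u v :: "'a::euclidean_space \<Rightarrow> real"
  assumes \<Omega>: "open \<Omega>" and u: "integrable (lebesgue_on \<Omega>) u" "integrable (lebesgue_on \<Omega>) G" "has_weak_gradient \<Omega> u G"
    and v: "integrable (lebesgue_on \<Omega>) v" "integrable (lebesgue_on \<Omega>) H" "has_weak_gradient \<Omega> v H"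
  shows "has_weak_gradient \<Omega> (\<lambda>x. a * u x + c * v x) (\<lambda>x. a *\<^sub>R G x + c *\<^sub>R H x)"
proof (rule has_weak_gradientI[OF \<Omega>])
  show "integrable (lebesgue_on \<Omega>) (\<lambda>x. a * u x + c * v x)" "integrable (lebesgue_on \<Omega>) (\<lambda>x. a *\<^sub>R G x + c *\<^sub>R H x)"
    using u(1,2) v(1,2) by simp_all
  fix \<phi> and i :: 'a assume \<phi>: "\<phi> \<in> test_functions \<Omega>" and i: "i \<in> Basis"
  obtain C where "0 < C" and C: "\<And>x. \<bar>\<phi> x\<bar> \<le> C" "\<And>x. \<bar>frechet_derivative \<phi> (at x) i\<bar> \<le> C"
    using test_function_bounds[OF \<phi> i] by blast
  have int1: "integrable (lebesgue_on \<Omega>) (\<lambda>x. w x * frechet_derivative \<phi> (at x) i)"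
    if "integrable (lebesgue_on \<Omega>) w" for w
    using that test_function_measurable_lebesgue_on(2)[OF \<phi> i] C by (intro integrable_mult_bounded) auto
  have int2: "integrable (lebesgue_on \<Omega>) (\<lambda>x. (F x \<bullet> i) * \<phi> x)"
    if "integrable (lebesgue_on \<Omega>) F" for F :: "'a \<Rightarrow> 'a"
    using that test_function_measurable_lebesgue_on(1)[OF \<phi>] C by (intro integrable_mult_bounded integrable_inner_left) auto
  have "(LINT x|lebesgue_on \<Omega>. (a * u x + c * v x) * frechet_derivative \<phi> (at x) i)
      = a * (LINT x|lebesgue_on \<Omega>. u x * frechet_derivative \<phi> (at x) i) + c * (LINT x|lebesgue_on \<Omega>. v x * frechet_derivative \<phi> (at x) i)"
    using int1[OF u(1)] int1[OF v(1)] by (simp add: distrib_right mult.assoc)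
  also have "\<dots> = - (a * (LINT x|lebesgue_on \<Omega>. (G x \<bullet> i) * \<phi> x) + c * (LINT x|lebesgue_on \<Omega>. (H x \<bullet> i) * \<phi> x))"
    using has_weak_gradientD[OF u(3) \<phi> i] has_weak_gradientD[OF v(3) \<phi> i] by simp
  also have "a * (LINT x|lebesgue_on \<Omega>. (G x \<bullet> i) * \<phi> x) + c * (LINT x|lebesgue_on \<Omega>. (H x \<bullet> i) * \<phi> x)
      = (LINT x|lebesgue_on \<Omega>. ((a *\<^sub>R G x + c *\<^sub>R H x) \<bullet> i) * \<phi> x)"
    using int2[OF u(2)] int2[OF v(2)] by (simp add: inner_add_left distrib_right mult.assoc)
  finally show "(LINT x|lebesgue_on \<Omega>. (a * u x + c * v x) * frechet_derivative \<phi> (at x) i)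
      = - (LINT x|lebesgue_on \<Omega>. ((a *\<^sub>R G x + c *\<^sub>R H x) \<bullet> i) * \<phi> x)" .
qed

section \<open>Truncation\<close>

definition clamp_real :: "real \<Rightarrow> real \<Rightarrow> real \<Rightarrow> real" where
  "clamp_real a c s = max a (min c s)"

text \<open>This reduces truncation to the absolute value, the only nonsmooth function left to
  regularise.\<close>

lemma clamp_real_eq: "a \<le> c \<Longrightarrow> clamp_real a c s = (\<bar>s - a\<bar> - \<bar>s - c\<bar> + a + c) / 2"
  by (auto simp: clamp_real_def)

text \<open>For a < c the value at the two corners is 1/2, not 0 or 1. It is the limit that the
  symmetric regularisation of the absolute value produces, so the level sets of u need no separate
  treatment.\<close>

definition clamp_deriv :: "real \<Rightarrow> real \<Rightarrow> real \<Rightarrow> real" where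
  "clamp_deriv a c s = (sgn (s - a) - sgn (s - c)) / 2"

lemma clamp_deriv_bounds: "a \<le> c \<Longrightarrow> 0 \<le> clamp_deriv a c s" "a \<le> c \<Longrightarrow> clamp_deriv a c s \<le> 1"
  by (auto simp: clamp_deriv_def sgn_if)

lemma clamp_deriv_eq_1: "a < s \<Longrightarrow> s < c \<Longrightarrow> clamp_deriv a c s = 1"
  by (auto simp: clamp_deriv_def)

lemma tendsto_sqrt_add_inverse:
  "(\<lambda>n. sqrt (s\<^sup>2 + inverse (real (Suc n)))) \<longlonglongrightarrow> \<bar>s\<bar>"
  "(\<lambda>n. s / sqrt (s\<^sup>2 + inverse (real (Suc n)))) \<longlonglongrightarrow> sgn s"
proof -
  have "(\<lambda>n. sqrt (s\<^sup>2 + inverse (real (Suc n)))) \<longlonglongrightarrow> sqrt (s\<^sup>2 + 0)"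
    by (intro tendsto_intros LIMSEQ_inverse_real_of_nat)
  then show 1: "(\<lambda>n. sqrt (s\<^sup>2 + inverse (real (Suc n)))) \<longlonglongrightarrow> \<bar>s\<bar>" by simp
  show "(\<lambda>n. s / sqrt (s\<^sup>2 + inverse (real (Suc n)))) \<longlonglongrightarrow> sgn s"
  proof (cases "s = 0")
    case False
    have "(\<lambda>n. s / sqrt (s\<^sup>2 + inverse (real (Suc n)))) \<longlonglongrightarrow> s / \<bar>s\<bar>"
      using False by (intro tendsto_divide tendsto_const 1) auto
    moreover have "s / \<bar>s\<bar> = sgn s" using False by (simp add: sgn_if)
    ultimately show ?thesis by simp
  qed simp
qed

text \<open>Approximate \<open>\<bar>s\<bar>\<close> by \<open>sqrt (s\<^sup>2 + 1/n)\<close>, whose derivative converges pointwise to \<open>sgn s\<close>.\<close>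
lemma has_weak_gradient_clamp:
  fixes u :: "'a::euclidean_space \<Rightarrow> real"
  assumes \<Omega>: "open \<Omega>" "\<Omega> \<in> lmeasurable" and u: "integrable (lebesgue_on \<Omega>) u" and G: "integrable (lebesgue_on \<Omega>) G"
    and wg: "has_weak_gradient \<Omega> u G" and ac: "a \<le> c"
  shows "has_weak_gradient \<Omega> (\<lambda>x. clamp_real a c (u x)) (\<lambda>x. clamp_deriv a c (u x) *\<^sub>R G x)"
proof -
  let ?M = "lebesgue_on \<Omega>"
  interpret finite_measure ?M using \<Omega>(2) by (rule finite_measure_lebesgue_on)
  note um[measurable] = borel_measurable_integrable[OF u] and [measurable] = borel_measurable_integrable[OF G]
  define q where "q n s = sqrt (s\<^sup>2 + inverse (real (Suc n)))" for n and s :: real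
  have q_pos: "0 < s\<^sup>2 + inverse (real (Suc n))" for n s
    by (rule add_nonneg_pos) auto
  have q_der: "(q n has_real_derivative s / q n s) (at s)" for n s
  proof -
    have "((\<lambda>s. sqrt (s\<^sup>2 + inverse (real (Suc n)))) has_real_derivative
        (inverse (sqrt (s\<^sup>2 + inverse (real (Suc n)))) / 2) * (2 * s)) (at s)"
      using q_pos[of s n] by (intro DERIV_chain'[OF _ DERIV_real_sqrt]) (auto intro!: derivative_eq_intros)
    then show ?thesis by (simp add: q_def[abs_def] field_simps)
  qed
  have q_pos': "0 < q n s" for n s
    unfolding q_def using q_pos by simp
  have q_ge: "\<bar>s\<bar> \<le> q n s" for n s
    unfolding q_def by (rule real_le_rsqrt) simp
  have q_le: "q n s \<le> \<bar>s\<bar> + 1" for n s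
  proof -
    have "inverse (real (Suc n)) \<le> 1" by (simp add: inverse_le_1_iff)
    then have "inverse (real (Suc n)) \<le> 1 + 2 * \<bar>s\<bar>" by (smt (verit) abs_ge_zero)
    then show ?thesis
      unfolding q_def by (intro real_le_lsqrt) (simp_all add: power2_sum)
  qed
  have q_der_le: "\<bar>s / q n s\<bar> \<le> 1" for n s
    using q_ge[of s n] q_pos'[of n s] by simp
  have q_der_cont: "continuous_on UNIV (\<lambda>s. (s - t) / q n (s - t))" for n t
    using q_pos'[of n] DERIV_isCont[OF q_der]
    by (intro continuous_intros continuous_on_compose2[of UNIV "q n" _ "\<lambda>s. s - t"])
      (auto simp: continuous_at_imp_continuous_on less_imp_neq[THEN not_sym])
  define f where "f n s = (q n (s - a) - q n (s - c) + a + c) / 2" for n s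
  define f' where "f' n s = ((s - a) / q n (s - a) - (s - c) / q n (s - c)) / 2" for n s
  have f_der: "(f n has_real_derivative f' n s) (at s)" for n s
  proof -
    have "((\<lambda>s. q n (s - t)) has_real_derivative (s - t) / q n (s - t)) (at s)" for t
    proof -
      have "((\<lambda>s. s - t) has_real_derivative 1) (at s)" by (auto intro!: derivative_eq_intros)
      from DERIV_chain'[OF this q_der] show ?thesis by simp
    qed
    from this[of a] this[of c] show ?thesis
      unfolding f_def f'_def by (auto intro!: derivative_eq_intros simp: mult.commute)
  qed
  have f'_cont: "continuous_on UNIV (f' n)" for n
    unfolding f'_def
    by (rule continuous_on_divide[OF continuous_on_diff[OF q_der_cont q_der_cont] continuous_on_const]) simp
  have f'_le: "\<bar>f' n s\<bar> \<le> 1" for n s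
  proof -
    have "\<bar>(x - y) / 2\<bar> \<le> 1" if "\<bar>x\<bar> \<le> 1" "\<bar>y\<bar> \<le> 1" for x y :: real
      using that by (simp add: abs_le_iff)
    from this[OF q_der_le q_der_le] show ?thesis by (simp add: f'_def)
  qed
  \<comment> \<open>Linear growth with constants independent of n supplies the dominating function,
    on a domain of finite measure.\<close>
  have f_le: "\<bar>f n s\<bar> \<le> \<bar>s\<bar> + (\<bar>a\<bar> + \<bar>c\<bar> + 1)" for n s
  proof -
    have "\<bar>(X - Y + a + c) / 2\<bar> \<le> \<bar>s\<bar> + (\<bar>a\<bar> + \<bar>c\<bar> + 1)"
      if "0 < X" "0 < Y" "X \<le> \<bar>s - a\<bar> + 1" "Y \<le> \<bar>s - c\<bar> + 1" for X Y
    proof -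
      have "X \<le> \<bar>s\<bar> + \<bar>a\<bar> + 1" "Y \<le> \<bar>s\<bar> + \<bar>c\<bar> + 1" using that by linarith+
      moreover have "a \<le> \<bar>a\<bar>" "- a \<le> \<bar>a\<bar>" "c \<le> \<bar>c\<bar>" "- c \<le> \<bar>c\<bar>" "0 \<le> \<bar>s\<bar>" by auto
      moreover have "\<bar>(X - Y + a + c) / 2\<bar> \<le> S + (A + C + 1)"
        if "X \<le> S + A + 1" "Y \<le> S + C + 1" "a \<le> A" "- a \<le> A" "c \<le> C" "- c \<le> C" "0 \<le> S" for S A C
        using that \<open>0 < X\<close> \<open>0 < Y\<close> by (simp add: abs_le_iff)
      ultimately show ?thesis by blast
    qed
    from this[OF q_pos' q_pos' q_le q_le] show ?thesis by (simp add: f_def)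
  qed
  have f_lim: "(\<lambda>n. f n s) \<longlonglongrightarrow> clamp_real a c s" for s
    unfolding clamp_real_eq[OF ac] f_def q_def by (intro tendsto_intros tendsto_sqrt_add_inverse) auto
  have f'_lim: "(\<lambda>n. f' n s) \<longlonglongrightarrow> clamp_deriv a c s" for s
    unfolding clamp_deriv_def f'_def q_def by (intro tendsto_intros tendsto_sqrt_add_inverse) auto
  have [measurable]: "f n \<in> borel_measurable borel" "f' n \<in> borel_measurable borel" for n
    using f'_cont DERIV_isCont[OF f_der]
    by (auto intro!: borel_measurable_continuous_onI simp: continuous_at_imp_continuous_on)
  have [measurable]: "clamp_deriv a c \<in> borel_measurable borel" "clamp_real a c \<in> borel_measurable borel"
    unfolding clamp_deriv_def clamp_real_def by measurable
  have dom: "integrable ?M (\<lambda>x. \<bar>u x\<bar> + (\<bar>a\<bar> + \<bar>c\<bar> + 1))"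
    using u by simp
  have fu: "integrable ?M (\<lambda>x. f n (u x))" for n
    by (rule Bochner_Integration.integrable_bound[OF dom]) (auto intro!: order_trans[OF f_le])
  have cu: "integrable ?M (\<lambda>x. clamp_real a c (u x))"
    by (rule Bochner_Integration.integrable_bound[OF dom]) (auto simp: clamp_real_def)
  have bound: "integrable ?M (\<lambda>x. k (u x) *\<^sub>R G x)"
    if "k \<in> borel_measurable borel" "\<And>s. \<bar>k s\<bar> \<le> 1" for k
    by (rule Bochner_Integration.integrable_bound[OF G]) (use that in \<open>auto intro!: mult_left_le_one_le\<close>)
  have cd: "\<bar>clamp_deriv a c s\<bar> \<le> 1" for s
    using clamp_deriv_bounds[OF ac, of s] by simp
  show ?thesis
  proof (rule has_weak_gradient_L1_limit[OF \<Omega>(1) cu bound fu bound])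
    show "has_weak_gradient \<Omega> (\<lambda>x. f n (u x)) (\<lambda>x. f' n (u x) *\<^sub>R G x)" for n
      by (rule has_weak_gradient_compose[OF \<Omega>(1) u G fu wg f_der f'_cont f'_le])
    have "(\<lambda>n. LINT x|?M. \<bar>f n (u x) - clamp_real a c (u x)\<bar>) \<longlonglongrightarrow> (LINT x|?M. 0)"
    proof (rule integral_dominated_convergence[where w="\<lambda>x. 2 * (\<bar>u x\<bar> + (\<bar>a\<bar> + \<bar>c\<bar> + 1))"])
      show "AE x in ?M. (\<lambda>n. \<bar>f n (u x) - clamp_real a c (u x)\<bar>) \<longlonglongrightarrow> 0"
        by (intro AE_I2 tendsto_rabs_zero LIM_zero f_lim)
      show "AE x in ?M. norm \<bar>f n (u x) - clamp_real a c (u x)\<bar> \<le> 2 * (\<bar>u x\<bar> + (\<bar>a\<bar> + \<bar>c\<bar> + 1))" for n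
      proof (rule AE_I2)
        fix x
        have "\<bar>clamp_real a c (u x)\<bar> \<le> \<bar>u x\<bar> + (\<bar>a\<bar> + \<bar>c\<bar> + 1)" by (auto simp: clamp_real_def)
        with add_mono[OF f_le[of n "u x"] this] abs_triangle_ineq4[of "f n (u x)" "clamp_real a c (u x)"]
        show "norm \<bar>f n (u x) - clamp_real a c (u x)\<bar> \<le> 2 * (\<bar>u x\<bar> + (\<bar>a\<bar> + \<bar>c\<bar> + 1))"
          by simp
      qed
    qed (use integrable_mult_right[OF dom, of 2] in measurable)
    then show "(\<lambda>n. LINT x|?M. \<bar>f n (u x) - clamp_real a c (u x)\<bar>) \<longlonglongrightarrow> 0" by simp
    have "(\<lambda>n. LINT x|?M. norm (f' n (u x) *\<^sub>R G x - clamp_deriv a c (u x) *\<^sub>R G x)) \<longlonglongrightarrow> (LINT x|?M. 0)"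
    proof (rule integral_dominated_convergence[where w="\<lambda>x. 2 * norm (G x)"])
      show "AE x in ?M. (\<lambda>n. norm (f' n (u x) *\<^sub>R G x - clamp_deriv a c (u x) *\<^sub>R G x)) \<longlonglongrightarrow> 0"
        by (intro AE_I2 tendsto_norm_zero LIM_zero tendsto_scaleR f'_lim tendsto_const)
      show "AE x in ?M. norm (norm (f' n (u x) *\<^sub>R G x - clamp_deriv a c (u x) *\<^sub>R G x)) \<le> 2 * norm (G x)" for n
      proof (rule AE_I2)
        fix x
        have "\<bar>f' n (u x) - clamp_deriv a c (u x)\<bar> \<le> 2"
          using f'_le[of n "u x"] cd[of "u x"] abs_triangle_ineq4[of "f' n (u x)" "clamp_deriv a c (u x)"] by simp
        then show "norm (norm (f' n (u x) *\<^sub>R G x - clamp_deriv a c (u x) *\<^sub>R G x)) \<le> 2 * norm (G x)"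
          by (simp add: scaleR_diff_left[symmetric] mult_right_mono)
      qed
    qed (use integrable_norm[OF G] in \<open>measurable, simp\<close>)
    then show "(\<lambda>n. LINT x|?M. norm (f' n (u x) *\<^sub>R G x - clamp_deriv a c (u x) *\<^sub>R G x)) \<longlonglongrightarrow> 0" by simp
  qed (use cd f'_le in auto)
qed

section \<open>Variable exponent spaces\<close>

lemma Fatou_bound:
  fixes f :: "nat \<Rightarrow> 'a \<Rightarrow> real"
  assumes int: "\<And>n. integrable M (f n)" and nn: "\<And>n. AE x in M. 0 \<le> f n x"
    and lim: "AE x in M. (\<lambda>n. f n x) \<longlonglongrightarrow> g x" and g: "g \<in> borel_measurable M"
    and le: "\<And>n. (LINT x|M. f n x) \<le> c n" and c: "c \<longlonglongrightarrow> C"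
  shows "integrable M g" "(LINT x|M. g x) \<le> C"
proof -
  have g_nn: "AE x in M. 0 \<le> g x"
    using lim nn[THEN AE_all_countable[THEN iffD2, OF allI]]
    by eventually_elim (rule LIMSEQ_le_const, auto)
  have c_nn: "0 \<le> c n" for n
    using le[of n] integral_nonneg_AE[OF nn[of n]] by linarith
  then have C: "0 \<le> C" by (intro LIMSEQ_le_const[OF c]) auto
  have "(\<integral>\<^sup>+x. ennreal (g x) \<partial>M) = (\<integral>\<^sup>+x. liminf (\<lambda>n. ennreal (f n x)) \<partial>M)"
  proof (rule nn_integral_cong_AE)
    show "AE x in M. ennreal (g x) = liminf (\<lambda>n. ennreal (f n x))"
      using lim
    proof eventually_elim
      case (elim x)
      then have "(\<lambda>n. ennreal (f n x)) \<longlonglongrightarrow> ennreal (g x)" by (rule tendsto_ennrealI)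
      then show ?case by (simp add: lim_imp_Liminf)
    qed
  qed
  also have "\<dots> \<le> liminf (\<lambda>n. \<integral>\<^sup>+x. ennreal (f n x) \<partial>M)"
    using int by (intro nn_integral_liminf) auto
  also have "\<dots> = liminf (\<lambda>n. ennreal (LINT x|M. f n x))"
    using int nn by (simp add: nn_integral_eq_integral)
  also have "\<dots> \<le> liminf (\<lambda>n. ennreal (c n))"
    by (intro Liminf_mono always_eventually allI ennreal_leI le)
  also have "\<dots> = ennreal C"
    using tendsto_ennrealI[OF c] by (simp add: lim_imp_Liminf)
  finally have le: "(\<integral>\<^sup>+x. ennreal (g x) \<partial>M) \<le> ennreal C" .
  show int_g: "integrable M g"
    using g g_nn le by (intro integrableI_nonneg) (auto simp: le_less_trans)
  show "(LINT x|M. g x) \<le> C"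
    using le C by (simp add: nn_integral_eq_integral[OF int_g g_nn])
qed

lemma powr_add_le:
  fixes a b r P :: real
  assumes "0 \<le> a" "0 \<le> b" "0 < r" "r \<le> P"
  shows "(a + b) powr r \<le> 2 powr P * (a powr r + b powr r)"
proof -
  have "(a + b) powr r \<le> (2 * max a b) powr r"
    using assms by (intro powr_mono2) auto
  also have "\<dots> = 2 powr r * max a b powr r"
    using assms by (simp add: powr_mult)
  also have "\<dots> \<le> 2 powr P * (a powr r + b powr r)"
    using assms by (intro mult_mono powr_mono) (auto simp: max_def)
  finally show ?thesis .
qed

text \<open>Above the level K one has \<open>t = t powr (1 - r) * t powr r\<close>, and the first
  factor is at most \<open>K powr (1 - q)\<close>. The tail thus carries a factor that is small
  uniformly over all exponents from q upwards, which is the source of uniform integrability.\<close>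

lemma le_truncated_plus_powr:
  fixes t K q r :: real
  assumes "1 \<le> K" "0 \<le> t" "1 < q" "q \<le> r"
  shows "t \<le> min t K + K powr (1 - q) * t powr r"
proof (cases "t \<le> K")
  case False
  then have t: "K < t" "0 < t" "0 < K" using assms by auto
  have "t = t powr (1 - r) * t powr r"
    using t by (simp add: powr_add[symmetric])
  also have "\<dots> \<le> K powr (1 - q) * t powr r"
  proof (rule mult_right_mono)
    have "t powr (1 - r) \<le> K powr (1 - r)"
      using t assms by (intro powr_mono2') auto
    also have "\<dots> \<le> K powr (1 - q)"
      using assms by (intro powr_mono) auto
    finally show "t powr (1 - r) \<le> K powr (1 - q)" .
  qed simp
  finally show ?thesis using t by simp
qed (use assms in simp)

text \<open>The weights in Young's inequality are at most 1. Dropping them leaves a bound with no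
  constant depending on r, hence uniform in x for a variable exponent.\<close>

lemma Young_powr:
  fixes a b r :: real
  assumes "1 < r" "0 \<le> a" "0 \<le> b"
  shows "a * b \<le> a powr (r / (r - 1)) + b powr r"
proof -
  have "a * b \<le> a powr (r / (r - 1)) / (r / (r - 1)) + b powr r / r"
    using assms by (intro Youngs_inequality) (auto simp: field_simps)
  also have "\<dots> \<le> a powr (r / (r - 1)) + b powr r"
  proof (rule add_mono)
    have "1 \<le> r / (r - 1)" using assms by (simp add: field_simps)
    then show "a powr (r / (r - 1)) / (r / (r - 1)) \<le> a powr (r / (r - 1))"
      using mult_left_mono[of 1 "r / (r - 1)" "a powr (r / (r - 1))"] by (subst divide_le_eq) auto
    show "b powr r / r \<le> b powr r"
      using assms mult_left_mono[of 1 r "b powr r"] by (subst divide_le_eq) auto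
  qed
  finally show ?thesis .
qed

section \<open>Function spaces over a fixed domain and exponent\<close>

locale var_exp_domain =
  fixes \<Omega> :: "'a::euclidean_space set" and p :: "'a \<Rightarrow> real" and pmin pmax :: real
  assumes open_domain: "open \<Omega>" and lmeas_domain: "\<Omega> \<in> lmeasurable"
    and p_meas [measurable]: "p \<in> borel_measurable (lebesgue_on \<Omega>)"
    and pmin: "1 < pmin" and p_ge: "\<And>x. x \<in> \<Omega> \<Longrightarrow> pmin \<le> p x" and p_le: "\<And>x. x \<in> \<Omega> \<Longrightarrow> p x \<le> pmax"
begin

abbreviation "M \<equiv> lebesgue_on \<Omega>"
abbreviation "grad \<equiv> weak_gradient \<Omega>"

sublocale finite_measure M
  using lmeas_domain by (rule finite_measure_lebesgue_on)

lemma p_pos: "x \<in> \<Omega> \<Longrightarrow> 0 < p x" "x \<in> \<Omega> \<Longrightarrow> 1 < p x"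
  using p_ge[of x] pmin by auto

lemma LpD:
  assumes "u \<in> Lp_var \<Omega> p"
  shows "u \<in> borel_measurable M" "integrable M (\<lambda>x. \<bar>u x\<bar> powr p x)"
  using assms by (auto simp: Lp_var_def)

lemma Lp_bound:
  assumes u: "u \<in> Lp_var \<Omega> p" and v: "v \<in> borel_measurable M" "AE x in M. \<bar>v x\<bar> \<le> \<bar>u x\<bar>"
  shows "v \<in> Lp_var \<Omega> p"
proof -
  have "integrable M (\<lambda>x. \<bar>v x\<bar> powr p x)"
  proof (rule Bochner_Integration.integrable_bound[OF LpD(2)[OF u]])
    show "AE x in M. norm (\<bar>v x\<bar> powr p x) \<le> norm (\<bar>u x\<bar> powr p x)"
      using v(2) AE_space
    proof eventually_elim
      case (elim x)
      then show ?case using p_pos[of x] by (auto intro!: powr_mono2)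
    qed
  qed (use v in measurable)
  with v show ?thesis by (simp add: Lp_var_def)
qed

lemma Lp_add:
  assumes u: "u \<in> Lp_var \<Omega> p" and v: "v \<in> Lp_var \<Omega> p"
  shows "(\<lambda>x. \<bar>u x\<bar> + \<bar>v x\<bar>) \<in> Lp_var \<Omega> p"
proof -
  note [measurable] = LpD(1)[OF u] LpD(1)[OF v]
  have "integrable M (\<lambda>x. 2 powr pmax * (\<bar>u x\<bar> powr p x + \<bar>v x\<bar> powr p x))"
    using LpD(2)[OF u] LpD(2)[OF v] by simp
  then have "integrable M (\<lambda>x. \<bar>\<bar>u x\<bar> + \<bar>v x\<bar>\<bar> powr p x)"
  proof (rule Bochner_Integration.integrable_bound)
    show "AE x in M. norm (\<bar>\<bar>u x\<bar> + \<bar>v x\<bar>\<bar> powr p x) \<le> norm (2 powr pmax * (\<bar>u x\<bar> powr p x + \<bar>v x\<bar> powr p x))"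
      by (rule AE_I2) (use p_pos p_le powr_add_le in \<open>auto simp: abs_mult\<close>)
  qed measurable
  then show ?thesis by (simp add: Lp_var_def)
qed

lemma Lp_scale:
  assumes u: "u \<in> Lp_var \<Omega> p"
  shows "(\<lambda>x. a * u x) \<in> Lp_var \<Omega> p"
proof -
  note [measurable] = LpD(1)[OF u]
  \<comment> \<open>A base of at least 1 makes the power increase with its exponent, so the single
    exponent \<open>pmax\<close> serves all x.\<close>
  have "integrable M (\<lambda>x. max 1 \<bar>a\<bar> powr pmax * \<bar>u x\<bar> powr p x)"
    using LpD(2)[OF u] by simp
  then have "integrable M (\<lambda>x. \<bar>a * u x\<bar> powr p x)"
  proof (rule Bochner_Integration.integrable_bound)
    show "AE x in M. norm (\<bar>a * u x\<bar> powr p x) \<le> norm (max 1 \<bar>a\<bar> powr pmax * \<bar>u x\<bar> powr p x)"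
    proof (rule AE_I2)
      fix x assume x: "x \<in> space M"
      have "\<bar>a\<bar> powr p x \<le> max 1 \<bar>a\<bar> powr p x"
        using x p_pos[of x] by (intro powr_mono2) auto
      also have "\<dots> \<le> max 1 \<bar>a\<bar> powr pmax"
        using x p_le[of x] by (intro powr_mono) auto
      finally show "norm (\<bar>a * u x\<bar> powr p x) \<le> norm (max 1 \<bar>a\<bar> powr pmax * \<bar>u x\<bar> powr p x)"
        by (simp add: abs_mult powr_mult mult_right_mono)
    qed
  qed measurable
  then show ?thesis by (simp add: Lp_var_def)
qed

lemma Lp_bounded:
  assumes v: "v \<in> borel_measurable M" "AE x in M. \<bar>v x\<bar> \<le> C"
  shows "v \<in> Lp_var \<Omega> p"
proof (rule Lp_bound[OF _ v(1)])
  show "(\<lambda>x. C * 1) \<in> Lp_var \<Omega> p"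
    by (rule Lp_scale) (simp add: Lp_var_def)
  show "AE x in M. \<bar>v x\<bar> \<le> \<bar>C * 1\<bar>"
    using v(2) by eventually_elim simp
qed

lemma Lp_integrable:
  assumes u: "u \<in> Lp_var \<Omega> p"
  shows "integrable M u"
proof (rule Bochner_Integration.integrable_bound)
  show "integrable M (\<lambda>x. 1 + \<bar>u x\<bar> powr p x)"
    using LpD(2)[OF u] by simp
  show "AE x in M. norm (u x) \<le> norm (1 + \<bar>u x\<bar> powr p x)"
  proof (rule AE_I2)
    fix x assume x: "x \<in> space M"
    show "norm (u x) \<le> norm (1 + \<bar>u x\<bar> powr p x)"
    proof (cases "\<bar>u x\<bar> \<le> 1")
      case False
      then have "\<bar>u x\<bar> powr 1 \<le> \<bar>u x\<bar> powr p x"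
        using x p_pos[of x] by (intro powr_mono) auto
      with False show ?thesis by simp
    qed (simp add: add_increasing2)
  qed
qed (rule LpD(1)[OF u])

lemma Lp_conj_integrable:
  assumes u: "u \<in> Lp_var \<Omega> (conj_exponent p)" and v: "v \<in> Lp_var \<Omega> p"
  shows "integrable M (\<lambda>x. u x * v x)"
proof (rule Bochner_Integration.integrable_bound)
  show "integrable M (\<lambda>x. \<bar>u x\<bar> powr conj_exponent p x + \<bar>v x\<bar> powr p x)"
    using u v by (simp add: Lp_var_def)
  show "AE x in M. norm (u x * v x) \<le> norm (\<bar>u x\<bar> powr conj_exponent p x + \<bar>v x\<bar> powr p x)"
    by (rule AE_I2) (use p_pos Young_powr in \<open>auto simp: abs_mult conj_exponent_def\<close>)
qed (use u v in \<open>auto simp: Lp_var_def\<close>)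

text \<open>A weak gradient is only known to be integrable on compact subsets; exhausting the domain
  by countably many of them gives measurability on all of it.\<close>

lemma weak_gradient_measurable:
  assumes "has_weak_gradient \<Omega> u G"
  shows "G \<in> borel_measurable M"
proof -
  obtain C where C: "\<And>n::nat. compact (C n)" "\<And>n. C n \<subseteq> \<Omega>" "\<And>n. C n \<subseteq> interior (C (Suc n))"
      "\<Union>(range C) = \<Omega>"
    using open_Union_compact_subsets[OF open_domain] by (metis (no_types))
  have inc: "incseq C"
    using C(3) interior_subset by (intro incseq_SucI) blast
  show ?thesis
  proof (rule borel_measurable_LIMSEQ_metric)
    fix n
    have "set_integrable lebesgue (C n) G"
      using assms C(1,2) by (auto simp: has_weak_gradient_def)
    then show "(\<lambda>x. indicator (C n) x *\<^sub>R G x) \<in> borel_measurable M"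
      unfolding set_integrable_def by (intro measurable_restrict_space1 borel_measurable_integrable)
  next
    fix x assume "x \<in> space M"
    then obtain N where "x \<in> C N" using C(4) by auto
    then have "x \<in> C n" if "n \<ge> N" for n using inc that by (auto simp: incseq_def)
    then show "(\<lambda>n. indicator (C n) x *\<^sub>R G x) \<longlonglongrightarrow> G x"
      by (intro tendsto_eventually eventually_sequentiallyI[of N]) auto
  qed
qed

text \<open>The second conclusion is how every concrete gradient is computed: the representative
  selected by \<open>weak_gradient\<close> is unknown, but agrees almost everywhere with any
  gradient exhibited.\<close>

lemma W1pI:
  assumes u: "u \<in> Lp_var \<Omega> p" and wg: "has_weak_gradient \<Omega> u G" and G: "(\<lambda>x. norm (G x)) \<in> Lp_var \<Omega> p"
  shows "u \<in> W1p_var \<Omega> p" "AE x in M. grad u x = G x"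
proof -
  show "u \<in> W1p_var \<Omega> p" using assms by (auto simp: W1p_var_def)
  have "has_weak_gradient \<Omega> u (grad u)"
    unfolding weak_gradient_def by (rule someI[of "has_weak_gradient \<Omega> u", OF wg])
  then show "AE x in M. grad u x = G x"
    using has_weak_gradient_unique[OF open_domain _ wg] by blast
qed

text \<open>Membership speaks of some gradient with p-integrable norm. Almost everywhere uniqueness
  carries the norm bound over to the selected one.\<close>

lemma W1pD:
  assumes u: "u \<in> W1p_var \<Omega> p"
  shows "u \<in> Lp_var \<Omega> p" "u \<in> borel_measurable M" "integrable M u" "has_weak_gradient \<Omega> u (grad u)"
    "grad u \<in> borel_measurable M" "(\<lambda>x. norm (grad u x)) \<in> Lp_var \<Omega> p" "integrable M (grad u)"
proof -
  obtain G where G: "has_weak_gradient \<Omega> u G" "(\<lambda>x. norm (G x)) \<in> Lp_var \<Omega> p"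
    using u by (auto simp: W1p_var_def)
  show uL: "u \<in> Lp_var \<Omega> p" using u by (auto simp: W1p_var_def)
  show "u \<in> borel_measurable M" "integrable M u" using LpD[OF uL] Lp_integrable[OF uL] by auto
  show wg: "has_weak_gradient \<Omega> u (grad u)"
    unfolding weak_gradient_def by (rule someI[of "has_weak_gradient \<Omega> u", OF G(1)])
  show gm: "grad u \<in> borel_measurable M"
    by (rule weak_gradient_measurable[OF wg])
  show gL: "(\<lambda>x. norm (grad u x)) \<in> Lp_var \<Omega> p"
  proof (rule Lp_bound[OF G(2)])
    show "AE x in M. \<bar>norm (grad u x)\<bar> \<le> \<bar>norm (G x)\<bar>"
      using W1pI(2)[OF uL G] by eventually_elim simp
  qed (use gm in measurable)
  show "integrable M (grad u)"
    using Lp_integrable[OF gL] gm by (simp add: integrable_norm_iff)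
qed

lemma W1p_combine:
  assumes u: "u \<in> W1p_var \<Omega> p" and v: "v \<in> W1p_var \<Omega> p"
  shows "(\<lambda>x. a * u x + c * v x) \<in> W1p_var \<Omega> p"
    "AE x in M. grad (\<lambda>x. a * u x + c * v x) x = a *\<^sub>R grad u x + c *\<^sub>R grad v x"
proof -
  note u = W1pD[OF u] and v = W1pD[OF v]
  note [measurable] = u(2,5) v(2,5)
  have 1: "(\<lambda>x. a * u x + c * v x) \<in> Lp_var \<Omega> p"
  proof (rule Lp_bound[OF Lp_add[OF Lp_scale[OF u(1), of a] Lp_scale[OF v(1), of c]]])
    show "AE x in M. \<bar>a * u x + c * v x\<bar> \<le> \<bar>\<bar>a * u x\<bar> + \<bar>c * v x\<bar>\<bar>"
      by (intro AE_I2) (metis abs_add_abs abs_triangle_ineq)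
  qed (use u(2) v(2) in simp)
  have 2: "(\<lambda>x. norm (a *\<^sub>R grad u x + c *\<^sub>R grad v x)) \<in> Lp_var \<Omega> p"
  proof (rule Lp_bound[OF Lp_add[OF Lp_scale[OF u(6), of a] Lp_scale[OF v(6), of c]]])
    show "AE x in M. \<bar>norm (a *\<^sub>R grad u x + c *\<^sub>R grad v x)\<bar> \<le> \<bar>\<bar>a * norm (grad u x)\<bar> + \<bar>c * norm (grad v x)\<bar>\<bar>"
      by (intro AE_I2) (auto simp: abs_mult intro!: norm_triangle_le)
  qed measurable
  have 3: "has_weak_gradient \<Omega> (\<lambda>x. a * u x + c * v x) (\<lambda>x. a *\<^sub>R grad u x + c *\<^sub>R grad v x)"
    by (rule has_weak_gradient_add_scale[OF open_domain u(3,7,4) v(3,7,4)])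
  show "(\<lambda>x. a * u x + c * v x) \<in> W1p_var \<Omega> p"
    "AE x in M. grad (\<lambda>x. a * u x + c * v x) x = a *\<^sub>R grad u x + c *\<^sub>R grad v x"
    using W1pI[OF 1 3 2] by auto
qed

lemma W1p_clamp:
  assumes u: "u \<in> W1p_var \<Omega> p" and ac: "a \<le> c"
  shows "(\<lambda>x. clamp_real a c (u x)) \<in> W1p_var \<Omega> p"
    "AE x in M. grad (\<lambda>x. clamp_real a c (u x)) x = clamp_deriv a c (u x) *\<^sub>R grad u x"
proof -
  note u = W1pD[OF u]
  note [measurable] = u(2,5)
  have [measurable]: "clamp_deriv a c \<in> borel_measurable borel" "clamp_real a c \<in> borel_measurable borel"
    unfolding clamp_deriv_def clamp_real_def by measurable
  have 1: "(\<lambda>x. clamp_real a c (u x)) \<in> Lp_var \<Omega> p"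
    by (rule Lp_bounded[where C = "max \<bar>a\<bar> \<bar>c\<bar>"]) (measurable, use ac in \<open>auto simp: clamp_real_def\<close>)
  have 2: "(\<lambda>x. norm (clamp_deriv a c (u x) *\<^sub>R grad u x)) \<in> Lp_var \<Omega> p"
  proof (rule Lp_bound[OF u(6)])
    show "AE x in M. \<bar>norm (clamp_deriv a c (u x) *\<^sub>R grad u x)\<bar> \<le> \<bar>norm (grad u x)\<bar>"
      using clamp_deriv_bounds[OF ac] by (intro AE_I2) (auto intro!: mult_left_le_one_le)
  qed measurable
  have 3: "has_weak_gradient \<Omega> (\<lambda>x. clamp_real a c (u x)) (\<lambda>x. clamp_deriv a c (u x) *\<^sub>R grad u x)"
    by (rule has_weak_gradient_clamp[OF open_domain lmeas_domain u(3,7,4) ac])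
  show "(\<lambda>x. clamp_real a c (u x)) \<in> W1p_var \<Omega> p"
    "AE x in M. grad (\<lambda>x. clamp_real a c (u x)) x = clamp_deriv a c (u x) *\<^sub>R grad u x"
    using W1pI[OF 1 3 2] by auto
qed

lemma W1p_zero: "(\<lambda>x. 0) \<in> W1p_var \<Omega> p"
proof (rule W1pI(1))
  show "(\<lambda>x. 0) \<in> Lp_var \<Omega> p" "(\<lambda>x. norm ((\<lambda>x. 0) x)) \<in> Lp_var \<Omega> p" for x :: 'a
    by (auto intro!: Lp_bounded[where C = 0])
  show "has_weak_gradient \<Omega> (\<lambda>x. 0) (\<lambda>x. 0)"
    by (rule has_weak_gradientI[OF open_domain]) auto
qed

text \<open>Since \<open>pmin > 1\<close>, a bounded modular gives uniform integrability.\<close>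
lemma L1_convergence_of_bounded_modular:
  fixes G :: "nat \<Rightarrow> 'a \<Rightarrow> 'b::euclidean_space"
  assumes G: "\<And>n. G n \<in> borel_measurable M" "\<And>n. (\<lambda>x. norm (G n x)) \<in> Lp_var \<Omega> p"
    and R: "\<And>n. (LINT x|M. norm (G n x) powr p x) \<le> R"
    and H: "H \<in> borel_measurable M" and lim: "AE x in M. (\<lambda>n. G n x) \<longlonglongrightarrow> H x"
  shows "(\<lambda>x. norm (H x)) \<in> Lp_var \<Omega> p" "(\<lambda>n. LINT x|M. norm (G n x - H x)) \<longlonglongrightarrow> 0"
proof -
  note [measurable] = G(1) H
  have lim': "AE x in M. (\<lambda>n. norm (G n x) powr p x) \<longlonglongrightarrow> norm (H x) powr p x"
    using lim AE_space
  proof eventually_elim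
    case (elim x)
    then show ?case using p_pos(1)[of x] by (intro tendsto_powr' tendsto_norm tendsto_const) auto
  qed
  have Gi: "integrable M (\<lambda>x. norm (G n x) powr p x)" for n
    using LpD(2)[OF G(2)[of n]] by simp
  have Hi: "integrable M (\<lambda>x. norm (H x) powr p x)" "(LINT x|M. norm (H x) powr p x) \<le> R"
    by (rule Fatou_bound[OF Gi _ lim' _ R tendsto_const]; measurable; simp)+
  then show HL: "(\<lambda>x. norm (H x)) \<in> Lp_var \<Omega> p"
    by (simp add: Lp_var_def)
  have diff_bound: "norm (G n x - H x) powr p x \<le> 2 powr pmax * (norm (G n x) powr p x + norm (H x) powr p x)"
    if "x \<in> \<Omega>" for n x
  proof -
    have "norm (G n x - H x) powr p x \<le> (norm (G n x) + norm (H x)) powr p x"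
      using p_pos[OF that] by (intro powr_mono2 norm_triangle_ineq4) auto
    also have "\<dots> \<le> 2 powr pmax * (norm (G n x) powr p x + norm (H x) powr p x)"
      using p_pos[OF that] p_le[OF that] by (intro powr_add_le) auto
    finally show ?thesis .
  qed
  have dom: "integrable M (\<lambda>x. 2 powr pmax * (norm (G n x) powr p x + norm (H x) powr p x))" for n
    using Gi Hi(1) by simp
  have diff_int: "integrable M (\<lambda>x. norm (G n x - H x) powr p x)" for n
    by (rule Bochner_Integration.integrable_bound[OF dom[of n]], measurable)
      (use diff_bound in \<open>auto simp: abs_mult\<close>)
  define C where "C = 2 powr pmax * (R + R)"
  have C: "(LINT x|M. norm (G n x - H x) powr p x) \<le> C" for n
  proof -
    have "(LINT x|M. norm (G n x - H x) powr p x)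
        \<le> (LINT x|M. 2 powr pmax * (norm (G n x) powr p x + norm (H x) powr p x))"
      using diff_int dom diff_bound by (intro integral_mono) auto
    also have "\<dots> = 2 powr pmax * ((LINT x|M. norm (G n x) powr p x) + (LINT x|M. norm (H x) powr p x))"
      using Gi Hi(1) by simp
    also have "\<dots> \<le> C"
      unfolding C_def using R Hi(2) by (intro mult_left_mono add_mono) auto
    finally show ?thesis .
  qed
  have C0: "0 \<le> C"
    using C[of 0] by (rule order_trans[rotated]) (auto intro!: Bochner_Integration.integral_nonneg)
  have min_int: "integrable M (\<lambda>x. min (norm (G n x - H x)) K)" if "0 \<le> K" for n K
    by (rule Bochner_Integration.integrable_bound[where f = "\<lambda>x. K"]) (measurable, use that in auto)
  have min_lim: "(\<lambda>n. LINT x|M. min (norm (G n x - H x)) K) \<longlonglongrightarrow> 0" if "0 \<le> K" for K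
  proof -
    have "(\<lambda>n. LINT x|M. min (norm (G n x - H x)) K) \<longlonglongrightarrow> (LINT x|M. 0)"
    proof (rule integral_dominated_convergence[where w = "\<lambda>x. K"])
      show "AE x in M. (\<lambda>n. min (norm (G n x - H x)) K) \<longlonglongrightarrow> 0"
        using lim
      proof eventually_elim
        case (elim x)
        have "(\<lambda>n. min (norm (G n x - H x)) K) \<longlonglongrightarrow> min (norm (H x - H x)) K"
          by (intro tendsto_intros elim)
        with that show ?case by simp
      qed
    qed (use that in auto)
    then show ?thesis by simp
  qed
  show "(\<lambda>n. LINT x|M. norm (G n x - H x)) \<longlonglongrightarrow> 0"
  proof (rule LIMSEQ_I)
    fix \<epsilon> :: real assume \<epsilon>: "\<epsilon> > 0"
    \<comment> \<open>The level K is fixed before n: it makes the tail smaller than \<epsilon>/2 for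
      all n simultaneously, after which dominated convergence handles the part truncated at
      K.\<close>
    have "((\<lambda>K. K powr (1 - pmin) * C) \<longlongrightarrow> 0 * C) at_top"
      using pmin by (intro tendsto_mult_right tendsto_neg_powr filterlim_ident) auto
    then have "eventually (\<lambda>K. K powr (1 - pmin) * C < \<epsilon> / 2) at_top"
      using \<epsilon> by (intro order_tendstoD(2)[of _ 0]) auto
    then have "eventually (\<lambda>K. K powr (1 - pmin) * C < \<epsilon> / 2 \<and> K \<ge> 1) at_top"
      by (intro eventually_conj eventually_ge_at_top)
    then obtain K :: real where K: "K powr (1 - pmin) * C < \<epsilon> / 2" "K \<ge> 1"
      using eventually_happens'[OF trivial_limit_at_top_linorder] by blast
    have le: "(LINT x|M. norm (G n x - H x)) \<le> (LINT x|M. min (norm (G n x - H x)) K) + K powr (1 - pmin) * C" for n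
    proof -
      have "(LINT x|M. norm (G n x - H x))
          \<le> (LINT x|M. min (norm (G n x - H x)) K + K powr (1 - pmin) * norm (G n x - H x) powr p x)"
      proof (rule order_trans[OF abs_ge_self abs_integral_le_AE])
        show "integrable M (\<lambda>x. min (norm (G n x - H x)) K + K powr (1 - pmin) * norm (G n x - H x) powr p x)"
          using min_int[of K n] diff_int K by simp
        show "AE x in M. \<bar>norm (G n x - H x)\<bar>
            \<le> min (norm (G n x - H x)) K + K powr (1 - pmin) * norm (G n x - H x) powr p x"
          using le_truncated_plus_powr[OF K(2) norm_ge_zero pmin p_ge] by (intro AE_I2) auto
      qed
      also have "\<dots> = (LINT x|M. min (norm (G n x - H x)) K) + K powr (1 - pmin) * (LINT x|M. norm (G n x - H x) powr p x)"
        using min_int[of K n] diff_int K by simp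
      also have "\<dots> \<le> (LINT x|M. min (norm (G n x - H x)) K) + K powr (1 - pmin) * C"
        using C by (intro add_left_mono mult_left_mono) auto
      finally show ?thesis .
    qed
    have "eventually (\<lambda>n. (LINT x|M. min (norm (G n x - H x)) K) < \<epsilon> / 2) sequentially"
      using min_lim[of K] K \<epsilon> by (intro order_tendstoD(2)[of _ 0]) auto
    then obtain N where N: "\<And>n. n \<ge> N \<Longrightarrow> (LINT x|M. min (norm (G n x - H x)) K) < \<epsilon> / 2"
      by (auto simp: eventually_sequentially)
    have "norm ((LINT x|M. norm (G n x - H x)) - 0) < \<epsilon>" if "n \<ge> N" for n
    proof -
      have "0 \<le> (LINT x|M. norm (G n x - H x))" by (rule Bochner_Integration.integral_nonneg) simp
      then show ?thesis using le[of n] N[OF that] K(1) by simp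
    qed
    then show "\<exists>N. \<forall>n\<ge>N. norm ((LINT x|M. norm (G n x - H x)) - 0) < \<epsilon>" by blast
  qed
qed

end

section \<open>The flux and the reaction term at a point\<close>

lemma antiderivative_exists:
  fixes f :: "real \<Rightarrow> real"
  assumes "continuous_on UNIV f"
  obtains F where "F 0 = 0" "\<And>s. (F has_real_derivative f s) (at s)"
proof -
  have "\<exists>F. \<forall>x. -\<infinity> < ereal x \<longrightarrow> ereal x < \<infinity> \<longrightarrow> (F has_vector_derivative f x) (at x)"
    using assms by (intro einterval_antiderivative) (auto simp: continuous_on_eq_continuous_at)
  then obtain F where F: "\<And>s. (F has_real_derivative f s) (at s)"
    by (auto simp: has_real_derivative_iff_has_vector_derivative)
  show ?thesis
  proof (rule that[of "\<lambda>s. F s - F 0"])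
    show "((\<lambda>s. F s - F 0) has_real_derivative f s) (at s)" for s
      using F[of s] by (auto intro!: derivative_eq_intros)
  qed simp
qed

text \<open>By the mean value theorem the chord slope of F is a value of f between the two points,
  and monotonicity compares it with \<open>f v\<close>. All convexity used for the potential and the
  energy comes from this inequality.\<close>

lemma antiderivative_subgradient:
  fixes f :: "real \<Rightarrow> real"
  assumes F: "\<And>s. (F has_real_derivative f s) (at s)" and f: "mono f"
  shows "f v * (w - v) \<le> F w - F v"
proof -
  consider "v < w" | "v = w" | "w < v" by linarith
  then show ?thesis
  proof cases
    case 1
    then obtain z where z: "v < z" "z < w" "F w - F v = (w - v) * f z"
      using MVT2[of v w F f] F by blast
    have "f v * (w - v) \<le> f z * (w - v)"
      using z f by (intro mult_right_mono) (auto simp: mono_def)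
    with z show ?thesis by (simp add: mult.commute)
  next
    case 3
    then obtain z where z: "w < z" "z < v" "F v - F w = (v - w) * f z"
      using MVT2[of w v F f] F by blast
    have "f z * (v - w) \<le> f v * (v - w)"
      using z f by (intro mult_right_mono) (auto simp: mono_def)
    with z show ?thesis by (simp add: algebra_simps)
  qed simp
qed

text \<open>The purpose is measurability: a primitive chosen separately for each x has no visible
  measurability in x, whereas its Riemann sums do. For monotone f the error telescopes to at most
  \<open>(f v - f 0) * v / (k + 1)\<close>, for either sign of v.\<close>

lemma antiderivative_Riemann_sums:
  fixes f :: "real \<Rightarrow> real"
  assumes F: "\<And>s. (F has_real_derivative f s) (at s)" and F0: "F 0 = 0" and f: "mono f"
  shows "(\<lambda>k. \<Sum>i<Suc k. f (real i / real (Suc k) * v) * (v / real (Suc k))) \<longlonglongrightarrow> F v"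
proof -
  note sg = antiderivative_subgradient[OF F f]
  have bounds: "0 \<le> F v - (\<Sum>i<Suc k. f (real i / real (Suc k) * v) * (v / real (Suc k)))"
    "F v - (\<Sum>i<Suc k. f (real i / real (Suc k) * v) * (v / real (Suc k))) \<le> (f v - f 0) * v * inverse (real (Suc k))" for k
  proof -
    define t where "t i = real i / real (Suc k) * v" for i
    have step: "t (Suc i) - t i = v / real (Suc k)" for i
      by (simp add: t_def add_divide_distrib distrib_right)
    have ends: "t (Suc k) = v" "t 0 = 0" by (simp_all add: t_def del: of_nat_Suc)
    have tel: "F v = (\<Sum>i<Suc k. F (t (Suc i)) - F (t i))"
      using sum_lessThan_telescope[of "\<lambda>i. F (t i)" "Suc k"] by (simp only: ends F0 diff_zero)
    have lower: "f (t i) * (v / real (Suc k)) \<le> F (t (Suc i)) - F (t i)" for i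
      using sg[of "t i" "t (Suc i)"] by (simp only: step)
    have upper: "F (t (Suc i)) - F (t i) \<le> f (t (Suc i)) * (v / real (Suc k))" for i
    proof -
      have "t i - t (Suc i) = - (v / real (Suc k))" using step[of i] by simp
      then show ?thesis using sg[of "t (Suc i)" "t i"] by simp
    qed
    show "0 \<le> F v - (\<Sum>i<Suc k. f (real i / real (Suc k) * v) * (v / real (Suc k)))"
      unfolding tel t_def[symmetric] using lower by (simp only: diff_ge_0_iff_ge sum_mono)
    have "F v - (\<Sum>i<Suc k. f (t i) * (v / real (Suc k)))
        \<le> (\<Sum>i<Suc k. f (t (Suc i)) * (v / real (Suc k))) - (\<Sum>i<Suc k. f (t i) * (v / real (Suc k)))"
      unfolding tel using upper by (simp only: diff_right_mono sum_mono)
    also have "\<dots> = (\<Sum>i<Suc k. f (t (Suc i)) - f (t i)) * (v / real (Suc k))"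
      by (simp only: sum_distrib_right sum_subtractf left_diff_distrib)
    also have "(\<Sum>i<Suc k. f (t (Suc i)) - f (t i)) = f v - f 0"
      by (simp only: sum_lessThan_telescope[of "\<lambda>i. f (t i)"] ends)
    finally show "F v - (\<Sum>i<Suc k. f (real i / real (Suc k) * v) * (v / real (Suc k))) \<le> (f v - f 0) * v * inverse (real (Suc k))"
      unfolding t_def[symmetric] by (simp add: field_simps)
  qed
  have "(\<lambda>k. F v - (\<Sum>i<Suc k. f (real i / real (Suc k) * v) * (v / real (Suc k)))) \<longlonglongrightarrow> 0"
  proof (rule tendsto_sandwich[OF always_eventually always_eventually tendsto_const])
    show "(\<lambda>k. (f v - f 0) * v * inverse (real (Suc k))) \<longlonglongrightarrow> 0"
      using tendsto_mult_left[OF LIMSEQ_inverse_real_of_nat, of "(f v - f 0) * v"] by simp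
  qed (use bounds in auto)
  from tendsto_diff[OF tendsto_const[of "F v"] this] show ?thesis by simp
qed

lemma isCont_if_locally_abs_continuous:
  assumes ac: "locally_abs_continuous_on_pos f" and s: "0 < s"
  shows "isCont f s"
  unfolding continuous_at_eps_delta
proof (intro allI impI)
  fix \<epsilon> :: real assume "\<epsilon> > 0"
  moreover have "abs_continuous_on_Icc (s / 2) (2 * s) f"
    using ac s by (auto simp: locally_abs_continuous_on_pos_def)
  ultimately have "\<exists>\<delta>>0. \<forall>D. finite D \<and> (\<forall>(a, b)\<in>D. s / 2 \<le> a \<and> a \<le> b \<and> b \<le> 2 * s) \<and>
        pairwise (\<lambda>I J. {fst I<..<snd I} \<inter> {fst J<..<snd J} = {}) D \<and>
        (\<Sum>(a, b)\<in>D. b - a) < \<delta> \<longrightarrow> (\<Sum>(a, b)\<in>D. \<bar>f b - f a\<bar>) < \<epsilon>"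
    unfolding abs_continuous_on_Icc_def by simp
  then obtain \<delta> where \<delta>: "\<delta> > 0"
    and D: "\<forall>D. finite D \<and> (\<forall>(a, b)\<in>D. s / 2 \<le> a \<and> a \<le> b \<and> b \<le> 2 * s) \<and>
        pairwise (\<lambda>I J. {fst I<..<snd I} \<inter> {fst J<..<snd J} = {}) D \<and>
        (\<Sum>(a, b)\<in>D. b - a) < \<delta> \<longrightarrow> (\<Sum>(a, b)\<in>D. \<bar>f b - f a\<bar>) < \<epsilon>"
    by (elim exE conjE)
  have "dist (f t) (f s) < \<epsilon>" if "dist t s < min \<delta> (s / 2)" for t
  proof -
    have t: "\<bar>t - s\<bar> < \<delta>" "s / 2 \<le> t" "t \<le> 2 * s"
      using that s by (auto simp: dist_real_def abs_if split: if_splits)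
    \<comment> \<open>Absolute continuity is used for the family consisting of the single interval
      between s and t.\<close>
    have "(\<Sum>(a, b)\<in>{(min s t, max s t)}. \<bar>f b - f a\<bar>) < \<epsilon>"
      using t s by (intro D[rule_format]) auto
    then show ?thesis by (auto simp: dist_real_def max_def min_def split: if_splits)
  qed
  then show "\<exists>d>0. \<forall>t. dist t s < d \<longrightarrow> dist (f t) (f s) < \<epsilon>"
    using \<delta> s by (intro exI[of _ "min \<delta> (s / 2)"]) auto
qed

text \<open>The structure conditions are collected at a single point, so that hypotheses holding
  almost everywhere merge into one almost everywhere statement and their consequences can be drawn
  pointwise.\<close>

locale flux_at =
  fixes \<Psi> :: "'a::euclidean_space \<Rightarrow> real \<Rightarrow> real" and x :: 'a
  assumes pos: "\<And>s. 0 < s \<Longrightarrow> 0 < \<Psi> x s"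
    and ac: "locally_abs_continuous_on_pos (\<Psi> x)"
    and lim0: "((\<lambda>s. \<Psi> x s * s) \<longlongrightarrow> 0) (at_right 0)"
    and incr: "strict_mono_on {0<..} (\<lambda>s. \<Psi> x s * s)"
begin

lemma Phi_pos: "0 < s \<Longrightarrow> Phi \<Psi> x s = \<Psi> x s * s"
  by (simp add: Phi_def)

lemma Phi_nonneg: "0 \<le> Phi \<Psi> x s"
  using pos[of "\<bar>s\<bar>"] by (auto simp: Phi_def)

lemma Phi_mono: "0 \<le> s \<Longrightarrow> s \<le> t \<Longrightarrow> Phi \<Psi> x s \<le> Phi \<Psi> x t"
proof (cases "s = 0")
  case False
  assume "0 \<le> s" "s \<le> t"
  with False show ?thesis
    using incr strict_mono_onD[OF incr, of s t] by (cases "s = t") (auto simp: Phi_pos)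
qed (simp add: Phi_nonneg, simp add: Phi_def[of _ _ 0] Phi_nonneg)

text \<open>\<open>Phi\<close> is even in s and hence not monotone on the line. Continued by 0 to
  the negative axis it becomes monotone and continuous, with a convex primitive, and agrees with
  \<open>Phi\<close> at norms.\<close>

definition Phi_plus :: "real \<Rightarrow> real" where
  "Phi_plus s = Phi \<Psi> x (max 0 s)"

lemma Phi_plus_mono: "mono Phi_plus"
  unfolding Phi_plus_def by (intro monoI Phi_mono) auto

lemma Phi_plus_cont: "continuous_on UNIV Phi_plus"
proof -
  have "isCont Phi_plus s" for s
  proof -
    consider "s < 0" | "s = 0" | "s > 0" by linarith
    then show ?thesis
    proof cases
      case 1
      have "eventually (\<lambda>t. t \<in> {..<0}) (nhds s)" using 1 by (intro eventually_nhds_in_open) auto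
      then have "eventually (\<lambda>t. Phi_plus t = 0) (nhds s)"
        by eventually_elim (auto simp: Phi_plus_def Phi_def)
      then show ?thesis by (subst isCont_cong) auto
    next
      case 2
      have "(Phi_plus \<longlongrightarrow> 0) (at_right 0)"
        by (rule Lim_transform_eventually[OF lim0])
          (auto simp: Phi_plus_def Phi_pos intro!: eventually_at_rightI[of 0 1])
      moreover have "(Phi_plus \<longlongrightarrow> 0) (at_left 0)"
        by (rule tendsto_eventually) (auto simp: Phi_plus_def Phi_def intro!: eventually_at_leftI[of "-1"])
      ultimately have "(Phi_plus \<longlongrightarrow> 0) (at 0)" by (simp add: filterlim_split_at)
      with 2 show ?thesis by (simp add: isCont_def Phi_plus_def Phi_def)
    next
      case 3
      have "eventually (\<lambda>t. t \<in> {0<..}) (nhds s)" using 3 by (intro eventually_nhds_in_open) auto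
      then have "eventually (\<lambda>t. Phi_plus t = \<Psi> x t * t) (nhds s)"
        by eventually_elim (auto simp: Phi_plus_def Phi_pos)
      moreover have "isCont (\<lambda>t. \<Psi> x t * t) s"
        using isCont_if_locally_abs_continuous[OF ac 3] by (intro continuous_intros)
      ultimately show ?thesis by (subst isCont_cong) auto
    qed
  qed
  then show ?thesis by (simp add: continuous_on_eq_continuous_at)
qed

definition prim :: "real \<Rightarrow> real" where
  "prim = (SOME F. F 0 = 0 \<and> (\<forall>s. (F has_real_derivative Phi_plus s) (at s)))"

lemma prim: "prim 0 = 0" "(prim has_real_derivative Phi_plus s) (at s)"
proof -
  have "\<exists>F. F 0 = 0 \<and> (\<forall>s. (F has_real_derivative Phi_plus s) (at s))"
    using antiderivative_exists[OF Phi_plus_cont] by metis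
  from someI_ex[OF this] show "prim 0 = 0" "(prim has_real_derivative Phi_plus s) (at s)"
    by (auto simp: prim_def)
qed

lemma potential_eq: "potential \<Psi> x \<xi> = prim (norm \<xi>)"
proof -
  have "potential \<Psi> x \<xi> = (LINT s|lborel. Phi_plus s * indicator {0..norm \<xi>} s)"
    unfolding potential_def set_lebesgue_integral_def
    by (intro Bochner_Integration.integral_cong) (auto simp: Phi_plus_def indicator_def)
  also have "\<dots> = prim (norm \<xi>) - prim 0"
    using Phi_plus_cont by (intro integral_FTC_Icc_real prim) (auto simp: continuous_on_eq_continuous_at)
  finally show ?thesis by (simp add: prim)
qed

lemma norm_flux: "norm (flux \<Psi> x \<xi>) = Phi \<Psi> x (norm \<xi>)"
  using pos[of "norm \<xi>"] by (auto simp: flux_def Phi_def)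

lemma inner_flux: "flux \<Psi> x \<xi> \<bullet> \<xi> = Phi \<Psi> x (norm \<xi>) * norm \<xi>"
  by (auto simp: flux_def Phi_def dot_square_norm power2_eq_square)

text \<open>The flux is parallel to \<xi> with length \<open>Phi\<close> at the norm of \<xi>, so
  Cauchy-Schwarz reduces the claim to the radial inequality for \<open>prim\<close>.\<close>

lemma potential_subgradient: "flux \<Psi> x \<xi> \<bullet> (\<eta> - \<xi>) \<le> potential \<Psi> x \<eta> - potential \<Psi> x \<xi>"
proof -
  have "flux \<Psi> x \<xi> \<bullet> \<eta> \<le> Phi \<Psi> x (norm \<xi>) * norm \<eta>"
    using Cauchy_Schwarz_ineq2[of "flux \<Psi> x \<xi>" \<eta>] by (simp add: norm_flux)
  then have "flux \<Psi> x \<xi> \<bullet> (\<eta> - \<xi>) \<le> Phi_plus (norm \<xi>) * (norm \<eta> - norm \<xi>)"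
    by (simp add: inner_diff_right inner_flux right_diff_distrib Phi_plus_def)
  also have "\<dots> \<le> prim (norm \<eta>) - prim (norm \<xi>)"
    by (rule antiderivative_subgradient[OF prim(2) Phi_plus_mono])
  finally show ?thesis by (simp add: potential_eq)
qed

lemma potential_cont: "isCont (potential \<Psi> x) \<xi>"
proof -
  have "isCont prim (norm \<xi>)" by (rule DERIV_isCont[OF prim(2)])
  then have "isCont (\<lambda>\<xi>. prim (norm \<xi>)) \<xi>" by (intro continuous_intros isCont_o2[of \<xi> norm prim]) auto
  then show ?thesis by (simp add: potential_eq[abs_def])
qed

lemma potential_mono: "norm \<xi> \<le> norm \<eta> \<Longrightarrow> potential \<Psi> x \<xi> \<le> potential \<Psi> x \<eta>"
proof -
  assume le: "norm \<xi> \<le> norm \<eta>"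
  have "0 \<le> Phi_plus (norm \<xi>) * (norm \<eta> - norm \<xi>)"
    using le Phi_nonneg by (simp add: Phi_plus_def)
  also have "\<dots> \<le> prim (norm \<eta>) - prim (norm \<xi>)"
    by (rule antiderivative_subgradient[OF prim(2) Phi_plus_mono])
  finally show ?thesis by (simp add: potential_eq)
qed

lemma potential_nonneg: "0 \<le> potential \<Psi> x \<xi>"
  using potential_mono[of 0 \<xi>] potential_eq[of 0] prim(1) by simp

lemma potential_le: "potential \<Psi> x \<xi> \<le> Phi \<Psi> x (norm \<xi>) * norm \<xi>"
  using potential_subgradient[of \<xi> 0] potential_eq[of 0] prim(1) by (simp add: inner_flux)

lemma potential_midpoint:
  "2 * potential \<Psi> x ((1/2) *\<^sub>R \<xi> + (1/2) *\<^sub>R \<eta>) \<le> potential \<Psi> x \<xi> + potential \<Psi> x \<eta>"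
proof -
  let ?m = "(1/2) *\<^sub>R \<xi> + (1/2) *\<^sub>R \<eta>"
  \<comment> \<open>The increments from the midpoint are opposite, so the linear terms cancel when
    the two subgradient inequalities are added.\<close>
  have m: "\<xi> - ?m = - (\<eta> - ?m)"
    using scaleR_add_left[of "1/2" "1/2" \<xi>] scaleR_add_left[of "1/2" "1/2" \<eta>] by (simp add: algebra_simps)
  show ?thesis
    using potential_subgradient[of ?m \<xi>] potential_subgradient[of ?m \<eta>]
    by (simp only: m inner_minus_right)
qed

lemma flux_monotone: "0 \<le> (flux \<Psi> x \<xi> - flux \<Psi> x \<eta>) \<bullet> (\<xi> - \<eta>)"
  using potential_subgradient[of \<xi> \<eta>] potential_subgradient[of \<eta> \<xi>]
  by (simp add: inner_diff_left inner_diff_right)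

lemma flux_cont: "isCont (flux \<Psi> x) \<xi>"
proof (cases "\<xi> = 0")
  case True
  have "isCont Phi_plus 0"
    using Phi_plus_cont by (simp add: continuous_on_eq_continuous_at)
  then have "isCont (\<lambda>\<eta>. Phi_plus (norm \<eta>)) (0::'a)"
    by (intro isCont_o2[of 0 norm Phi_plus]) auto
  then have "((\<lambda>\<eta>. Phi_plus (norm \<eta>)) \<longlongrightarrow> 0) (at (0::'a))"
    by (simp add: isCont_def Phi_plus_def Phi_def)
  moreover have "norm (flux \<Psi> x \<eta>) \<le> Phi_plus (norm \<eta>)" for \<eta>
    by (simp add: norm_flux Phi_plus_def)
  ultimately have "(flux \<Psi> x \<longlongrightarrow> 0) (at 0)"
    by (intro Lim_null_comparison[of "flux \<Psi> x" "\<lambda>\<eta>. Phi_plus (norm \<eta>)"]) auto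
  with True show ?thesis by (simp add: isCont_def flux_def)
next
  case False
  have "eventually (\<lambda>\<eta>. \<eta> \<in> - {0}) (nhds \<xi>)" using False by (intro eventually_nhds_in_open) auto
  then have "eventually (\<lambda>\<eta>. flux \<Psi> x \<eta> = \<Psi> x (norm \<eta>) *\<^sub>R \<eta>) (nhds \<xi>)"
    by eventually_elim (auto simp: flux_def)
  moreover have "isCont (\<lambda>\<eta>. \<Psi> x (norm \<eta>) *\<^sub>R \<eta>) \<xi>"
    using isCont_if_locally_abs_continuous[OF ac, of "norm \<xi>"] False
    by (intro continuous_intros isCont_o2[of \<xi> norm "\<Psi> x"]) auto
  ultimately show ?thesis by (subst isCont_cong) auto
qed

lemma potential_Riemann_sums:
  "(\<lambda>k. \<Sum>i<Suc k. Phi \<Psi> x (real i / real (Suc k) * norm \<xi>) * (norm \<xi> / real (Suc k))) \<longlonglongrightarrow> potential \<Psi> x \<xi>"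
proof -
  have "Phi_plus (real i / real (Suc k) * norm \<xi>) = Phi \<Psi> x (real i / real (Suc k) * norm \<xi>)" for i k
    by (simp add: Phi_plus_def)
  then show ?thesis
    using antiderivative_Riemann_sums[OF prim(2) prim(1) Phi_plus_mono, of "norm \<xi>"] by (simp only: potential_eq)
qed

end

section \<open>The reaction term\<close>

locale reaction_at =
  fixes \<delta> :: real and b :: "'a \<Rightarrow> real \<Rightarrow> real" and x :: 'a
  assumes \<delta>: "0 < \<delta>" and b_nonneg: "\<And>s. s \<in> {0..\<delta>} \<Longrightarrow> 0 \<le> b x s"
    and b_cont: "continuous_on {0..\<delta>} (b x)" and b_mono: "strict_mono_on {0..\<delta>} (b x)"
begin

text \<open>The three cases become one formula: a clamped argument plus two linear tails, each
  continuous and nondecreasing.\<close>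

lemma b_ext_eq: "b_ext \<delta> b x s = b x (clamp_real 0 \<delta> s) + min s 0 + max (s - \<delta>) 0"
  using \<delta> by (auto simp: b_ext_def clamp_real_def)

lemma b_ext_cont: "continuous_on UNIV (b_ext \<delta> b x)"
proof -
  have "continuous_on UNIV (\<lambda>s. b x (clamp_real 0 \<delta> s) + min s 0 + max (s - \<delta>) 0)"
    unfolding clamp_real_def using \<delta>
    by (intro continuous_intros continuous_on_compose2[OF b_cont]) auto
  then show ?thesis by (simp add: b_ext_eq[abs_def])
qed

lemma b_ext_strict_mono: "strict_mono (b_ext \<delta> b x)"
proof (rule strict_monoI)
  fix s t :: real assume st: "s < t"
  have c: "clamp_real 0 \<delta> s \<in> {0..\<delta>}" "clamp_real 0 \<delta> t \<in> {0..\<delta>}" "clamp_real 0 \<delta> s \<le> clamp_real 0 \<delta> t"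
    using st \<delta> by (auto simp: clamp_real_def)
  have le: "b x (clamp_real 0 \<delta> s) \<le> b x (clamp_real 0 \<delta> t)"
    by (rule strict_mono_on_leD[OF b_mono c])
  show "b_ext \<delta> b x s < b_ext \<delta> b x t"
  proof (cases "clamp_real 0 \<delta> s = clamp_real 0 \<delta> t")
    case True
    \<comment> \<open>Two distinct points with equal clamped values lie in the same outer half-line,
      where one of the linear tails is strictly increasing.\<close>
    then have "min s 0 + max (s - \<delta>) 0 < min t 0 + max (t - \<delta>) 0"
      using st \<delta> by (auto simp: clamp_real_def min_def max_def split: if_splits)
    with True show ?thesis by (simp add: b_ext_eq)
  next
    case False
    then have "b x (clamp_real 0 \<delta> s) < b x (clamp_real 0 \<delta> t)"
      using c strict_mono_onD[OF b_mono] by auto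
    moreover have "min s 0 \<le> min t 0" "max (s - \<delta>) 0 \<le> max (t - \<delta>) 0" using st by auto
    ultimately show ?thesis by (simp add: b_ext_eq)
  qed
qed

lemma b_ext_bound: "\<bar>b_ext \<delta> b x s\<bar> \<le> b x \<delta> + \<bar>s\<bar>"
proof -
  have "clamp_real 0 \<delta> s \<in> {0..\<delta>}" using \<delta> by (auto simp: clamp_real_def)
  then have "0 \<le> b x (clamp_real 0 \<delta> s)" "b x (clamp_real 0 \<delta> s) \<le> b x \<delta>"
    using b_nonneg strict_mono_on_leD[OF b_mono, of _ \<delta>] \<delta> by auto
  then show ?thesis using \<delta> by (auto simp: b_ext_eq)
qed

end

definition reaction_energy :: "(real \<Rightarrow> real) \<Rightarrow> real \<Rightarrow> real" where
  "reaction_energy f = (SOME F. F 0 = 0 \<and> (\<forall>s. (F has_real_derivative f s) (at s)))"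

lemma reaction_energy:
  assumes f: "continuous_on UNIV f"
  shows "reaction_energy f 0 = 0" "(reaction_energy f has_real_derivative f s) (at s)"
proof -
  have "\<exists>F. F 0 = 0 \<and> (\<forall>s. (F has_real_derivative f s) (at s))"
    using antiderivative_exists[OF f] by metis
  from someI_ex[OF this] show "reaction_energy f 0 = 0" "(reaction_energy f has_real_derivative f s) (at s)"
    by (auto simp: reaction_energy_def)
qed

section \<open>Measurability\<close>

text \<open>Completeness permits changes on null sets, so that functions described only almost
  everywhere, such as limits, remain measurable.\<close>

lemma complete_measure_lebesgue_on:
  assumes "\<Omega> \<in> sets lebesgue"
  shows "complete_measure (lebesgue_on \<Omega>)"
proof
  fix A B assume "B \<subseteq> A" "A \<in> null_sets (lebesgue_on \<Omega>)"
  then have "A \<subseteq> \<Omega>" "A \<in> null_sets lebesgue"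
    using null_sets_restrict_space[of \<Omega> lebesgue A] assms by auto
  then have "B \<in> sets lebesgue" "B \<subseteq> \<Omega>"
    using \<open>B \<subseteq> A\<close> completion.complete by auto
  then show "B \<in> sets (lebesgue_on \<Omega>)"
    using assms by (simp add: sets_restrict_space_iff)
qed

lemma borel_measurable_AE_eq:
  fixes f g :: "'a::euclidean_space \<Rightarrow> 'b::topological_space"
  assumes \<Omega>: "\<Omega> \<in> sets lebesgue" and g: "g \<in> borel_measurable (lebesgue_on \<Omega>)"
    and eq: "AE x in lebesgue_on \<Omega>. g x = f x"
  shows "f \<in> borel_measurable (lebesgue_on \<Omega>)"
proof (rule measurableI)
  fix A :: "'b set" assume A: "A \<in> sets borel"
  show "f -` A \<inter> space (lebesgue_on \<Omega>) \<in> sets (lebesgue_on \<Omega>)"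
  proof (rule complete_measure.in_sets_AE[OF complete_measure_lebesgue_on[OF \<Omega>] _ measurable_sets[OF g A]])
    show "AE x in lebesgue_on \<Omega>. (x \<in> g -` A \<inter> space (lebesgue_on \<Omega>)) = (x \<in> f -` A \<inter> space (lebesgue_on \<Omega>))"
      using eq by eventually_elim auto
  qed simp
qed simp

lemma borel_measurable_AE_limit:
  fixes f :: "'a::euclidean_space \<Rightarrow> real"
  assumes \<Omega>: "\<Omega> \<in> sets lebesgue" and h: "\<And>n::nat. h n \<in> borel_measurable (lebesgue_on \<Omega>)"
    and lim: "AE x in lebesgue_on \<Omega>. (\<lambda>n. h n x) \<longlonglongrightarrow> f x"
  shows "f \<in> borel_measurable (lebesgue_on \<Omega>)"
proof (rule borel_measurable_AE_eq[OF \<Omega>])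
  show "(\<lambda>x. lim (\<lambda>n. h n x)) \<in> borel_measurable (lebesgue_on \<Omega>)"
    using h by (intro borel_measurable_lim_metric) auto
  show "AE x in lebesgue_on \<Omega>. lim (\<lambda>n. h n x) = f x"
    using lim by eventually_elim (rule limI)
qed

text \<open>Rounding v down to multiples of \<open>1/(n+1)\<close> gives functions with countably
  many values, for which composition is measurable piece by piece; continuity in s then passes to
  the limit.\<close>

lemma borel_measurable_Caratheodory:
  fixes f :: "'a::euclidean_space \<Rightarrow> real \<Rightarrow> real"
  assumes \<Omega>: "\<Omega> \<in> sets lebesgue" and f: "\<And>s. (\<lambda>x. f x s) \<in> borel_measurable (lebesgue_on \<Omega>)"
    and cont: "AE x in lebesgue_on \<Omega>. continuous_on UNIV (f x)"
    and v [measurable]: "v \<in> borel_measurable (lebesgue_on \<Omega>)"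
  shows "(\<lambda>x. f x (v x)) \<in> borel_measurable (lebesgue_on \<Omega>)"
proof (rule borel_measurable_AE_limit[OF \<Omega>])
  let ?v = "\<lambda>n x. real_of_int \<lfloor>real (Suc n) * v x\<rfloor> / real (Suc n)"
  show "(\<lambda>x. f x (?v n x)) \<in> borel_measurable (lebesgue_on \<Omega>)" for n
  proof (rule measurable_compose_countable[where f = "\<lambda>i x. f x (real_of_int i / real (Suc n))"])
    show "(\<lambda>x. \<lfloor>real (Suc n) * v x\<rfloor>) \<in> measurable (lebesgue_on \<Omega>) (count_space UNIV)" by measurable
  qed (rule f)
  have vlim: "(\<lambda>n. ?v n x) \<longlonglongrightarrow> v x" for x
  proof (rule LIM_zero_cancel, rule Lim_null_comparison[OF always_eventually LIMSEQ_inverse_real_of_nat], rule allI)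
    fix n
    have "\<bar>real_of_int \<lfloor>real (Suc n) * v x\<rfloor> - real (Suc n) * v x\<bar> \<le> 1" by linarith
    then have "\<bar>real_of_int \<lfloor>real (Suc n) * v x\<rfloor> - real (Suc n) * v x\<bar> / real (Suc n) \<le> 1 / real (Suc n)"
      by (intro divide_right_mono) auto
    also have "\<bar>real_of_int \<lfloor>real (Suc n) * v x\<rfloor> - real (Suc n) * v x\<bar> / real (Suc n) = norm (?v n x - v x)"
      by (simp add: field_simps del: of_nat_Suc flip: abs_divide)
    finally show "norm (?v n x - v x) \<le> inverse (real (Suc n))" by (simp add: inverse_eq_divide)
  qed
  show "AE x in lebesgue_on \<Omega>. (\<lambda>n. f x (?v n x)) \<longlonglongrightarrow> f x (v x)"
    using cont
  proof eventually_elim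
    case (elim x)
    then have "isCont (f x) (v x)" by (simp add: continuous_on_eq_continuous_at)
    from isCont_tendsto_compose[OF this vlim] show ?case .
  qed
qed

section \<open>Minimisation of a convex functional\<close>

text \<open>Among the near-minimisers of \<open>J\<close> pick near-minimisers of \<open>H\<close>: the midpoint of two
  consecutive ones is again a near-minimiser of \<open>J\<close>, so it cannot lower \<open>H\<close> by much.\<close>
lemma near_minimisers:
  fixes J H :: "'v \<Rightarrow> real" and \<eta> :: "nat \<Rightarrow> real"
  assumes X: "X \<noteq> {}" and J_bdd: "\<And>v. v \<in> X \<Longrightarrow> m \<le> J v"
    and mid: "\<And>u v. u \<in> X \<Longrightarrow> v \<in> X \<Longrightarrow> mid u v \<in> X"
    and J_mid: "\<And>u v. u \<in> X \<Longrightarrow> v \<in> X \<Longrightarrow> 2 * J (mid u v) \<le> J u + J v"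
    and H: "\<And>v. v \<in> X \<Longrightarrow> J v \<le> Inf (J ` X) + 1 \<Longrightarrow> 0 \<le> H v \<and> H v \<le> B"
    and \<eta>: "\<And>k. 0 < \<eta> k" "decseq \<eta>"
  obtains V where "\<And>k. V k \<in> X" "\<And>k. J (V k) \<le> Inf (J ` X) + 1" "(\<lambda>k. J (V k)) \<longlonglongrightarrow> Inf (J ` X)"
    "\<And>k. H (V k) + H (V (Suc k)) - 2 * H (mid (V k) (V (Suc k))) \<le> \<eta> k"
proof -
  define I where "I = Inf (J ` X)"
  have J_ge: "I \<le> J v" if "v \<in> X" for v
    unfolding I_def using that J_bdd by (intro cInf_lower bdd_belowI[of _ m]) auto
  define L where "L \<epsilon> = {v \<in> X. J v \<le> I + \<epsilon>}" for \<epsilon>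
  have L_ne: "L \<epsilon> \<noteq> {}" if "\<epsilon> > 0" for \<epsilon>
  proof -
    have "Inf (J ` X) < I + \<epsilon>" using that by (simp add: I_def)
    from cInf_lessD[OF _ this] X obtain y where "y \<in> J ` X" "y < I + \<epsilon>" by blast
    then show ?thesis by (auto simp: L_def intro: less_imp_le)
  qed
  have L_H: "0 \<le> H v" "H v \<le> B" if "v \<in> L \<epsilon>" "\<epsilon> \<le> 1" for v \<epsilon>
    using H[of v] that by (auto simp: L_def I_def)
  define s where "s \<epsilon> = Inf (H ` L \<epsilon>)" for \<epsilon>
  have L_bdd: "bdd_below (H ` L \<epsilon>)" if "\<epsilon> \<le> 1" for \<epsilon>
    by (rule bdd_belowI[of _ 0]) (use L_H(1)[OF _ that] in auto)
  have s_le: "s \<epsilon> \<le> H v" if "v \<in> L \<epsilon>" "\<epsilon> \<le> 1" for v \<epsilon>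
    unfolding s_def using that L_bdd by (intro cInf_lower) auto
  have s_B: "s \<epsilon> \<le> B" if "0 < \<epsilon>" "\<epsilon> \<le> 1" for \<epsilon>
  proof -
    have "L \<epsilon> \<noteq> {}" by (rule L_ne[OF that(1)])
    then obtain v where "v \<in> L \<epsilon>" by auto
    then show ?thesis using s_le L_H(2) that(2) by fastforce
  qed
  have s_mono: "s \<epsilon>' \<le> s \<epsilon>" if "0 < \<epsilon>" "\<epsilon> \<le> \<epsilon>'" "\<epsilon>' \<le> 1" for \<epsilon> \<epsilon>'
    unfolding s_def
    using that L_ne L_bdd by (intro cInf_superset_mono) (auto simp: L_def)
  \<comment> \<open>As the tolerance shrinks, the infimum of H over the sublevel set of J rises
    towards S. Where it is within \<open>\<eta> k / 4\<close> of S, the midpoint has H above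
    \<open>S - \<eta> k / 4\<close>, while each chosen V has H below S plus a quarter of its \<eta>;
    the four quarters add up to \<open>\<eta> k\<close>.\<close>
  define S where "S = Sup (s ` {0<..1})"
  have S_bdd: "bdd_above (s ` {0<..1})"
    by (rule bdd_aboveI[of _ B]) (use s_B in auto)
  have s_S: "s \<epsilon> \<le> S" if "0 < \<epsilon>" "\<epsilon> \<le> 1" for \<epsilon>
    unfolding S_def using that S_bdd by (intro cSup_upper) auto
  have "\<exists>\<epsilon>. 0 < \<epsilon> \<and> \<epsilon> \<le> 1 \<and> S - \<eta> k / 4 < s \<epsilon>" for k
    using less_cSupD[of "s ` {0<..1}" "S - \<eta> k / 4"] \<eta>(1)[of k] by (auto simp: S_def)
  then obtain e where e: "\<And>k. 0 < e k" "\<And>k. e k \<le> 1" "\<And>k. S - \<eta> k / 4 < s (e k)" by metis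
  \<comment> \<open>The running minimum makes the tolerances decrease, so that
    \<open>V (Suc k)\<close> also belongs to the k-th sublevel set; the bound \<open>1/(k+1)\<close>
    forces J to converge to its infimum.\<close>
  define e' where "e' k = min (Min (e ` {..k})) (1 / real (Suc k))" for k
  have e': "0 < e' k" "e' k \<le> e k" "e' k \<le> 1 / real (Suc k)" "e' (Suc k) \<le> e' k" for k
  proof -
    show "0 < e' k" "e' k \<le> e k" "e' k \<le> 1 / real (Suc k)"
      using e(1) by (auto simp: e'_def intro: min.coboundedI1)
    have "Min (e ` {..Suc k}) \<le> Min (e ` {..k})" by (intro Min_antimono) auto
    moreover have "1 / real (Suc (Suc k)) \<le> 1 / real (Suc k)" by (intro divide_left_mono) auto
    ultimately show "e' (Suc k) \<le> e' k" unfolding e'_def by (intro min.mono)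
  qed
  have e'1: "e' k \<le> 1" for k using e'(2)[of k] e(2)[of k] by linarith
  have "\<exists>v. v \<in> L (e' k) \<and> H v < S + \<eta> k / 4" for k
  proof -
    have "Inf (H ` L (e' k)) < S + \<eta> k / 4"
      using s_S[OF e'(1) e'1, of k] \<eta>(1)[of k] by (simp add: s_def)
    from cInf_lessD[OF _ this] show ?thesis using L_ne[OF e'(1), of k] by auto
  qed
  then obtain V where V: "\<And>k. V k \<in> L (e' k)" "\<And>k. H (V k) < S + \<eta> k / 4" by metis
  show ?thesis
  proof (rule that[of V])
    show VX: "V k \<in> X" "J (V k) \<le> Inf (J ` X) + 1" for k
      using V(1)[of k] e'1[of k] by (auto simp: L_def I_def)
    show "(\<lambda>k. J (V k)) \<longlonglongrightarrow> Inf (J ` X)"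
    proof (rule tendsto_sandwich[OF always_eventually always_eventually tendsto_const])
      show "(\<lambda>k. I + inverse (real (Suc k))) \<longlonglongrightarrow> Inf (J ` X)"
        using tendsto_add[OF tendsto_const[of I] LIMSEQ_inverse_real_of_nat] by (simp add: I_def)
      show "\<forall>k. Inf (J ` X) \<le> J (V k)" using J_ge VX by (simp add: I_def)
      show "\<forall>k. J (V k) \<le> I + inverse (real (Suc k))"
      proof
        fix k
        have "J (V k) \<le> I + e' k" using V(1)[of k] by (simp add: L_def)
        then show "J (V k) \<le> I + inverse (real (Suc k))"
          using e'(3)[of k] by (simp add: inverse_eq_divide)
      qed
    qed
    fix k
    have "V (Suc k) \<in> L (e' k)" using V(1)[of "Suc k"] e'(4)[of k] by (auto simp: L_def)
    with V(1)[of k] have "mid (V k) (V (Suc k)) \<in> L (e' k)"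
      using mid J_mid[of "V k" "V (Suc k)"] by (auto simp: L_def)
    from s_le[OF this e'1] have "S - \<eta> k / 4 < H (mid (V k) (V (Suc k)))"
      using s_mono[OF e'(1,2) e(2), of k] e(3)[of k] by linarith
    moreover have "\<eta> (Suc k) \<le> \<eta> k" using \<eta>(2) by (simp add: decseq_Suc_iff)
    ultimately show "H (V k) + H (V (Suc k)) - 2 * H (mid (V k) (V (Suc k))) \<le> \<eta> k"
      using V(2)[of k] V(2)[of "Suc k"] \<eta>(1)[of k] by linarith
  qed
qed

text \<open>The area integrand, i.e. the length of \<open>(1, \<xi>)\<close>. Unlike the norm it is
  strictly convex in the radial direction too, and its linear growth keeps it integrable along
  integrable gradients.\<close>

definition japanese_bracket :: "'b::real_inner \<Rightarrow> real" where
  "japanese_bracket \<xi> = sqrt (1 + (norm \<xi>)\<^sup>2)"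

lemma japanese_bracket_bounds: "1 \<le> japanese_bracket \<xi>" "japanese_bracket \<xi> \<le> 1 + norm \<xi>"
  "0 < japanese_bracket \<xi>"
proof -
  show 1: "1 \<le> japanese_bracket \<xi>" by (simp add: japanese_bracket_def)
  then show "0 < japanese_bracket \<xi>" by linarith
  show "japanese_bracket \<xi> \<le> 1 + norm \<xi>"
    unfolding japanese_bracket_def by (rule real_le_lsqrt) (auto simp: power2_sum)
qed

text \<open>With \<open>u = (1, \<xi>)\<close> and \<open>v = (1, \<zeta>)\<close> this follows from
  \<open>(\<bar>u\<bar> + \<bar>v\<bar>)\<^sup>2 - \<bar>u + v\<bar>\<^sup>2 = 2 (\<bar>u\<bar>\<bar>v\<bar> - u \<bullet> v)\<close> and \<open>\<bar>u\<bar>\<^sup>2\<bar>v\<bar>\<^sup>2 - (u \<bullet> v)\<^sup>2 \<ge> \<bar>\<xi> - \<zeta>\<bar>\<^sup>2\<close>.\<close>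
lemma japanese_bracket_strictly_convex:
  fixes \<xi> \<zeta> :: "'b::real_inner"
  defines "X \<equiv> japanese_bracket \<xi>" and "Y \<equiv> japanese_bracket \<zeta>"
    and "m \<equiv> 2 * japanese_bracket ((1/2) *\<^sub>R \<xi> + (1/2) *\<^sub>R \<zeta>)"
  shows "(norm (\<xi> - \<zeta>))\<^sup>2 \<le> 2 * (X + Y) * (X * Y) * (X + Y - m)" "0 \<le> X + Y - m"
proof -
  define d where "d = \<xi> \<bullet> \<zeta>"
  have X2: "X\<^sup>2 = 1 + \<xi> \<bullet> \<xi>" and Y2: "Y\<^sup>2 = 1 + \<zeta> \<bullet> \<zeta>"
    by (simp_all add: X_def Y_def japanese_bracket_def dot_square_norm)
  \<comment> \<open>m is the length of the sum of the two vectors \<open>(1, \<xi>)\<close> and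
    \<open>(1, \<zeta>)\<close>, because the bracket of the midpoint is half of it.\<close>
  have m2: "m\<^sup>2 = X\<^sup>2 + Y\<^sup>2 + 2 + 2 * d"
  proof -
    have "m\<^sup>2 = 4 * (1 + ((1/2) *\<^sub>R \<xi> + (1/2) *\<^sub>R \<zeta>) \<bullet> ((1/2) *\<^sub>R \<xi> + (1/2) *\<^sub>R \<zeta>))"
      by (simp add: m_def japanese_bracket_def dot_square_norm power_mult_distrib)
    also have "\<dots> = X\<^sup>2 + Y\<^sup>2 + 2 + 2 * d"
      unfolding X2 Y2 d_def by (simp add: inner_add_left inner_add_right inner_commute)
    finally show ?thesis .
  qed
  have pos: "1 \<le> X" "1 \<le> Y" "0 < m"
    using japanese_bracket_bounds by (auto simp: X_def Y_def m_def)
  have cs: "d\<^sup>2 \<le> (\<xi> \<bullet> \<xi>) * (\<zeta> \<bullet> \<zeta>)"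
    unfolding d_def by (rule Cauchy_Schwarz_ineq)
  have n: "(norm (\<xi> - \<zeta>))\<^sup>2 = \<xi> \<bullet> \<xi> + \<zeta> \<bullet> \<zeta> - 2 * d"
    unfolding d_def power2_norm_eq_inner by (simp add: inner_diff_left inner_diff_right inner_commute)
  have XY0: "0 < X * Y" using pos by simp
  have prod: "(norm (\<xi> - \<zeta>))\<^sup>2 \<le> (X * Y - (1 + d)) * (X * Y + (1 + d))"
  proof -
    have "(X * Y - (1 + d)) * (X * Y + (1 + d)) = X\<^sup>2 * Y\<^sup>2 - (1 + d)\<^sup>2"
      by (simp add: algebra_simps power2_eq_square)
    also have "\<dots> = (norm (\<xi> - \<zeta>))\<^sup>2 + ((\<xi> \<bullet> \<xi>) * (\<zeta> \<bullet> \<zeta>) - d\<^sup>2)"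
      unfolding X2 Y2 n by (simp add: algebra_simps power2_eq_square)
    finally show ?thesis using cs by simp
  qed
  have abs_le: "\<bar>1 + d\<bar> \<le> X * Y"
  proof (rule power2_le_imp_le[of "\<bar>1 + d\<bar>"])
    have "0 \<le> (X * Y - (1 + d)) * (X * Y + (1 + d))"
      using prod zero_le_power2 order_trans by blast
    then show "\<bar>1 + d\<bar>\<^sup>2 \<le> (X * Y)\<^sup>2"
      by (simp add: algebra_simps power2_eq_square)
  qed (use XY0 in simp)
  have diff: "(X + Y - m) * (X + Y + m) = 2 * (X * Y - (1 + d))"
  proof -
    have "(X + Y - m) * (X + Y + m) = (X + Y)\<^sup>2 - m\<^sup>2" by (simp add: algebra_simps power2_eq_square)
    then show ?thesis unfolding m2 by (simp add: power2_sum)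
  qed
  have sum_pos: "0 < X + Y + m" using pos by linarith
  show nn: "0 \<le> X + Y - m"
  proof -
    have "0 \<le> (X + Y - m) * (X + Y + m)" unfolding diff using abs_le by (simp add: abs_le_iff)
    then show ?thesis using sum_pos by (simp add: zero_le_mult_iff)
  qed
  have "(norm (\<xi> - \<zeta>))\<^sup>2 \<le> (X * Y - (1 + d)) * (2 * (X * Y))"
    using prod abs_le by (rule_tac order_trans[OF prod]) (intro mult_left_mono; simp add: abs_le_iff)
  also have "\<dots> = (X + Y - m) * (X + Y + m) * (X * Y)" unfolding diff by simp
  also have "\<dots> \<le> (X + Y - m) * (2 * (X + Y)) * (X * Y)"
    using nn XY0 by (intro mult_right_mono mult_left_mono) auto
  finally show "(norm (\<xi> - \<zeta>))\<^sup>2 \<le> 2 * (X + Y) * (X * Y) * (X + Y - m)"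
    by (simp add: mult_ac)
qed

lemma convergent_of_geometric_increments:
  fixes z :: "nat \<Rightarrow> 'b::banach"
  assumes "\<And>k. (norm (z (Suc k) - z k))\<^sup>2 \<le> C * (1/4) ^ k"
  shows "convergent z"
proof -
  have C: "0 \<le> C" using order_trans[OF zero_le_power2 assms[of 0]] by simp
  have "norm (z (Suc k) - z k) \<le> sqrt C * (1/2) ^ k" for k
  proof (rule power2_le_imp_le)
    have "((1/2::real) ^ k)\<^sup>2 = (1/4) ^ k"
      by (simp add: power2_eq_square flip: power_mult_distrib)
    then have "(sqrt C * (1/2) ^ k)\<^sup>2 = C * (1/4) ^ k"
      using C by (simp add: power_mult_distrib)
    then show "(norm (z (Suc k) - z k))\<^sup>2 \<le> (sqrt C * (1/2) ^ k)\<^sup>2" using assms[of k] by simp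
  qed (use C in simp)
  moreover have "summable (\<lambda>k. sqrt C * (1/2) ^ k)"
    by (intro summable_mult summable_geometric) simp
  ultimately have "summable (\<lambda>k. z (Suc k) - z k)"
    using summable_comparison_test'[of "\<lambda>k. sqrt C * (1/2) ^ k" 0 "\<lambda>k. z (Suc k) - z k"] by blast
  then have "convergent (\<lambda>n. \<Sum>k<n. z (Suc k) - z k)"
    by (simp add: summable_iff_convergent)
  then have "convergent (\<lambda>n. z n - z 0)" by (simp add: sum_lessThan_telescope)
  then show ?thesis
    by (simp add: convergent_diff_const_right_iff)
qed

text \<open>Summable integrals make the series finite almost everywhere, and each term is bounded by
  its sum. The constant may depend on x, which suffices for convergence checked at one point at a
  time.\<close>

lemma AE_bounded_of_summable_integrals:
  fixes f :: "nat \<Rightarrow> 'a \<Rightarrow> real"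
  assumes f: "\<And>k. integrable M (f k)" "\<And>k x. 0 \<le> f k x" and s: "summable (\<lambda>k. LINT x|M. f k x)"
  shows "AE x in M. \<exists>C. \<forall>k. f k x \<le> C"
proof -
  have [measurable]: "\<And>k. f k \<in> borel_measurable M" using f(1) by auto
  have nn: "0 \<le> (LINT x|M. f k x)" for k using f(2) by (intro Bochner_Integration.integral_nonneg)
  have "(\<integral>\<^sup>+x. (\<Sum>k. ennreal (f k x)) \<partial>M) = (\<Sum>k. \<integral>\<^sup>+x. ennreal (f k x) \<partial>M)"
    by (rule nn_integral_suminf) measurable
  also have "\<dots> = (\<Sum>k. ennreal (LINT x|M. f k x))"
    using f by (simp add: nn_integral_eq_integral)
  also have "\<dots> \<noteq> \<infinity>"
    using suminf_ennreal2[OF nn s] by simp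
  finally have "AE x in M. (\<Sum>k. ennreal (f k x)) \<noteq> \<infinity>"
    by (intro nn_integral_noteq_infinite) auto
  then show ?thesis
  proof eventually_elim
    case (elim x)
    then have "summable (\<lambda>k. f k x)" using f(2) by (intro summable_suminf_not_top) auto
    then have "f k x \<le> (\<Sum>k. f k x)" for k
      using f(2) sum_le_suminf[of "\<lambda>k. f k x" "{k}"] by simp
    then show ?case by blast
  qed
qed

locale convex_minimisation = var_exp_domain +
  fixes A :: "'a \<Rightarrow> 'a \<Rightarrow> real" and E :: "'a \<Rightarrow> real \<Rightarrow> real" and E_max :: "'a \<Rightarrow> real" and \<delta> :: real
  assumes \<delta>: "0 \<le> \<delta>"
    and A_nonneg: "AE x in M. \<forall>\<xi>. 0 \<le> A x \<xi>"
    and A_cont: "AE x in M. \<forall>\<xi>. isCont (A x) \<xi>"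
    and A_mid: "AE x in M. \<forall>\<xi> \<zeta>. 2 * A x ((1/2) *\<^sub>R \<xi> + (1/2) *\<^sub>R \<zeta>) \<le> A x \<xi> + A x \<zeta>"
    and A_int: "\<And>V. V \<in> W1p_var \<Omega> p \<Longrightarrow> integrable M (\<lambda>x. A x (grad V x))"
    and A_coercive: "\<And>V :: nat \<Rightarrow> 'a \<Rightarrow> real. (\<And>k. V k \<in> W1p_var \<Omega> p) \<Longrightarrow>
      filterlim (\<lambda>k. LINT x|M. norm (grad (V k) x) powr p x) at_top sequentially \<Longrightarrow>
      filterlim (\<lambda>k. LINT x|M. A x (grad (V k) x)) at_top sequentially"
    and E_cont: "AE x in M. \<forall>s. isCont (E x) s"
    and E_mid: "AE x in M. \<forall>s t. 2 * E x ((1/2) * s + (1/2) * t) \<le> E x s + E x t"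
    and E_bound: "AE x in M. \<forall>s\<in>{0..\<delta>}. \<bar>E x s\<bar> \<le> E_max x"
    and E_max: "integrable M E_max"
    and E_meas: "\<And>v. v \<in> borel_measurable M \<Longrightarrow> (\<lambda>x. E x (v x)) \<in> borel_measurable M"
begin

definition K :: "('a \<Rightarrow> real) set" where
  "K = {V \<in> W1p_var \<Omega> p. AE x in M. 0 \<le> V x \<and> V x \<le> \<delta>}"

definition J :: "('a \<Rightarrow> real) \<Rightarrow> real" where
  "J V = (LINT x|M. A x (grad V x)) + (LINT x|M. E x (V x))"

definition mid :: "('a \<Rightarrow> real) \<Rightarrow> ('a \<Rightarrow> real) \<Rightarrow> 'a \<Rightarrow> real" where
  "mid u v x = (1/2) * u x + (1/2) * v x"

definition H :: "('a \<Rightarrow> real) \<Rightarrow> real" where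
  "H V = (LINT x|M. (V x)\<^sup>2) + (LINT x|M. japanese_bracket (grad V x))"

lemma KD:
  assumes "V \<in> K"
  shows "V \<in> W1p_var \<Omega> p" "AE x in M. 0 \<le> V x \<and> V x \<le> \<delta>" "V \<in> borel_measurable M"
  using assms W1pD(2) by (auto simp: K_def)

lemma E_int:
  assumes V: "V \<in> K"
  shows "integrable M (\<lambda>x. E x (V x))"
proof (rule Bochner_Integration.integrable_bound[OF E_max E_meas[OF KD(3)[OF V]]])
  show "AE x in M. norm (E x (V x)) \<le> norm (E_max x)"
    using E_bound KD(2)[OF V] by eventually_elim force
qed

lemma E_lower:
  assumes V: "V \<in> K"
  shows "- (LINT x|M. E_max x) \<le> (LINT x|M. E x (V x))"
proof -
  have "(LINT x|M. - E_max x) \<le> (LINT x|M. E x (V x))"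
  proof (rule integral_mono_AE)
    show "AE x in M. - E_max x \<le> E x (V x)"
      using E_bound KD(2)[OF V] by eventually_elim force
  qed (use E_max E_int[OF V] in auto)
  then show ?thesis by simp
qed

lemma A_integral_nonneg: "0 \<le> (LINT x|M. A x (grad V x))"
  by (rule integral_nonneg_AE) (use A_nonneg in \<open>eventually_elim, auto\<close>)

lemma grad_mid:
  assumes "u \<in> K" "v \<in> K"
  shows "mid u v \<in> K" "AE x in M. grad (mid u v) x = (1/2) *\<^sub>R grad u x + (1/2) *\<^sub>R grad v x"
proof -
  note c = W1p_combine[OF KD(1)[OF assms(1)] KD(1)[OF assms(2)], of "1/2" "1/2"]
  have "AE x in M. 0 \<le> mid u v x \<and> mid u v x \<le> \<delta>"
    using KD(2)[OF assms(1)] KD(2)[OF assms(2)] by eventually_elim (auto simp: mid_def)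
  then show "mid u v \<in> K"
    using c(1) by (simp add: K_def mid_def[abs_def])
  show "AE x in M. grad (mid u v) x = (1/2) *\<^sub>R grad u x + (1/2) *\<^sub>R grad v x"
    using c(2) by (simp add: mid_def[abs_def])
qed

lemma J_mid:
  assumes u: "u \<in> K" and v: "v \<in> K"
  shows "2 * J (mid u v) \<le> J u + J v"
proof -
  note m = grad_mid[OF u v]
  note iA = A_int[OF KD(1)[OF u]] A_int[OF KD(1)[OF v]] A_int[OF KD(1)[OF m(1)]]
  note iE = E_int[OF u] E_int[OF v] E_int[OF m(1)]
  have "(LINT x|M. 2 * A x (grad (mid u v) x)) \<le> (LINT x|M. A x (grad u x) + A x (grad v x))"
  proof (rule integral_mono_AE)
    show "AE x in M. 2 * A x (grad (mid u v) x) \<le> A x (grad u x) + A x (grad v x)"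
      using A_mid m(2) by eventually_elim simp
  qed (use iA in auto)
  moreover have "(LINT x|M. 2 * E x (mid u v x)) \<le> (LINT x|M. E x (u x) + E x (v x))"
  proof (rule integral_mono_AE)
    show "AE x in M. 2 * E x (mid u v x) \<le> E x (u x) + E x (v x)"
      using E_mid by eventually_elim (simp add: mid_def)
  qed (use iE in auto)
  ultimately show ?thesis using iA iE by (simp add: J_def)
qed

lemma square_int:
  assumes V: "V \<in> K"
  shows "integrable M (\<lambda>x. (V x)\<^sup>2)" "(LINT x|M. (V x)\<^sup>2) \<le> (LINT x|M. \<delta>\<^sup>2)"
proof -
  have le: "AE x in M. (V x)\<^sup>2 \<le> \<delta>\<^sup>2"
    using KD(2)[OF V] by eventually_elim (auto intro: power_mono)
  show i: "integrable M (\<lambda>x. (V x)\<^sup>2)"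
    by (rule Bochner_Integration.integrable_bound[of _ "\<lambda>x. \<delta>\<^sup>2"]) (use KD(3)[OF V] le in auto)
  show "(LINT x|M. (V x)\<^sup>2) \<le> (LINT x|M. \<delta>\<^sup>2)"
    using i le by (intro integral_mono_AE) auto
qed

lemma bracket_measurable [measurable]: "japanese_bracket \<in> borel_measurable borel"
  unfolding japanese_bracket_def by measurable

lemma bracket_int:
  assumes V: "V \<in> W1p_var \<Omega> p"
  shows "integrable M (\<lambda>x. japanese_bracket (grad V x))"
    "(LINT x|M. japanese_bracket (grad V x)) \<le> (LINT x|M. 2) + (LINT x|M. norm (grad V x) powr p x)"
proof -
  note g = W1pD(5,6,7)[OF V]
  note [measurable] = g(1)
  show i: "integrable M (\<lambda>x. japanese_bracket (grad V x))"
  proof (rule Bochner_Integration.integrable_bound[of _ "\<lambda>x. 1 + norm (grad V x)"])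
    show "AE x in M. norm (japanese_bracket (grad V x)) \<le> norm (1 + norm (grad V x))"
    proof (rule AE_I2)
      fix x
      show "norm (japanese_bracket (grad V x)) \<le> norm (1 + norm (grad V x))"
        using japanese_bracket_bounds(2)[of "grad V x"] japanese_bracket_bounds(3)[of "grad V x"] by simp
    qed
  qed (use g(3) in auto)
  have ip: "integrable M (\<lambda>x. norm (grad V x) powr p x)" using LpD(2)[OF g(2)] by simp
  have "(LINT x|M. japanese_bracket (grad V x)) \<le> (LINT x|M. 2 + norm (grad V x) powr p x)"
  proof (rule integral_mono_AE[OF i])
    show "AE x in M. japanese_bracket (grad V x) \<le> 2 + norm (grad V x) powr p x"
    proof (rule AE_I2)
      fix x assume x: "x \<in> space M"
      have "norm (grad V x) \<le> 1 + norm (grad V x) powr p x"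
      proof (cases "norm (grad V x) \<le> 1")
        case False
        then have "norm (grad V x) powr 1 \<le> norm (grad V x) powr p x"
          using x p_pos[of x] by (intro powr_mono) auto
        with False show ?thesis by simp
      qed (simp add: add_increasing2)
      then show "japanese_bracket (grad V x) \<le> 2 + norm (grad V x) powr p x"
        using japanese_bracket_bounds(2)[of "grad V x"] by linarith
    qed
  qed (use ip in auto)
  then show "(LINT x|M. japanese_bracket (grad V x)) \<le> (LINT x|M. 2) + (LINT x|M. norm (grad V x) powr p x)"
    using ip by simp
qed

text \<open>Coercivity is a statement about sequences. If the modulars were unbounded on a sublevel
  set, elements with modular above k would drive the potential part to infinity, while E is bounded
  below on K.\<close>

lemma sublevel_modular_bounded:
  obtains R where "\<And>V. V \<in> K \<Longrightarrow> J V \<le> c \<Longrightarrow> (LINT x|M. norm (grad V x) powr p x) \<le> R"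
proof (rule ccontr)
  assume "\<not> thesis"
  then have "\<forall>k::nat. \<exists>V. V \<in> K \<and> J V \<le> c \<and> real k < (LINT x|M. norm (grad V x) powr p x)"
    using that by (metis not_le)
  then obtain V where V: "\<And>k::nat. V k \<in> K" "\<And>k. J (V k) \<le> c"
    "\<And>k. real k < (LINT x|M. norm (grad (V k) x) powr p x)" by metis
  have "filterlim (\<lambda>k. LINT x|M. A x (grad (V k) x)) at_top sequentially"
  proof (rule A_coercive[OF KD(1)[OF V(1)]])
    show "filterlim (\<lambda>k. LINT x|M. norm (grad (V k) x) powr p x) at_top sequentially"
      by (rule filterlim_at_top_mono[OF filterlim_real_sequentially always_eventually])
        (use V(3) less_imp_le in blast)
  qed
  then have "eventually (\<lambda>k. c + (LINT x|M. E_max x) + 1 \<le> (LINT x|M. A x (grad (V k) x))) sequentially"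
    by (auto simp: filterlim_at_top)
  then obtain k where "c + (LINT x|M. E_max x) + 1 \<le> (LINT x|M. A x (grad (V k) x))"
    using eventually_happens'[OF sequentially_bot] by blast
  then show False
    using V(2)[of k] E_lower[OF V(1), of k] by (simp add: J_def)
qed

theorem minimiser_exists: "\<exists>V\<in>K. \<forall>W\<in>K. J V \<le> J W"
proof -
  have K_ne: "K \<noteq> {}" using W1p_zero \<delta> by (auto simp: K_def)
  define I where "I = Inf (J ` K)"
  have J_lower: "- (LINT x|M. E_max x) \<le> J V" if "V \<in> K" for V
    using E_lower[OF that] A_integral_nonneg[of V] by (simp add: J_def)
  have I_le: "I \<le> J V" if "V \<in> K" for V
    unfolding I_def using that J_lower by (intro cInf_lower bdd_belowI[of _ "- (LINT x|M. E_max x)"]) auto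
  obtain R where R: "\<And>V. V \<in> K \<Longrightarrow> J V \<le> I + 1 \<Longrightarrow> (LINT x|M. norm (grad V x) powr p x) \<le> R"
    using sublevel_modular_bounded by blast
  define B where "B = (LINT x|M. \<delta>\<^sup>2) + ((LINT x|M. 2) + R)"
  have H_bound: "0 \<le> H V \<and> H V \<le> B" if "V \<in> K" "J V \<le> Inf (J ` K) + 1" for V
  proof
    show "0 \<le> H V"
      unfolding H_def using less_imp_le[OF japanese_bracket_bounds(3)]
      by (intro add_nonneg_nonneg Bochner_Integration.integral_nonneg) auto
    show "H V \<le> B"
      unfolding H_def B_def
      using square_int(2)[OF that(1)] bracket_int(2)[OF KD(1)[OF that(1)]] R[OF that(1)] that(2)
      by (simp add: I_def)
  qed
  obtain V where V: "\<And>k. V k \<in> K" "\<And>k. J (V k) \<le> I + 1" and J_lim: "(\<lambda>k. J (V k)) \<longlonglongrightarrow> I"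
    and H_mid: "\<And>k. H (V k) + H (V (Suc k)) - 2 * H (mid (V k) (V (Suc k))) \<le> (1/64) ^ k"
    unfolding I_def
  proof (rule near_minimisers[of K "- (LINT x|M. E_max x)" J mid H B "\<lambda>k. (1/64) ^ k"])
    show "decseq (\<lambda>k. (1/64::real) ^ k)" by (auto simp: decseq_def intro: power_decreasing)
  qed (use K_ne J_lower grad_mid(1) J_mid H_bound in auto)
  note VW = KD(1)[OF V(1)]
  note VW' = W1pD[OF VW]
  have Vm[measurable]: "V k \<in> borel_measurable M" "grad (V k) \<in> borel_measurable M" for k
    using VW'(2,5) .
  define j where "j k x = japanese_bracket (grad (V k) x)" for k x
  have j_int: "integrable M (j k)" for k
    unfolding j_def by (rule bracket_int(1)[OF VW])
  have j1: "1 \<le> j k x" for k x by (simp add: j_def japanese_bracket_bounds)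
  \<comment> \<open>The pointwise midpoint gap of the integrand of H. For the square it is half the
    squared difference, by the parallelogram identity.\<close>
  define D where "D k x = (V k x - V (Suc k) x)\<^sup>2 / 2 + (j k x + j (Suc k) x
      - 2 * japanese_bracket ((1/2) *\<^sub>R grad (V k) x + (1/2) *\<^sub>R grad (V (Suc k)) x))" for k x
  have D_parts: "0 \<le> j k x + j (Suc k) x - 2 * japanese_bracket ((1/2) *\<^sub>R grad (V k) x + (1/2) *\<^sub>R grad (V (Suc k)) x)" for k x
    unfolding j_def by (rule japanese_bracket_strictly_convex(2))
  have D0: "0 \<le> D k x" for k x
    unfolding D_def using D_parts[of k x] by (intro add_nonneg_nonneg) auto
  have D_int: "integrable M (D k)" "(LINT x|M. D k x) \<le> (1/64) ^ k" for k
  proof -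
    let ?m = "mid (V k) (V (Suc k))"
    note m = grad_mid[OF V(1)[of k] V(1)[of "Suc k"]]
    note i = square_int(1)[OF V(1)[of k]] square_int(1)[OF V(1)[of "Suc k"]] square_int(1)[OF m(1)]
      j_int[of k] j_int[of "Suc k"] bracket_int(1)[OF KD(1)[OF m(1)]]
    let ?D' = "\<lambda>x. ((V k x)\<^sup>2 + (V (Suc k) x)\<^sup>2 - 2 * (?m x)\<^sup>2) + (j k x + j (Suc k) x - 2 * japanese_bracket (grad ?m x))"
    have int': "integrable M ?D'" using i by auto
    have eq: "AE x in M. ?D' x = D k x"
      using m(2)
    proof eventually_elim
      case (elim x)
      have "(V k x)\<^sup>2 + (V (Suc k) x)\<^sup>2 - 2 * (?m x)\<^sup>2 = (V k x - V (Suc k) x)\<^sup>2 / 2"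
        by (simp add: mid_def power2_eq_square field_simps)
      then show ?case by (simp only: D_def elim)
    qed
    have Dm: "D k \<in> borel_measurable M" unfolding D_def j_def by measurable
    show "integrable M (D k)"
      using integrable_cong_AE[OF borel_measurable_integrable[OF int'] Dm eq] int' by simp
    have "(LINT x|M. D k x) = (LINT x|M. ?D' x)"
      by (rule integral_cong_AE[OF borel_measurable_integrable[OF int'] Dm eq, symmetric])
    also have "\<dots> = H (V k) + H (V (Suc k)) - 2 * H ?m"
      using i unfolding H_def j_def by simp
    finally show "(LINT x|M. D k x) \<le> (1/64) ^ k" using H_mid[of k] by simp
  qed
  have j_B: "(LINT x|M. j k x) \<le> B" for k
  proof -
    have "0 \<le> (LINT x|M. (V k x)\<^sup>2)" by (rule Bochner_Integration.integral_nonneg) simp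
    moreover have "H (V k) \<le> B" using H_bound[OF V(1), of k] V(2)[of k] by (simp add: I_def)
    ultimately show ?thesis unfolding H_def j_def by linarith
  qed
  \<comment> \<open>The integrals of D are at most \<open>64^(-k)\<close> and those of j are
    bounded, so both weighted terms have integrals of order \<open>2^(-k)\<close>. Pointwise this
    leaves D of order \<open>32^(-k)\<close> and brackets of order \<open>2^k\<close>. The convexity
    inequality costs three brackets, and \<open>8^k * 32^(-k) = 4^(-k)\<close> bounds the squared
    increments.\<close>
  have "AE x in M. \<exists>C. \<forall>k. 32 ^ k * D k x + (1/2) ^ k * j k x \<le> C"
  proof (rule AE_bounded_of_summable_integrals)
    show "integrable M (\<lambda>x. 32 ^ k * D k x + (1/2) ^ k * j k x)" for k
      using D_int(1) j_int by simp
    show "0 \<le> 32 ^ k * D k x + (1/2) ^ k * j k x" for k x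
      using D0[of k x] j1[of k x] by (intro add_nonneg_nonneg mult_nonneg_nonneg) auto
    have eq: "(LINT x|M. 32 ^ k * D k x + (1/2) ^ k * j k x) = 32 ^ k * (LINT x|M. D k x) + (1/2) ^ k * (LINT x|M. j k x)" for k
      using D_int(1) j_int by simp
    have le: "norm (LINT x|M. 32 ^ k * D k x + (1/2) ^ k * j k x) \<le> (1 + B) * (1/2) ^ k" for k
    proof -
      have "0 \<le> (LINT x|M. D k x)" "0 \<le> (LINT x|M. j k x)"
        using D0 order_trans[OF zero_le_one j1] by (auto intro!: Bochner_Integration.integral_nonneg)
      then have "norm (LINT x|M. 32 ^ k * D k x + (1/2) ^ k * j k x) = 32 ^ k * (LINT x|M. D k x) + (1/2) ^ k * (LINT x|M. j k x)"
        unfolding eq by simp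
      also have "\<dots> \<le> 32 ^ k * (1/64) ^ k + (1/2) ^ k * B"
        using D_int(2) j_B by (intro add_mono mult_left_mono) auto
      also have "32 ^ k * (1/64) ^ k = (1/2::real) ^ k" by (simp add: power_mult_distrib[symmetric])
      finally show ?thesis by (simp add: algebra_simps)
    qed
    have "summable (\<lambda>k. (1 + B) * (1/2) ^ k)"
      by (intro summable_mult summable_geometric) simp
    then show "summable (\<lambda>k. LINT x|M. 32 ^ k * D k x + (1/2) ^ k * j k x)"
      by (rule summable_comparison_test'[of _ 0]) (rule le)
  qed
  then have conv: "AE x in M. convergent (\<lambda>k. V k x) \<and> convergent (\<lambda>k. grad (V k) x)"
  proof eventually_elim
    case (elim x)
    then obtain C where C: "\<And>k. 32 ^ k * D k x + (1/2) ^ k * j k x \<le> C" by blast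
    have Dk: "D k x \<le> C * (1/32) ^ k" for k
    proof -
      have "0 \<le> (1/2) ^ k * j k x" by (rule mult_nonneg_nonneg) (use j1[of k x] in auto)
      then have "32 ^ k * D k x \<le> C" using C[of k] by linarith
      then show ?thesis by (simp add: field_simps power_divide)
    qed
    have jk: "j k x \<le> C * 2 ^ k" for k
    proof -
      have "0 \<le> 32 ^ k * D k x" by (rule mult_nonneg_nonneg) (use D0[of k x] in auto)
      then have "(1/2) ^ k * j k x \<le> C" using C[of k] by linarith
      then show ?thesis by (simp add: field_simps power_divide)
    qed
    have C0: "0 \<le> C" using j1[of 0 x] jk[of 0] by simp
    have "(norm (V (Suc k) x - V k x))\<^sup>2 \<le> (2 * C) * (1/4) ^ k" for k
    proof -
      have "(norm (V (Suc k) x - V k x))\<^sup>2 = (V k x - V (Suc k) x)\<^sup>2" by (simp add: power2_commute)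
      also have "\<dots> \<le> 2 * D k x" unfolding D_def using D_parts[of k x] by simp
      also have "\<dots> \<le> 2 * (C * (1/32) ^ k)" using Dk[of k] by simp
      also have "\<dots> \<le> 2 * (C * (1/4) ^ k)"
        using C0 by (intro mult_left_mono power_mono) auto
      finally show ?thesis by simp
    qed
    then have 1: "convergent (\<lambda>k. V k x)" by (rule convergent_of_geometric_increments)
    have "(norm (grad (V (Suc k)) x - grad (V k) x))\<^sup>2 \<le> (12 * C ^ 4) * (1/4) ^ k" for k
    proof -
      let ?d = "j k x + j (Suc k) x - 2 * japanese_bracket ((1/2) *\<^sub>R grad (V k) x + (1/2) *\<^sub>R grad (V (Suc k)) x)"
      have d: "?d \<le> C * (1/32) ^ k"
        using Dk[of k] zero_le_power2[of "V k x - V (Suc k) x"] unfolding D_def by linarith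
      have j0: "0 \<le> j i x" for i using j1[of i x] by linarith
      have "(norm (grad (V (Suc k)) x - grad (V k) x))\<^sup>2 = (norm (grad (V k) x - grad (V (Suc k)) x))\<^sup>2"
        by (simp add: norm_minus_commute)
      also have "\<dots> \<le> 2 * (j k x + j (Suc k) x) * (j k x * j (Suc k) x) * ?d"
        unfolding j_def by (rule japanese_bracket_strictly_convex(1))
      \<comment> \<open>The constant arises as 12 = 2 * (1 + 2) * 2: the sum of the bounds at k and
        k + 1 contributes 1 + 2, their product another 2.\<close>
      also have "\<dots> \<le> 2 * (C * 2 ^ k + C * 2 ^ Suc k) * (C * 2 ^ k * (C * 2 ^ Suc k)) * (C * (1/32) ^ k)"
        using jk[of k] jk[of "Suc k"] j0[of k] j0[of "Suc k"] C0 d D_parts[of k x]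
        by (intro mult_mono add_mono mult_nonneg_nonneg add_nonneg_nonneg) auto
      also have "\<dots> = (12 * C ^ 4) * (2 ^ k * 2 ^ k * 2 ^ k * (1/32) ^ k)"
        by (simp add: algebra_simps power_numeral_reduce)
      also have "2 ^ k * 2 ^ k * 2 ^ k * (1/32) ^ k = (1/4::real) ^ k"
        by (simp add: power_mult_distrib[symmetric])
      finally show ?thesis .
    qed
    then have "convergent (\<lambda>k. grad (V k) x)" by (rule convergent_of_geometric_increments)
    with 1 show ?case by simp
  qed
  define v where "v x = lim (\<lambda>k. V k x)" for x
  define g where "g x = lim (\<lambda>k. grad (V k) x)" for x
  have vm[measurable]: "v \<in> borel_measurable M" unfolding v_def by (intro borel_measurable_lim_metric) measurable
  have gm[measurable]: "g \<in> borel_measurable M" unfolding g_def by (intro borel_measurable_lim_metric) measurable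
  have v_lim: "AE x in M. (\<lambda>k. V k x) \<longlonglongrightarrow> v x" and g_lim: "AE x in M. (\<lambda>k. grad (V k) x) \<longlonglongrightarrow> g x"
    using conv by (eventually_elim, simp add: v_def g_def convergent_LIMSEQ_iff)+
  have V_bounds: "AE x in M. \<forall>k. 0 \<le> V k x \<and> V k x \<le> \<delta>"
    using KD(2)[OF V(1)] by (simp add: AE_all_countable)
  have v_bounds: "AE x in M. 0 \<le> v x \<and> v x \<le> \<delta>"
    using v_lim V_bounds
    by eventually_elim (auto intro: LIMSEQ_le_const LIMSEQ_le_const2)
  have g_Lp: "(\<lambda>x. norm (g x)) \<in> Lp_var \<Omega> p"
    and g_L1: "(\<lambda>k. LINT x|M. norm (grad (V k) x - g x)) \<longlonglongrightarrow> 0"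
    by (rule L1_convergence_of_bounded_modular[OF Vm(2) VW'(6) R[OF V] gm g_lim])+
  have v_Lp: "v \<in> Lp_var \<Omega> p"
    by (rule Lp_bounded[OF vm, of \<delta>]) (use v_bounds in \<open>eventually_elim, simp\<close>)
  have v_L1: "(\<lambda>k. LINT x|M. \<bar>V k x - v x\<bar>) \<longlonglongrightarrow> 0"
  proof -
    have "(\<lambda>k. LINT x|M. \<bar>V k x - v x\<bar>) \<longlonglongrightarrow> (LINT x|M. 0)"
    proof (rule integral_dominated_convergence[where w = "\<lambda>x. \<delta>"])
      show "AE x in M. (\<lambda>k. \<bar>V k x - v x\<bar>) \<longlonglongrightarrow> 0"
        using v_lim by eventually_elim (intro tendsto_rabs_zero LIM_zero)
      show "AE x in M. norm \<bar>V k x - v x\<bar> \<le> \<delta>" for k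
        using V_bounds v_bounds
      proof eventually_elim
        case (elim x)
        then have "0 \<le> V k x" "V k x \<le> \<delta>" "0 \<le> v x" "v x \<le> \<delta>" by auto
        then show ?case by simp
      qed
    qed auto
    then show ?thesis by simp
  qed
  have g_int: "integrable M g"
    using Lp_integrable[OF g_Lp] gm by (simp add: integrable_norm_iff)
  have wg: "has_weak_gradient \<Omega> v g"
    by (rule has_weak_gradient_L1_limit[OF open_domain Lp_integrable[OF v_Lp] g_int VW'(3) VW'(7) VW'(4) v_L1 g_L1])
  have v_W: "v \<in> W1p_var \<Omega> p" and grad_v: "AE x in M. grad v x = g x"
    by (rule W1pI[OF v_Lp wg g_Lp])+
  have v_K: "v \<in> K" using v_W v_bounds by (simp add: K_def)
  \<comment> \<open>Adding \<open>E_max\<close> makes the integrand nonnegative, as Fatou's lemma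
    demands.\<close>
  let ?f = "\<lambda>k x. A x (grad (V k) x) + E x (V k x) + E_max x"
  have f_int: "integrable M (?f k)" for k
    using A_int[OF VW] E_int[OF V(1)] E_max by simp
  have le: "(LINT x|M. A x (grad v x) + E x (v x) + E_max x) \<le> I + (LINT x|M. E_max x)"
  proof (rule Fatou_bound(2)[OF f_int])
    show "AE x in M. 0 \<le> ?f k x" for k
      using A_nonneg E_bound V_bounds
    proof eventually_elim
      case (elim x)
      then have "\<bar>E x (V k x)\<bar> \<le> E_max x" "0 \<le> A x (grad (V k) x)" by auto
      then show ?case by linarith
    qed
    show "AE x in M. (\<lambda>k. ?f k x) \<longlonglongrightarrow> A x (grad v x) + E x (v x) + E_max x"
      using A_cont E_cont v_lim g_lim grad_v
    proof eventually_elim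
      case (elim x)
      then show ?case by (intro tendsto_add tendsto_const isCont_tendsto_compose[of _ "A x"] isCont_tendsto_compose[of _ "E x"]) auto
    qed
    show "(\<lambda>x. A x (grad v x) + E x (v x) + E_max x) \<in> borel_measurable M"
      using A_int[OF v_W] E_int[OF v_K] E_max by auto
    show "(LINT x|M. ?f k x) \<le> J (V k) + (LINT x|M. E_max x)" for k
      using A_int[OF VW] E_int[OF V(1)] E_max by (simp add: J_def)
    show "(\<lambda>k. J (V k) + (LINT x|M. E_max x)) \<longlonglongrightarrow> I + (LINT x|M. E_max x)"
      by (intro tendsto_intros J_lim)
  qed
  then have "J v \<le> I"
    using A_int[OF v_W] E_int[OF v_K] E_max by (simp add: J_def)
  then show ?thesis
    using v_K by (intro bexI[of _ v] ballI order_trans[OF _ I_le])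
qed

end

section \<open>The elliptic problem\<close>

locale elliptic_problem = var_exp_domain +
  fixes \<Psi> b :: "'a \<Rightarrow> real \<Rightarrow> real" and \<delta> lam :: real and g :: "'a \<Rightarrow> real" and g_max :: real
  assumes flux_AE: "AE x in M. flux_at \<Psi> x"
    and reaction_AE: "AE x in M. reaction_at \<delta> b x"
    and Phi_Lp: "\<And>v. v \<in> Lp_var \<Omega> p \<Longrightarrow> (\<lambda>x. Phi \<Psi> x (v x)) \<in> Lp_var \<Omega> (conj_exponent p)"
    and coercive: "\<And>V :: nat \<Rightarrow> 'a \<Rightarrow> real. (\<And>k. V k \<in> W1p_var \<Omega> p) \<Longrightarrow>
      filterlim (\<lambda>k. LINT x|M. norm (grad (V k) x) powr p x) at_top sequentially \<Longrightarrow>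
      filterlim (\<lambda>k. LINT x|M. potential \<Psi> x (grad (V k) x)) at_top sequentially"
    and delta_pos: "0 < \<delta>"
    and b_meas: "\<And>s. s \<in> {0..\<delta>} \<Longrightarrow> (\<lambda>x. b x s) \<in> borel_measurable M"
    and b_int: "integrable M (\<lambda>x. b x \<delta>)"
    and lam_pos: "0 < lam"
    and g_meas [measurable]: "g \<in> borel_measurable M" and g_bound: "AE x in M. \<bar>g x\<bar> \<le> g_max"
    and g_range: "AE x in M. lam * b x 0 \<le> g x \<and> g x \<le> lam * b x \<delta>"
begin

section \<open>Measurability and integrability of the terms of the problem\<close>

lemma lebesgue_domain: "\<Omega> \<in> sets lebesgue"
  using lmeas_domain by (rule fmeasurableD)

lemma g_int: "integrable M g"
proof (rule Bochner_Integration.integrable_bound[of _ "\<lambda>x. g_max"])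
  show "AE x in M. norm (g x) \<le> norm g_max" using g_bound by eventually_elim simp
qed auto

definition react :: "'a \<Rightarrow> real \<Rightarrow> real" where
  "react x s = lam * b_ext \<delta> b x s - g x"

definition energy :: "'a \<Rightarrow> real \<Rightarrow> real" where
  "energy x = reaction_energy (react x)"

definition react_bound :: "real \<Rightarrow> 'a \<Rightarrow> real" where
  "react_bound C x = lam * (b x \<delta> + C) + \<bar>g x\<bar>"

lemma react_bound_int: "integrable M (react_bound C)"
  using b_int g_int by (auto simp: react_bound_def[abs_def])

lemma react_facts:
  assumes "reaction_at \<delta> b x"
  shows "continuous_on UNIV (react x)" "strict_mono (react x)" "mono (react x)"
    "\<And>s C. \<bar>s\<bar> \<le> C \<Longrightarrow> \<bar>react x s\<bar> \<le> react_bound C x"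
    "\<And>v w. react x v * (w - v) \<le> energy x w - energy x v"
    "energy x 0 = 0" "\<And>s. (energy x has_real_derivative react x s) (at s)"
proof -
  interpret reaction_at \<delta> b x by (rule assms)
  show c: "continuous_on UNIV (react x)"
    unfolding react_def by (intro continuous_intros b_ext_cont)
  show sm: "strict_mono (react x)"
    using b_ext_strict_mono lam_pos by (auto simp: strict_mono_def react_def)
  then show m: "mono (react x)" by (rule strict_mono_mono)
  show "\<bar>react x s\<bar> \<le> react_bound C x" if "\<bar>s\<bar> \<le> C" for s C
  proof -
    have "\<bar>react x s\<bar> \<le> lam * \<bar>b_ext \<delta> b x s\<bar> + \<bar>g x\<bar>"
      unfolding react_def using abs_triangle_ineq4[of "lam * b_ext \<delta> b x s" "g x"] lam_pos by (simp add: abs_mult)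
    also have "lam * \<bar>b_ext \<delta> b x s\<bar> \<le> lam * (b x \<delta> + C)"
      using b_ext_bound[of s] that lam_pos by (intro mult_left_mono) auto
    finally show ?thesis by (simp add: react_bound_def)
  qed
  show "energy x 0 = 0" and d: "(energy x has_real_derivative react x s) (at s)" for s
    using reaction_energy[OF c] by (simp_all add: energy_def)
  show "react x v * (w - v) \<le> energy x w - energy x v" for v w
    by (rule antiderivative_subgradient[OF d m])
qed

lemma b_ext_measurable:
  assumes "v \<in> borel_measurable M"
  shows "(\<lambda>x. b_ext \<delta> b x (v x)) \<in> borel_measurable M"
proof (rule borel_measurable_Caratheodory[OF lebesgue_domain _ _ assms])
  show "(\<lambda>x. b_ext \<delta> b x s) \<in> borel_measurable M" for s
    unfolding b_ext_def using b_meas delta_pos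
    by (cases "s < 0"; cases "s \<le> \<delta>") auto
  show "AE x in M. continuous_on UNIV (b_ext \<delta> b x)"
    using reaction_AE by eventually_elim (rule reaction_at.b_ext_cont)
qed

lemma react_measurable: "v \<in> borel_measurable M \<Longrightarrow> (\<lambda>x. react x (v x)) \<in> borel_measurable M"
  unfolding react_def by (intro borel_measurable_diff borel_measurable_times b_ext_measurable g_meas borel_measurable_const)

lemma energy_measurable:
  assumes v: "v \<in> borel_measurable M"
  shows "(\<lambda>x. energy x (v x)) \<in> borel_measurable M"
proof (rule borel_measurable_AE_limit[OF lebesgue_domain])
  show "AE x in M. (\<lambda>k. \<Sum>i<Suc k. react x (real i / real (Suc k) * v x) * (v x / real (Suc k))) \<longlonglongrightarrow> energy x (v x)"
    using reaction_AE
    by eventually_elim (rule antiderivative_Riemann_sums[OF react_facts(7,6,3)])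
  show "(\<lambda>x. \<Sum>i<Suc k. react x (real i / real (Suc k) * v x) * (v x / real (Suc k))) \<in> borel_measurable M" for k
    using v by (intro borel_measurable_sum borel_measurable_times react_measurable borel_measurable_divide borel_measurable_const)
qed

text \<open>The subgradient inequality compared with 0 gives potential at most
  \<open>Phi * norm\<close>, a product of conjugate-integrable factors.\<close>

lemma potential_integrable:
  assumes G: "G \<in> borel_measurable M" "(\<lambda>x. norm (G x)) \<in> Lp_var \<Omega> p"
  shows "integrable M (\<lambda>x. potential \<Psi> x (G x))"
proof (rule Bochner_Integration.integrable_bound)
  show "integrable M (\<lambda>x. Phi \<Psi> x (norm (G x)) * norm (G x))"
    by (rule Lp_conj_integrable[OF Phi_Lp[OF G(2)] G(2)])
  show "AE x in M. norm (potential \<Psi> x (G x)) \<le> norm (Phi \<Psi> x (norm (G x)) * norm (G x))"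
    using flux_AE
  proof eventually_elim
    case (elim x)
    then interpret flux_at \<Psi> x .
    show ?case using potential_le[of "G x"] potential_nonneg[of "G x"] by simp
  qed
  show "(\<lambda>x. potential \<Psi> x (G x)) \<in> borel_measurable M"
  proof (rule borel_measurable_AE_limit[OF lebesgue_domain])
    show "AE x in M. (\<lambda>k. \<Sum>i<Suc k. Phi \<Psi> x (real i / real (Suc k) * norm (G x)) * (norm (G x) / real (Suc k)))
        \<longlonglongrightarrow> potential \<Psi> x (G x)"
      using flux_AE by eventually_elim (rule flux_at.potential_Riemann_sums)
    \<comment> \<open>Measurability is read off from the mapping property \<open>Phi_Lp\<close>,
      applied to multiples of the norm; these are the arguments occurring in the Riemann
      sums.\<close>
    have "(\<lambda>x. Phi \<Psi> x (c * norm (G x))) \<in> borel_measurable M" for c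
      using Phi_Lp[OF Lp_scale[OF G(2)]] by (simp add: Lp_var_def)
    then show "(\<lambda>x. \<Sum>i<Suc k. Phi \<Psi> x (real i / real (Suc k) * norm (G x)) * (norm (G x) / real (Suc k))) \<in> borel_measurable M" for k
      using measurable_compose[OF G(1) borel_measurable_norm]
      by (intro borel_measurable_sum borel_measurable_times borel_measurable_divide borel_measurable_const)
  qed
qed

lemma flux_measurable:
  assumes G: "G \<in> borel_measurable M" "(\<lambda>x. norm (G x)) \<in> Lp_var \<Omega> p"
  shows "(\<lambda>x. flux \<Psi> x (G x)) \<in> borel_measurable M"
proof -
  \<comment> \<open>At the origin the quotient is 0 by the convention for division, in agreement
    with the flux.\<close>
  have "flux \<Psi> x \<xi> = (Phi \<Psi> x (norm \<xi>) / norm \<xi>) *\<^sub>R \<xi>" for x \<xi>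
    by (auto simp: flux_def Phi_def)
  moreover have "(\<lambda>x. Phi \<Psi> x (norm (G x))) \<in> borel_measurable M"
    using Phi_Lp[OF G(2)] by (simp add: Lp_var_def)
  ultimately show ?thesis using G(1) by simp
qed

lemma flux_integrable:
  assumes G: "G \<in> borel_measurable M" "(\<lambda>x. norm (G x)) \<in> Lp_var \<Omega> p"
    and F: "F \<in> borel_measurable M" "(\<lambda>x. norm (F x)) \<in> Lp_var \<Omega> p"
  shows "integrable M (\<lambda>x. flux \<Psi> x (G x) \<bullet> F x)"
proof (rule Bochner_Integration.integrable_bound)
  show "integrable M (\<lambda>x. Phi \<Psi> x (norm (G x)) * norm (F x))"
    by (rule Lp_conj_integrable[OF Phi_Lp[OF G(2)] F(2)])
  show "AE x in M. norm (flux \<Psi> x (G x) \<bullet> F x) \<le> norm (Phi \<Psi> x (norm (G x)) * norm (F x))"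
    using flux_AE
  proof eventually_elim
    case (elim x)
    then interpret flux_at \<Psi> x .
    show ?case using Cauchy_Schwarz_ineq2[of "flux \<Psi> x (G x)" "F x"] Phi_nonneg by (simp add: norm_flux)
  qed
  show "(\<lambda>x. flux \<Psi> x (G x) \<bullet> F x) \<in> borel_measurable M"
    using flux_measurable[OF G] F(1) by simp
qed

sublocale convex_minimisation \<Omega> p pmin pmax "potential \<Psi>" energy "\<lambda>x. \<delta> * (2 * react_bound \<delta> x)" \<delta>
proof
  show "0 \<le> \<delta>" using delta_pos by simp
  show "AE x in M. \<forall>\<xi>. 0 \<le> potential \<Psi> x \<xi>"
    using flux_AE by eventually_elim (simp add: flux_at.potential_nonneg)
  show "AE x in M. \<forall>\<xi>. isCont (potential \<Psi> x) \<xi>"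
    using flux_AE by eventually_elim (simp add: flux_at.potential_cont)
  show "AE x in M. \<forall>\<xi> \<zeta>. 2 * potential \<Psi> x ((1/2) *\<^sub>R \<xi> + (1/2) *\<^sub>R \<zeta>) \<le> potential \<Psi> x \<xi> + potential \<Psi> x \<zeta>"
    using flux_AE by eventually_elim (simp only: flux_at.potential_midpoint, simp)
  show "integrable M (\<lambda>x. potential \<Psi> x (grad V x))" if "V \<in> W1p_var \<Omega> p" for V
    by (rule potential_integrable[OF W1pD(5,6)[OF that]])
  show "filterlim (\<lambda>k. LINT x|M. potential \<Psi> x (grad (V k) x)) at_top sequentially"
    if "\<And>k. V k \<in> W1p_var \<Omega> p" "filterlim (\<lambda>k. LINT x|M. norm (grad (V k) x) powr p x) at_top sequentially" for V
    by (rule coercive[OF that])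
  show "AE x in M. \<forall>s. isCont (energy x) s"
    using reaction_AE by eventually_elim (blast intro: DERIV_isCont react_facts(7))
  show "AE x in M. \<forall>s t. 2 * energy x ((1/2) * s + (1/2) * t) \<le> energy x s + energy x t"
    using reaction_AE
  proof eventually_elim
    case (elim x)
    show ?case
    proof (intro allI)
      fix s t :: real
      let ?m = "(1/2) * s + (1/2) * t"
      have "s - ?m = - (t - ?m)" by (simp add: field_simps)
      then show "2 * energy x ?m \<le> energy x s + energy x t"
        using react_facts(5)[OF elim, of ?m s] react_facts(5)[OF elim, of ?m t] by (simp only: mult_minus_right)
    qed
  qed
  show "AE x in M. \<forall>s\<in>{0..\<delta>}. \<bar>energy x s\<bar> \<le> \<delta> * (2 * react_bound \<delta> x)"
    using reaction_AE
  proof eventually_elim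
    case (elim x)
    show ?case
    proof
      fix s assume s: "s \<in> {0..\<delta>}"
      have r: "\<bar>react x s\<bar> \<le> react_bound \<delta> x" "\<bar>react x 0\<bar> \<le> react_bound \<delta> x"
        using react_facts(4)[OF elim] s delta_pos by auto
      \<comment> \<open>The energy vanishes at 0, so its subgradient inequalities at 0 and at s
        enclose it between two products of reaction and s.\<close>
      have "react x 0 * s \<le> energy x s" "energy x s \<le> react x s * s"
        using react_facts(5)[OF elim, of 0 s] react_facts(5)[OF elim, of s 0] react_facts(6)[OF elim] by auto
      moreover have "\<bar>react x s * s\<bar> \<le> react_bound \<delta> x * \<delta>" "\<bar>react x 0 * s\<bar> \<le> react_bound \<delta> x * \<delta>"
        unfolding abs_mult using r s by (intro mult_mono; simp)+
      moreover have "0 \<le> react_bound \<delta> x * \<delta>" using r delta_pos by simp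
      ultimately show "\<bar>energy x s\<bar> \<le> \<delta> * (2 * react_bound \<delta> x)" by (simp add: abs_le_iff mult.commute)
    qed
  qed
  show "integrable M (\<lambda>x. \<delta> * (2 * react_bound \<delta> x))"
    using react_bound_int by simp
qed (rule energy_measurable)

text \<open>The perturbation V + t\<phi> may leave K, but clamping it to the admissible range does
  not raise the functional. The subgradient inequality at the perturbed point bounds the increment
  of J by t times the integral of P, and t tends to 0 under a dominating function, so
  differentiability of J is never discussed.\<close>

lemma variational_inequality:
  assumes V: "V \<in> K" and V_min: "\<And>W. W \<in> K \<Longrightarrow> J V \<le> J W"
    and \<phi>: "\<phi> \<in> W1p_var \<Omega> p" and \<phi>_bound: "AE x in M. \<bar>\<phi> x\<bar> \<le> C"
  shows "0 \<le> (LINT x|M. flux \<Psi> x (grad V x) \<bullet> grad \<phi> x + react x (V x) * \<phi> x)"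
proof -
  note VW = W1pD[OF KD(1)[OF V]] and \<phi>W = W1pD[OF \<phi>]
  note [measurable] = VW(2,5) \<phi>W(2,5)
  define t where "t k = inverse (real (Suc k))" for k
  have t: "0 < t k" "t k \<le> 1" for k by (simp_all add: t_def inverse_le_1_iff)
  have t_lim: "t \<longlonglongrightarrow> 0" unfolding t_def by (rule LIMSEQ_inverse_real_of_nat)
  define P where "P k x = flux \<Psi> x (grad V x + t k *\<^sub>R grad \<phi> x) \<bullet> grad \<phi> x + react x (V x + t k * \<phi> x) * \<phi> x" for k x
  \<comment> \<open>Since t is at most 1, this dominates every perturbed gradient, and monotonicity
    of \<open>Phi\<close> turns it into one dominating function for all k.\<close>
  let ?s = "\<lambda>x. \<bar>norm (grad V x)\<bar> + \<bar>norm (grad \<phi> x)\<bar>"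
  have s_Lp: "?s \<in> Lp_var \<Omega> p" by (rule Lp_add[OF VW(6) \<phi>W(6)])
  have G_norm: "norm (grad V x + t k *\<^sub>R grad \<phi> x) \<le> ?s x" for k x
  proof -
    have "t k * norm (grad \<phi> x) \<le> 1 * norm (grad \<phi> x)"
      using t[of k] by (intro mult_right_mono) auto
    then show ?thesis
      using norm_triangle_ineq[of "grad V x" "t k *\<^sub>R grad \<phi> x"] t[of k] by simp
  qed
  have G: "(\<lambda>x. grad V x + t k *\<^sub>R grad \<phi> x) \<in> borel_measurable M"
    "(\<lambda>x. norm (grad V x + t k *\<^sub>R grad \<phi> x)) \<in> Lp_var \<Omega> p" for k
    by measurable (rule Lp_bound[OF s_Lp], measurable, use G_norm in auto)
  let ?w = "\<lambda>x. Phi \<Psi> x (?s x) * norm (grad \<phi> x) + C * react_bound (\<delta> + C) x"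
  have w_int: "integrable M ?w"
    using Lp_conj_integrable[OF Phi_Lp[OF s_Lp] \<phi>W(6)] react_bound_int by simp
  have P_meas: "P k \<in> borel_measurable M" for k
    unfolding P_def
    by (intro borel_measurable_add borel_measurable_times borel_measurable_inner flux_measurable[OF G] react_measurable) measurable
  have P_bound: "AE x in M. norm (P k x) \<le> ?w x" for k
    using flux_AE reaction_AE KD(2)[OF V] \<phi>_bound
  proof eventually_elim
    case (elim x)
    interpret flux_at \<Psi> x by (rule elim(1))
    have "\<bar>flux \<Psi> x (grad V x + t k *\<^sub>R grad \<phi> x) \<bullet> grad \<phi> x\<bar>
        \<le> Phi \<Psi> x (norm (grad V x + t k *\<^sub>R grad \<phi> x)) * norm (grad \<phi> x)"
      using Cauchy_Schwarz_ineq2 by (metis norm_flux)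
    also have "\<dots> \<le> Phi \<Psi> x (?s x) * norm (grad \<phi> x)"
      by (intro mult_right_mono Phi_mono G_norm) auto
    finally have 1: "\<bar>flux \<Psi> x (grad V x + t k *\<^sub>R grad \<phi> x) \<bullet> grad \<phi> x\<bar> \<le> Phi \<Psi> x (?s x) * norm (grad \<phi> x)" .
    have "t k * \<bar>\<phi> x\<bar> \<le> 1 * C" using t[of k] elim(4) by (intro mult_mono) auto
    then have "\<bar>V x + t k * \<phi> x\<bar> \<le> \<delta> + C"
      using elim(3) abs_triangle_ineq[of "V x" "t k * \<phi> x"] t[of k] by (simp add: abs_mult)
    then have "\<bar>react x (V x + t k * \<phi> x)\<bar> \<le> react_bound (\<delta> + C) x"
      by (rule react_facts(4)[OF elim(2)])
    then have "\<bar>react x (V x + t k * \<phi> x) * \<phi> x\<bar> \<le> react_bound (\<delta> + C) x * C"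
      unfolding abs_mult using elim(4) by (intro mult_mono) auto
    with 1 show ?case
      unfolding P_def real_norm_def
      by (intro order_trans[OF abs_triangle_ineq] add_mono) (auto simp: mult.commute)
  qed
  have P_int: "integrable M (P k)" for k
    by (rule Bochner_Integration.integrable_bound[OF w_int P_meas])
      (use P_bound[of k] in \<open>eventually_elim, simp\<close>)
  have P_nonneg: "0 \<le> (LINT x|M. P k x)" for k
  proof -
    let ?u = "\<lambda>x. 1 * V x + t k * \<phi> x" and ?T = "\<lambda>x. clamp_real 0 \<delta> (1 * V x + t k * \<phi> x)"
    note u = W1p_combine[OF KD(1)[OF V] \<phi>, of 1 "t k"]
    note T = W1p_clamp[OF u(1), of 0 \<delta>]
    have T_K: "?T \<in> K"
      using T(1) delta_pos by (auto simp: K_def clamp_real_def)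
    have le: "AE x in M. (potential \<Psi> x (grad ?T x) + energy x (?T x)) - (potential \<Psi> x (grad V x) + energy x (V x)) \<le> t k * P k x"
      using flux_AE reaction_AE u(2) T(2)[OF less_imp_le[OF delta_pos]] g_range
    proof eventually_elim
      case (elim x)
      interpret F: flux_at \<Psi> x by (rule elim(1))
      interpret R: reaction_at \<delta> b x by (rule elim(2))
      have gu: "grad ?u x = grad V x + t k *\<^sub>R grad \<phi> x" using elim(3) by simp
      have "norm (grad ?T x) \<le> norm (grad ?u x)"
        using clamp_deriv_bounds[of 0 \<delta> "?u x"] delta_pos unfolding elim(4) by (simp add: mult_left_le_one_le)
      then have "potential \<Psi> x (grad ?T x) \<le> potential \<Psi> x (grad ?u x)" by (rule F.potential_mono)
      also have "\<dots> \<le> potential \<Psi> x (grad V x) + t k * (flux \<Psi> x (grad V x + t k *\<^sub>R grad \<phi> x) \<bullet> grad \<phi> x)"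
        using F.potential_subgradient[of "grad ?u x" "grad V x"] unfolding gu by simp
      finally have 1: "potential \<Psi> x (grad ?T x) \<le> potential \<Psi> x (grad V x) + t k * (flux \<Psi> x (grad V x + t k *\<^sub>R grad \<phi> x) \<bullet> grad \<phi> x)" .
      have "0 \<le> react x (?T x) * (?u x - ?T x)"
      proof -
        \<comment> \<open>Here \<open>g_range\<close> enters: the energy is nonincreasing below 0
          and nondecreasing above \<delta>, so moving a value to the nearest end of the interval
          cannot raise it.\<close>
        have r0: "react x 0 \<le> 0" "0 \<le> react x \<delta>"
          using elim(5) delta_pos by (auto simp: react_def b_ext_def)
        consider "?u x < 0" | "0 \<le> ?u x" "?u x \<le> \<delta>" | "\<delta> < ?u x" by linarith
        then show ?thesis
          by cases (use r0 delta_pos in \<open>auto simp: clamp_real_def min_def max_def mult_nonpos_nonpos\<close>)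
      qed
      also have "\<dots> \<le> energy x (?u x) - energy x (?T x)" by (rule react_facts(5)[OF elim(2)])
      finally have "energy x (?T x) \<le> energy x (?u x)" by simp
      also have "energy x (?u x) \<le> energy x (V x) + t k * (react x (V x + t k * \<phi> x) * \<phi> x)"
        using react_facts(5)[OF elim(2), of "?u x" "V x"] by (simp add: algebra_simps)
      finally show ?case using 1 by (simp add: P_def distrib_left)
    qed
    have i: "integrable M (\<lambda>x. potential \<Psi> x (grad W x))" "integrable M (\<lambda>x. energy x (W x))" if "W \<in> K" for W
      using A_int[OF KD(1)[OF that]] E_int[OF that] by auto
    have "0 \<le> J ?T - J V" using V_min[OF T_K] by simp
    also have "\<dots> = (LINT x|M. (potential \<Psi> x (grad ?T x) + energy x (?T x)) - (potential \<Psi> x (grad V x) + energy x (V x)))"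
      using i[OF T_K] i[OF V] by (simp add: J_def)
    also have "\<dots> \<le> (LINT x|M. t k * P k x)"
      using i[OF T_K] i[OF V] P_int[of k] le by (intro integral_mono_AE) auto
    also have "\<dots> = t k * (LINT x|M. P k x)" by simp
    finally show ?thesis using t(1)[of k] by (simp add: zero_le_mult_iff)
  qed
  have "(\<lambda>k. LINT x|M. P k x) \<longlonglongrightarrow> (LINT x|M. flux \<Psi> x (grad V x) \<bullet> grad \<phi> x + react x (V x) * \<phi> x)"
  proof (rule integral_dominated_convergence[where w = ?w])
    show "(\<lambda>x. flux \<Psi> x (grad V x) \<bullet> grad \<phi> x + react x (V x) * \<phi> x) \<in> borel_measurable M"
      by (intro borel_measurable_add borel_measurable_times borel_measurable_inner flux_measurable[OF VW(5,6)] react_measurable) measurable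
    show "AE x in M. (\<lambda>k. P k x) \<longlonglongrightarrow> flux \<Psi> x (grad V x) \<bullet> grad \<phi> x + react x (V x) * \<phi> x"
      using flux_AE reaction_AE
    proof eventually_elim
      case (elim x)
      have "(\<lambda>k. grad V x + t k *\<^sub>R grad \<phi> x) \<longlonglongrightarrow> grad V x + 0 *\<^sub>R grad \<phi> x"
        by (intro tendsto_intros t_lim)
      then have 1: "(\<lambda>k. flux \<Psi> x (grad V x + t k *\<^sub>R grad \<phi> x)) \<longlonglongrightarrow> flux \<Psi> x (grad V x)"
        by (intro isCont_tendsto_compose[OF flux_at.flux_cont[OF elim(1)]]) simp
      have "(\<lambda>k. V x + t k * \<phi> x) \<longlonglongrightarrow> V x + 0 * \<phi> x"
        by (intro tendsto_intros t_lim)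
      moreover have "isCont (react x) (V x)"
        using react_facts(1)[OF elim(2)] by (simp add: continuous_on_eq_continuous_at)
      ultimately have 2: "(\<lambda>k. react x (V x + t k * \<phi> x)) \<longlonglongrightarrow> react x (V x)"
        by (intro isCont_tendsto_compose[of _ "react x"]) auto
      show ?case unfolding P_def by (intro tendsto_add tendsto_mult tendsto_inner tendsto_const 1 2)
    qed
  qed (use w_int P_bound P_meas in auto)
  then show ?thesis by (rule LIMSEQ_le_const) (use P_nonneg in auto)
qed

section \<open>From bounded to arbitrary test functions\<close>

definition weak_eq :: "('a \<Rightarrow> real) \<Rightarrow> ('a \<Rightarrow> real) \<Rightarrow> bool" where
  "weak_eq V \<phi> \<longleftrightarrow> (LINT x|M. flux \<Psi> x (grad V x) \<bullet> grad \<phi> x) + lam * (LINT x|M. b_ext \<delta> b x (V x) * \<phi> x)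
     = (LINT x|M. g x * \<phi> x)"

lemma b_ext_integrable:
  assumes V: "V \<in> W1p_var \<Omega> p" and \<phi>: "\<phi> \<in> borel_measurable M" "AE x in M. \<bar>\<phi> x\<bar> \<le> C"
  shows "integrable M (\<lambda>x. b_ext \<delta> b x (V x) * \<phi> x)"
proof (rule integrable_mult_bounded[OF _ \<phi>])
  show "integrable M (\<lambda>x. b_ext \<delta> b x (V x))"
  proof (rule Bochner_Integration.integrable_bound)
    show "integrable M (\<lambda>x. b x \<delta> + \<bar>V x\<bar>)" using b_int W1pD(3)[OF V] by simp
    show "AE x in M. norm (b_ext \<delta> b x (V x)) \<le> norm (b x \<delta> + \<bar>V x\<bar>)"
      using reaction_AE
    proof eventually_elim
      case (elim x)
      then show ?case using reaction_at.b_ext_bound[OF elim, of "V x"] by simp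
    qed
  qed (rule b_ext_measurable[OF W1pD(2)[OF V]])
qed

lemma g_mult_integrable:
  assumes "integrable M \<phi>"
  shows "integrable M (\<lambda>x. g x * \<phi> x)"
  using integrable_mult_bounded[OF assms g_meas g_bound] by (simp add: mult.commute)

lemma flux_grad_integrable:
  assumes "V \<in> W1p_var \<Omega> p" "\<phi> \<in> W1p_var \<Omega> p"
  shows "integrable M (\<lambda>x. flux \<Psi> x (grad V x) \<bullet> grad \<phi> x)"
  by (rule flux_integrable[OF W1pD(5,6)[OF assms(1)] W1pD(5,6)[OF assms(2)]])

lemma weak_eq_bounded:
  assumes V: "V \<in> K" and V_min: "\<And>W. W \<in> K \<Longrightarrow> J V \<le> J W"
    and \<phi>: "\<phi> \<in> W1p_var \<Omega> p" and \<phi>_bound: "AE x in M. \<bar>\<phi> x\<bar> \<le> C"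
  shows "weak_eq V \<phi>"
proof -
  let ?F = "\<lambda>\<phi>. (LINT x|M. flux \<Psi> x (grad V x) \<bullet> grad \<phi> x) + lam * (LINT x|M. b_ext \<delta> b x (V x) * \<phi> x)
     - (LINT x|M. g x * \<phi> x)"
  have F: "0 \<le> ?F \<psi>" if \<psi>: "\<psi> \<in> W1p_var \<Omega> p" "AE x in M. \<bar>\<psi> x\<bar> \<le> C" for \<psi>
  proof -
    have "(LINT x|M. flux \<Psi> x (grad V x) \<bullet> grad \<psi> x + react x (V x) * \<psi> x)
        = (LINT x|M. flux \<Psi> x (grad V x) \<bullet> grad \<psi> x + lam * (b_ext \<delta> b x (V x) * \<psi> x) - g x * \<psi> x)"
      by (intro Bochner_Integration.integral_cong) (auto simp: react_def algebra_simps)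
    also have "\<dots> = ?F \<psi>"
      using flux_grad_integrable[OF KD(1)[OF V] \<psi>(1)] b_ext_integrable[OF KD(1)[OF V] W1pD(2)[OF \<psi>(1)] \<psi>(2)]
        g_mult_integrable[OF W1pD(3)[OF \<psi>(1)]] by simp
    finally show ?thesis using variational_inequality[OF V V_min \<psi>] by simp
  qed
  note m = W1p_combine[OF \<phi> W1p_zero, of "-1" 0]
  have m1: "(\<lambda>x. - \<phi> x) \<in> W1p_var \<Omega> p" and m2: "AE x in M. grad (\<lambda>x. - \<phi> x) x = - grad \<phi> x"
    using m by simp_all
  have "(LINT x|M. flux \<Psi> x (grad V x) \<bullet> grad (\<lambda>x. - \<phi> x) x) = (LINT x|M. - (flux \<Psi> x (grad V x) \<bullet> grad \<phi> x))"
  proof (rule integral_cong_AE)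
    show "AE x in M. flux \<Psi> x (grad V x) \<bullet> grad (\<lambda>x. - \<phi> x) x = - (flux \<Psi> x (grad V x) \<bullet> grad \<phi> x)"
      using m2 by eventually_elim simp
  qed (use flux_grad_integrable[OF KD(1)[OF V] \<phi>] flux_grad_integrable[OF KD(1)[OF V] m1] in auto)
  then show ?thesis
    using F[OF \<phi> \<phi>_bound] F[OF m1] \<phi>_bound by (simp add: weak_eq_def)
qed

text \<open>Testing with truncations of \<open>\<phi>\<close> shows that \<open>b_ext(V) \<phi>\<close> is integrable, without an
  embedding into \<open>L\<^sup>2\<close>.\<close>
lemma b_ext_mult_integrable:
  assumes V: "V \<in> K" and eq: "\<And>\<phi> C. \<phi> \<in> W1p_var \<Omega> p \<Longrightarrow> AE x in M. \<bar>\<phi> x\<bar> \<le> C \<Longrightarrow> weak_eq V \<phi>"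
    and \<phi>: "\<phi> \<in> W1p_var \<Omega> p"
  shows "integrable M (\<lambda>x. b_ext \<delta> b x (V x) * \<phi> x)"
proof -
  note VW = KD(1)[OF V]
  have b_nn: "AE x in M. 0 \<le> b_ext \<delta> b x (V x)"
    using reaction_AE KD(2)[OF V]
    by eventually_elim (auto simp: b_ext_def reaction_at.b_nonneg)
  \<comment> \<open>The signs of the test function are separated because the reaction is nonnegative
    along V: truncations of the positive part then give nonnegative integrands, and Fatou turns a
    bound on their integrals into integrability.\<close>
  have pos: "integrable M (\<lambda>x. b_ext \<delta> b x (V x) * max 0 (\<psi> x))" if \<psi>: "\<psi> \<in> W1p_var \<Omega> p" for \<psi>
  proof -
    define \<psi>' where "\<psi>' k x = clamp_real 0 (real k) (\<psi> x)" for k x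
    have \<psi>'W: "\<psi>' k \<in> W1p_var \<Omega> p" and \<psi>'g: "AE x in M. grad (\<psi>' k) x = clamp_deriv 0 (real k) (\<psi> x) *\<^sub>R grad \<psi> x" for k
      using W1p_clamp[OF \<psi>, of 0 "real k"] by (auto simp: \<psi>'_def[abs_def])
    have \<psi>'b: "\<bar>\<psi>' k x\<bar> \<le> real k" "\<bar>\<psi>' k x\<bar> \<le> \<bar>\<psi> x\<bar>" "0 \<le> \<psi>' k x" for k x
      by (auto simp: \<psi>'_def clamp_real_def)
    have int: "integrable M (\<lambda>x. b_ext \<delta> b x (V x) * \<psi>' k x)" for k
      using \<psi>'b by (intro b_ext_integrable[OF VW W1pD(2)[OF \<psi>'W]]) auto
    \<comment> \<open>Independent of k, since truncation increases neither the size of the function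
      nor that of its gradient.\<close>
    let ?B = "((LINT x|M. g_max * \<bar>\<psi> x\<bar>) + (LINT x|M. \<bar>flux \<Psi> x (grad V x) \<bullet> grad \<psi> x\<bar>)) / lam"
    have le: "(LINT x|M. b_ext \<delta> b x (V x) * \<psi>' k x) \<le> ?B" for k
    proof -
      have "weak_eq V (\<psi>' k)" using \<psi>'b by (intro eq[OF \<psi>'W]) auto
      then have "lam * (LINT x|M. b_ext \<delta> b x (V x) * \<psi>' k x)
          = (LINT x|M. g x * \<psi>' k x) - (LINT x|M. flux \<Psi> x (grad V x) \<bullet> grad (\<psi>' k) x)"
        by (simp add: weak_eq_def)
      also have "\<dots> \<le> (LINT x|M. g_max * \<bar>\<psi> x\<bar>) + (LINT x|M. \<bar>flux \<Psi> x (grad V x) \<bullet> grad \<psi> x\<bar>)"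
      proof -
        have "\<bar>LINT x|M. g x * \<psi>' k x\<bar> \<le> (LINT x|M. g_max * \<bar>\<psi> x\<bar>)"
        proof (rule abs_integral_le_AE)
          show "AE x in M. \<bar>g x * \<psi>' k x\<bar> \<le> g_max * \<bar>\<psi> x\<bar>"
            using g_bound
          proof eventually_elim
            case (elim x)
            then show ?case
              unfolding abs_mult using \<psi>'b(2)[of k x] by (intro mult_mono) auto
          qed
        qed (use W1pD(3)[OF \<psi>] in simp)
        moreover have "\<bar>LINT x|M. flux \<Psi> x (grad V x) \<bullet> grad (\<psi>' k) x\<bar> \<le> (LINT x|M. \<bar>flux \<Psi> x (grad V x) \<bullet> grad \<psi> x\<bar>)"
        proof (rule abs_integral_le_AE)
          show "AE x in M. \<bar>flux \<Psi> x (grad V x) \<bullet> grad (\<psi>' k) x\<bar> \<le> \<bar>flux \<Psi> x (grad V x) \<bullet> grad \<psi> x\<bar>"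
            using \<psi>'g[of k]
          proof eventually_elim
            case (elim x)
            show ?case
              using clamp_deriv_bounds[of 0 "real k" "\<psi> x"] by (simp add: elim abs_mult mult_left_le_one_le)
          qed
        qed (use flux_grad_integrable[OF VW \<psi>] in simp)
        ultimately show ?thesis by linarith
      qed
      finally show ?thesis using lam_pos by (simp add: field_simps)
    qed
    show ?thesis
    proof (rule Fatou_bound(1)[OF int _ _ _ le tendsto_const])
      show "AE x in M. 0 \<le> b_ext \<delta> b x (V x) * \<psi>' k x" for k
        using b_nn by eventually_elim (simp add: \<psi>'b)
      have "(\<lambda>k. \<psi>' k x) \<longlonglongrightarrow> max 0 (\<psi> x)" for x
      proof (rule tendsto_eventually)
        obtain N :: nat where "\<psi> x \<le> real N" using real_arch_simple by blast
        then show "eventually (\<lambda>k. \<psi>' k x = max 0 (\<psi> x)) sequentially"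
          by (intro eventually_sequentiallyI[of N]) (auto simp: \<psi>'_def clamp_real_def)
      qed
      then show "AE x in M. (\<lambda>k. b_ext \<delta> b x (V x) * \<psi>' k x) \<longlonglongrightarrow> b_ext \<delta> b x (V x) * max 0 (\<psi> x)"
        by (intro AE_I2 tendsto_mult_left)
      show "(\<lambda>x. b_ext \<delta> b x (V x) * max 0 (\<psi> x)) \<in> borel_measurable M"
        using b_ext_measurable[OF W1pD(2)[OF VW]] W1pD(2)[OF \<psi>] by simp
    qed
  qed
  have m1: "(\<lambda>x. - \<phi> x) \<in> W1p_var \<Omega> p"
    using W1p_combine(1)[OF \<phi> W1p_zero, of "-1" 0] by simp
  have "b_ext \<delta> b x (V x) * \<phi> x = b_ext \<delta> b x (V x) * max 0 (\<phi> x) - b_ext \<delta> b x (V x) * max 0 (- \<phi> x)" for x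
    by (simp add: max_def)
  then show ?thesis using pos[OF \<phi>] pos[OF m1] by simp
qed

text \<open>Truncating \<phi> at levels -k and k gives bounded tests. Each of the three integrands
  is dominated by its untruncated version, which for the reaction term relies on
  \<open>b_ext_mult_integrable\<close>.\<close>

lemma weak_eq_all:
  assumes V: "V \<in> K" and eq: "\<And>\<phi> C. \<phi> \<in> W1p_var \<Omega> p \<Longrightarrow> AE x in M. \<bar>\<phi> x\<bar> \<le> C \<Longrightarrow> weak_eq V \<phi>"
    and \<phi>: "\<phi> \<in> W1p_var \<Omega> p"
  shows "weak_eq V \<phi>"
proof -
  note VW = KD(1)[OF V]
  define \<phi>' where "\<phi>' k x = clamp_real (- real k) (real k) (\<phi> x)" for k x
  have \<phi>'W: "\<phi>' k \<in> W1p_var \<Omega> p"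
    and \<phi>'g: "AE x in M. grad (\<phi>' k) x = clamp_deriv (- real k) (real k) (\<phi> x) *\<^sub>R grad \<phi> x" for k
    using W1p_clamp[OF \<phi>, of "- real k" "real k"] by (auto simp: \<phi>'_def[abs_def])
  have \<phi>'b: "\<bar>\<phi>' k x\<bar> \<le> real k" "\<bar>\<phi>' k x\<bar> \<le> \<bar>\<phi> x\<bar>" for k x
    by (auto simp: \<phi>'_def clamp_real_def)
  \<comment> \<open>The inequality is strict to stay off the corners, where
    \<open>clamp_deriv\<close> is not 1.\<close>
  have arch: "\<exists>N::nat. \<forall>k\<ge>N. \<bar>\<phi> x\<bar> < real k" for x
  proof -
    obtain N :: nat where "\<bar>\<phi> x\<bar> < real N" using reals_Archimedean2 by blast
    then show ?thesis by (intro exI[of _ N]) auto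
  qed
  have lim: "(\<lambda>k. \<phi>' k x) \<longlonglongrightarrow> \<phi> x" for x
  proof (rule tendsto_eventually)
    obtain N :: nat where "\<forall>k\<ge>N. \<bar>\<phi> x\<bar> < real k" using arch by blast
    then show "eventually (\<lambda>k. \<phi>' k x = \<phi> x) sequentially"
      by (intro eventually_sequentiallyI[of N]) (auto simp: \<phi>'_def clamp_real_def max_def min_def abs_less_iff)
  qed
  have mult_lim: "(\<lambda>k. LINT x|M. h x * \<phi>' k x) \<longlonglongrightarrow> (LINT x|M. h x * \<phi> x)"
    if "integrable M (\<lambda>x. h x * \<phi> x)" "h \<in> borel_measurable M" for h
  proof (rule integral_dominated_convergence[where w = "\<lambda>x. \<bar>h x * \<phi> x\<bar>"])
    show "AE x in M. (\<lambda>k. h x * \<phi>' k x) \<longlonglongrightarrow> h x * \<phi> x"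
      by (intro AE_I2 tendsto_mult_left lim)
    show "AE x in M. norm (h x * \<phi>' k x) \<le> \<bar>h x * \<phi> x\<bar>" for k
      by (intro AE_I2) (auto simp: abs_mult \<phi>'b intro!: mult_left_mono)
  qed (use that W1pD(2)[OF \<phi>'W] in auto)
  have flux_lim: "(\<lambda>k. LINT x|M. flux \<Psi> x (grad V x) \<bullet> grad (\<phi>' k) x) \<longlonglongrightarrow> (LINT x|M. flux \<Psi> x (grad V x) \<bullet> grad \<phi> x)"
  proof (rule integral_dominated_convergence[where w = "\<lambda>x. \<bar>flux \<Psi> x (grad V x) \<bullet> grad \<phi> x\<bar>"])
    show "AE x in M. (\<lambda>k. flux \<Psi> x (grad V x) \<bullet> grad (\<phi>' k) x) \<longlonglongrightarrow> flux \<Psi> x (grad V x) \<bullet> grad \<phi> x"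
    proof -
      have "AE x in M. \<forall>k. grad (\<phi>' k) x = clamp_deriv (- real k) (real k) (\<phi> x) *\<^sub>R grad \<phi> x"
        using \<phi>'g by (simp add: AE_all_countable)
      then show ?thesis
      proof eventually_elim
        case (elim x)
        obtain N :: nat where "\<forall>k\<ge>N. \<bar>\<phi> x\<bar> < real k" using arch by blast
        then have "flux \<Psi> x (grad V x) \<bullet> grad (\<phi>' k) x = flux \<Psi> x (grad V x) \<bullet> grad \<phi> x" if "k \<ge> N" for k
          using that clamp_deriv_eq_1[of "- real k" "\<phi> x" "real k"] elim by (auto simp: abs_less_iff)
        then show ?case by (intro tendsto_eventually eventually_sequentiallyI[of N]) auto
      qed
    qed
    show "AE x in M. norm (flux \<Psi> x (grad V x) \<bullet> grad (\<phi>' k) x) \<le> \<bar>flux \<Psi> x (grad V x) \<bullet> grad \<phi> x\<bar>" for k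
      using \<phi>'g[of k]
    proof eventually_elim
      case (elim x)
      show ?case
        using clamp_deriv_bounds[of "- real k" "real k" "\<phi> x"] by (simp add: elim abs_mult mult_left_le_one_le)
    qed
  qed (use flux_grad_integrable[OF VW \<phi>] flux_grad_integrable[OF VW \<phi>'W] in auto)
  have "weak_eq V (\<phi>' k)" for k using \<phi>'b by (intro eq[OF \<phi>'W]) auto
  then have k: "(LINT x|M. flux \<Psi> x (grad V x) \<bullet> grad (\<phi>' k) x) + lam * (LINT x|M. b_ext \<delta> b x (V x) * \<phi>' k x)
     = (LINT x|M. g x * \<phi>' k x)" for k
    by (simp add: weak_eq_def)
  have "(\<lambda>k. LINT x|M. g x * \<phi>' k x) \<longlonglongrightarrow> (LINT x|M. flux \<Psi> x (grad V x) \<bullet> grad \<phi> x) + lam * (LINT x|M. b_ext \<delta> b x (V x) * \<phi> x)"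
    unfolding k[symmetric]
    by (intro tendsto_add tendsto_mult_left flux_lim mult_lim b_ext_mult_integrable[OF V eq \<phi>] b_ext_measurable W1pD(2)[OF VW])
  then show ?thesis
    using mult_lim[OF g_mult_integrable[OF W1pD(3)[OF \<phi>]] g_meas] LIMSEQ_unique
    unfolding weak_eq_def by blast
qed

text \<open>The difference truncated to [-1, 1] is a bounded test, so the reaction products are
  integrable even for an unbounded competitor. The flux and reaction contributions are both
  nonnegative and cancel, and strict monotonicity of the reaction then forces equality.\<close>

lemma weak_eq_unique:
  assumes V: "V \<in> W1p_var \<Omega> p" and W: "W \<in> W1p_var \<Omega> p"
    and eqV: "\<And>\<phi>. \<phi> \<in> W1p_var \<Omega> p \<Longrightarrow> weak_eq V \<phi>" and eqW: "\<And>\<phi>. \<phi> \<in> W1p_var \<Omega> p \<Longrightarrow> weak_eq W \<phi>"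
  shows "AE x in M. W x = V x"
proof -
  note d = W1p_combine[OF W V, of 1 "-1"]
  define \<phi> where "\<phi> x = clamp_real (-1) 1 (1 * W x + (-1) * V x)" for x
  have \<phi>W: "\<phi> \<in> W1p_var \<Omega> p"
    and \<phi>g0: "AE x in M. grad \<phi> x = clamp_deriv (-1) 1 (1 * W x + (-1) * V x) *\<^sub>R grad (\<lambda>x. 1 * W x + (-1) * V x) x"
    using W1p_clamp[OF d(1), of "-1" 1] by (simp_all add: \<phi>_def[abs_def])
  have \<phi>g: "AE x in M. grad \<phi> x = clamp_deriv (-1) 1 (W x - V x) *\<^sub>R (grad W x - grad V x)"
    using \<phi>g0 d(2) by eventually_elim simp
  have \<phi>b: "AE x in M. \<bar>\<phi> x\<bar> \<le> 1" by (auto simp: \<phi>_def clamp_real_def)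
  note iF = flux_grad_integrable[OF W \<phi>W] flux_grad_integrable[OF V \<phi>W]
  note ib = b_ext_integrable[OF W W1pD(2)[OF \<phi>W] \<phi>b] b_ext_integrable[OF V W1pD(2)[OF \<phi>W] \<phi>b]
  let ?b = "\<lambda>x. b_ext \<delta> b x (W x) * \<phi> x - b_ext \<delta> b x (V x) * \<phi> x"
  have "(LINT x|M. flux \<Psi> x (grad W x) \<bullet> grad \<phi> x - flux \<Psi> x (grad V x) \<bullet> grad \<phi> x) + lam * (LINT x|M. ?b x) = 0"
    using eqV[OF \<phi>W] eqW[OF \<phi>W] iF ib by (simp add: weak_eq_def right_diff_distrib)
  moreover have "0 \<le> (LINT x|M. flux \<Psi> x (grad W x) \<bullet> grad \<phi> x - flux \<Psi> x (grad V x) \<bullet> grad \<phi> x)"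
  proof (rule integral_nonneg_AE)
    show "AE x in M. 0 \<le> flux \<Psi> x (grad W x) \<bullet> grad \<phi> x - flux \<Psi> x (grad V x) \<bullet> grad \<phi> x"
      using flux_AE \<phi>g
    proof eventually_elim
      case (elim x)
      \<comment> \<open>The gradient of the test is a nonnegative multiple of the difference of the
        gradients, so monotonicity of the flux survives truncation.\<close>
      have "flux \<Psi> x (grad W x) \<bullet> grad \<phi> x - flux \<Psi> x (grad V x) \<bullet> grad \<phi> x
          = clamp_deriv (-1) 1 (W x - V x) * ((flux \<Psi> x (grad W x) - flux \<Psi> x (grad V x)) \<bullet> (grad W x - grad V x))"
        unfolding elim(2) by (simp add: inner_diff_left right_diff_distrib)
      then show ?case
        using flux_at.flux_monotone[OF elim(1)] clamp_deriv_bounds[of "-1" 1] by simp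
    qed
  qed
  moreover have b_nn: "AE x in M. 0 \<le> ?b x" and b_0: "AE x in M. ?b x = 0 \<longrightarrow> W x = V x"
  proof -
    have "AE x in M. 0 \<le> ?b x \<and> (?b x = 0 \<longrightarrow> W x = V x)"
      using reaction_AE
    proof eventually_elim
      case (elim x)
      have sm: "b_ext \<delta> b x s < b_ext \<delta> b x t" if "s < t" for s t
        using reaction_at.b_ext_strict_mono[OF elim] that by (simp add: strict_mono_def)
      have e: "?b x = (b_ext \<delta> b x (W x) - b_ext \<delta> b x (V x)) * \<phi> x" by (simp add: left_diff_distrib)
      consider "W x < V x" | "W x = V x" | "V x < W x" by linarith
      then show ?case
      proof cases
        case 1
        then have "\<phi> x < 0" "b_ext \<delta> b x (W x) - b_ext \<delta> b x (V x) < 0" using sm by (auto simp: \<phi>_def clamp_real_def)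
        then have "0 < ?b x" unfolding e by (rule mult_neg_neg[rotated])
        then show ?thesis by (metis less_le)
      next
        case 3
        then have "0 < \<phi> x" "0 < b_ext \<delta> b x (W x) - b_ext \<delta> b x (V x)" using sm by (auto simp: \<phi>_def clamp_real_def)
        then have "0 < ?b x" unfolding e by (rule mult_pos_pos[rotated])
        then show ?thesis by (metis less_le)
      qed simp
    qed
    then show "AE x in M. 0 \<le> ?b x" "AE x in M. ?b x = 0 \<longrightarrow> W x = V x" by (eventually_elim, simp)+
  qed
  moreover have "0 \<le> (LINT x|M. ?b x)" by (rule integral_nonneg_AE[OF b_nn])
  ultimately have "(LINT x|M. ?b x) = 0"
    using lam_pos by (smt (verit) mult_pos_pos)
  then have "AE x in M. ?b x = 0"
    using integral_nonneg_eq_0_iff_AE[OF _ b_nn] ib by auto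
  with b_0 show ?thesis by eventually_elim simp
qed

theorem unique_weak_solution:
  "\<exists>V\<in>K. (\<forall>\<phi>\<in>W1p_var \<Omega> p. weak_eq V \<phi>) \<and>
    (\<forall>W\<in>W1p_var \<Omega> p. (\<forall>\<phi>\<in>W1p_var \<Omega> p. weak_eq W \<phi>) \<longrightarrow> (AE x in M. W x = V x))"
proof -
  obtain V where V: "V \<in> K" "\<And>W. W \<in> K \<Longrightarrow> J V \<le> J W"
    using minimiser_exists by blast
  have "weak_eq V \<phi>" if "\<phi> \<in> W1p_var \<Omega> p" for \<phi>
    by (rule weak_eq_all[OF V(1) weak_eq_bounded[OF V] that])
  with V(1) weak_eq_unique[OF KD(1)[OF V(1)]] show ?thesis by blast
qed

end

lemma log_holder_on_imp_continuous_on: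
  assumes "log_holder_on S p"
  shows "continuous_on S p"
proof -
  obtain C where C: "\<And>x y. x \<in> S \<Longrightarrow> y \<in> S \<Longrightarrow> 0 < dist x y \<Longrightarrow> dist x y < 1/2 \<Longrightarrow>
      \<bar>p x - p y\<bar> \<le> - C / ln (dist x y)"
    using assms by (auto simp: log_holder_on_def)
  show ?thesis
    unfolding continuous_on_iff
  proof (intro ballI allI impI)
    fix x and \<epsilon> :: real assume x: "x \<in> S" and \<epsilon>: "0 < \<epsilon>"
    \<comment> \<open>Chosen so that \<open>- ln (dist y x)\<close> exceeds
      \<open>\<bar>C\<bar> / \<epsilon>\<close>; the absolute value is taken because C carries no
      sign.\<close>
    define r where "r = min (1/2) (exp (- (\<bar>C\<bar> / \<epsilon> + 1)))"
    have "dist (p y) (p x) < \<epsilon>" if y: "y \<in> S" "dist y x < r" for y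
    proof (cases "y = x")
      case False
      then have d: "0 < dist y x" "dist y x < 1/2" "dist y x < exp (- (\<bar>C\<bar> / \<epsilon> + 1))"
        using y by (auto simp: r_def)
      have "ln (dist y x) < - (\<bar>C\<bar> / \<epsilon> + 1)"
        using d by (metis exp_gt_zero ln_exp ln_less_cancel_iff)
      moreover have "0 \<le> \<bar>C\<bar> / \<epsilon>" using \<epsilon> by simp
      ultimately have L: "\<bar>C\<bar> / \<epsilon> < - ln (dist y x)" "0 < - ln (dist y x)"
        by linarith+
      have "\<bar>p y - p x\<bar> \<le> C / (- ln (dist y x))"
        using C[OF y(1) x d(1,2)] by simp
      also have "\<dots> \<le> \<bar>C\<bar> / (- ln (dist y x))"
        using L(2) by (intro divide_right_mono) auto
      also have "\<dots> < \<epsilon>"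
        using L \<epsilon> by (simp only: pos_divide_less_eq mult.commute)
      finally show ?thesis by (simp add: dist_real_def)
    qed (use \<epsilon> in simp)
    moreover have "0 < r" by (simp add: r_def)
    ultimately show "\<exists>d>0. \<forall>y\<in>S. dist y x < d \<longrightarrow> dist (p y) (p x) < \<epsilon>" by blast
  qed
qed

theorem theorem6p1:
  fixes \<Omega> :: "(real ^ 'n) set"
    and p :: "real ^ 'n \<Rightarrow> real"
    and \<Psi> b :: "real ^ 'n \<Rightarrow> real \<Rightarrow> real"
    and \<delta>\<^sub>0 lam :: real
    and g :: "real ^ 'n \<Rightarrow> real"
  assumes dim: "2 \<le> CARD('n)"
    and domain: "\<Omega> \<noteq> {}" "open \<Omega>" "bounded \<Omega>" "connected \<Omega>" "lipschitz_boundary \<Omega>"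
    and p_gt_1: "\<forall>x\<in>closure \<Omega>. 1 < p x"
    and p_cases:
      "(log_holder_on (closure \<Omega>) p \<and>
          2 * real CARD('n) / (real CARD('n) + 2) \<le> (INF x\<in>closure \<Omega>. p x)) \<or>
       (continuous_on (closure \<Omega>) p \<and>
          2 * real CARD('n) / (real CARD('n) + 2) < (INF x\<in>closure \<Omega>. p x))"
    and Psi_pos: "\<forall>x\<in>closure \<Omega>. \<forall>s>0. 0 < \<Psi> x s"
    and Psi_meas: "\<forall>s>0. (\<lambda>x. \<Psi> x s) \<in> borel_measurable (lebesgue_on (closure \<Omega>))"
    and Psi_ac: "AE x in lebesgue_on \<Omega>. locally_abs_continuous_on_pos (\<Psi> x)"
    and Psi_lim: "AE x in lebesgue_on \<Omega>. ((\<lambda>s. \<Psi> x s * s) \<longlongrightarrow> 0) (at_right 0)"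
    and Psi_mono: "AE x in lebesgue_on \<Omega>. strict_mono_on {0<..} (\<lambda>s. \<Psi> x s * s)"
    and Phi_Lp': "\<forall>v\<in>Lp_var \<Omega> p. (\<lambda>x. Phi \<Psi> x (v x)) \<in> Lp_var \<Omega> (conj_exponent p)"
    and coercive:
      "\<forall>V :: nat \<Rightarrow> real ^ 'n \<Rightarrow> real. (\<forall>k. V k \<in> W1p_var \<Omega> p) \<and>
         filterlim (\<lambda>k. LINT x|lebesgue_on \<Omega>. norm (weak_gradient \<Omega> (V k) x) powr p x)
           at_top sequentially \<longrightarrow>
         filterlim (\<lambda>k. LINT x|lebesgue_on \<Omega>. potential \<Psi> x (weak_gradient \<Omega> (V k) x))
           at_top sequentially"
    and delta_pos: "0 < \<delta>\<^sub>0"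
    and b_nonneg: "\<forall>x\<in>closure \<Omega>. \<forall>s\<in>{0..\<delta>\<^sub>0}. 0 \<le> b x s"
    and b_meas: "\<forall>s\<in>{0..\<delta>\<^sub>0}. (\<lambda>x. b x s) \<in> borel_measurable (lebesgue_on (closure \<Omega>))"
    and b_cont: "AE x in lebesgue_on \<Omega>. continuous_on {0..\<delta>\<^sub>0} (b x)"
    and b_L2: "(\<lambda>x. b x 0) \<in> Lp_var \<Omega> (\<lambda>_. 2)" "(\<lambda>x. b x \<delta>\<^sub>0) \<in> Lp_var \<Omega> (\<lambda>_. 2)"
    and b_mono: "AE x in lebesgue_on \<Omega>. strict_mono_on {0..\<delta>\<^sub>0} (b x)"
    and lambda_pos: "0 < lam"
    and g: "g \<in> M_set \<Omega> \<delta>\<^sub>0 b lam"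
  shows "\<exists>V. weak_solution \<Omega> p \<Psi> \<delta>\<^sub>0 b lam g V \<and> V \<in> U_set \<Omega> \<delta>\<^sub>0 \<and>
    (\<forall>W. weak_solution \<Omega> p \<Psi> \<delta>\<^sub>0 b lam g W \<longrightarrow> (AE x in lebesgue_on \<Omega>. W x = V x))"
proof -
  let ?M = "lebesgue_on \<Omega>"
  have lmeas: "\<Omega> \<in> lmeasurable" using domain by (intro lmeasurable_open) auto
  interpret fin: finite_measure ?M using lmeas by (rule finite_measure_lebesgue_on)
  have cl: "compact (closure \<Omega>)" "closure \<Omega> \<noteq> {}" "\<Omega> \<subseteq> closure \<Omega>"
    using domain closure_subset by (auto simp: compact_closure)
  have p_cont: "continuous_on (closure \<Omega>) p"
    using p_cases log_holder_on_imp_continuous_on by blast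
  \<comment> \<open>The minimum is attained on the compact closure and hence exceeds 1 strictly. The
    uniform lower bound \<open>pmin\<close> for the exponent, on which uniform integrability rests,
    is \<open>p x0\<close>.\<close>
  obtain x0 where x0: "x0 \<in> closure \<Omega>" "\<And>x. x \<in> closure \<Omega> \<Longrightarrow> p x0 \<le> p x"
    using continuous_attains_inf[OF cl(1,2) p_cont] by blast
  obtain x1 where x1: "\<And>x. x \<in> closure \<Omega> \<Longrightarrow> p x \<le> p x1"
    using continuous_attains_sup[OF cl(1,2) p_cont] by blast
  have restrict: "f \<in> borel_measurable ?M" if "f \<in> borel_measurable (lebesgue_on (closure \<Omega>))" for f :: "real ^ 'n \<Rightarrow> real"
    by (rule measurable_restrict_mono[OF that cl(3)])
  have p_meas: "p \<in> borel_measurable ?M"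
    by (rule restrict) (rule continuous_imp_measurable_on_sets_lebesgue[OF p_cont], simp)
  have AE_cl: "AE x in ?M. x \<in> closure \<Omega>"
    using cl(3) by (intro AE_I2) auto
  have flux_AE: "AE x in ?M. flux_at \<Psi> x"
    using Psi_ac Psi_lim Psi_mono AE_cl
    by eventually_elim (use Psi_pos in \<open>simp add: flux_at_def\<close>)
  have reaction_AE: "AE x in ?M. reaction_at \<delta>\<^sub>0 b x"
    using b_cont b_mono AE_cl
    by eventually_elim (use b_nonneg delta_pos in \<open>simp add: reaction_at_def\<close>)
  have g': "g \<in> borel_measurable ?M" "AE x in ?M. lam * b x 0 \<le> g x \<and> g x \<le> lam * b x \<delta>\<^sub>0"
    using g by (auto simp: M_set_def Linfty_def)
  obtain g_max where g_max: "AE x in ?M. \<bar>g x\<bar> \<le> g_max"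
    using g by (auto simp: M_set_def Linfty_def)
  have b_int: "integrable ?M (\<lambda>x. b x \<delta>\<^sub>0)"
  proof (rule Bochner_Integration.integrable_bound)
    show "integrable ?M (\<lambda>x. 1 + \<bar>b x \<delta>\<^sub>0\<bar> powr 2)"
      using b_L2(2) by (simp add: Lp_var_def)
    show "AE x in ?M. norm (b x \<delta>\<^sub>0) \<le> norm (1 + \<bar>b x \<delta>\<^sub>0\<bar> powr 2)"
    proof (rule AE_I2)
      fix x
      have "0 \<le> (\<bar>b x \<delta>\<^sub>0\<bar> - 1)\<^sup>2 + 1 + (\<bar>b x \<delta>\<^sub>0\<bar>)\<^sup>2" by simp
      then have "\<bar>b x \<delta>\<^sub>0\<bar> \<le> 1 + (\<bar>b x \<delta>\<^sub>0\<bar>)\<^sup>2" by (simp add: power2_diff)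
      then show "norm (b x \<delta>\<^sub>0) \<le> norm (1 + \<bar>b x \<delta>\<^sub>0\<bar> powr 2)" by simp
    qed
  qed (use b_L2(2) in \<open>simp add: Lp_var_def\<close>)
  interpret elliptic_problem \<Omega> p "p x0" "p x1" \<Psi> b \<delta>\<^sub>0 lam g g_max
  proof
    show "(\<lambda>x. b x s) \<in> borel_measurable ?M" if "s \<in> {0..\<delta>\<^sub>0}" for s
      using b_meas that by (intro restrict) auto
    show "filterlim (\<lambda>k. LINT x|?M. potential \<Psi> x (weak_gradient \<Omega> (V k) x)) at_top sequentially"
      if "\<And>k. V k \<in> W1p_var \<Omega> p"
        "filterlim (\<lambda>k. LINT x|?M. norm (weak_gradient \<Omega> (V k) x) powr p x) at_top sequentially"
      for V :: "nat \<Rightarrow> real ^ 'n \<Rightarrow> real"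
      using coercive that by blast
  qed (use domain lmeas p_meas p_gt_1 x0 x1 cl(3) flux_AE reaction_AE Phi_Lp' delta_pos b_int lambda_pos g' g_max in auto)
  have sol: "weak_solution \<Omega> p \<Psi> \<delta>\<^sub>0 b lam g W \<longleftrightarrow> W \<in> W1p_var \<Omega> p \<and> (\<forall>\<phi>\<in>W1p_var \<Omega> p. weak_eq W \<phi>)" for W
    by (simp add: weak_solution_def weak_eq_def)
  obtain V where V: "V \<in> K" "\<forall>\<phi>\<in>W1p_var \<Omega> p. weak_eq V \<phi>"
    and uniq: "\<forall>W\<in>W1p_var \<Omega> p. (\<forall>\<phi>\<in>W1p_var \<Omega> p. weak_eq W \<phi>) \<longrightarrow> (AE x in ?M. W x = V x)"
    using unique_weak_solution by blast
  have "AE x in ?M. \<bar>V x\<bar> \<le> \<delta>\<^sub>0"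
    using KD(2)[OF V(1)] by eventually_elim simp
  then have "V \<in> U_set \<Omega> \<delta>\<^sub>0"
    using KD(2,3)[OF V(1)] by (auto simp: U_set_def Linfty_def)
  with V(2) uniq KD(1)[OF V(1)] show ?thesis
    unfolding sol by blast
qed

end
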